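(* Let $\mathbb H$ be the rational Cherednik algebra of $G(r,1,n)$ with parameters $\kappa,c_0,\dots,c_{r-1}\in\mathbb C$, and let $\mathfrak t\subseteq\mathbb H$ be the commutative subalgebra generated by $z_1,\dots,z_n$ and $t_{\zeta_1},\dots,t_{\zeta_n}$. Let $S_n$ act on $\mathfrak t$ by simultaneously permuting $z_1,\dots,z_n$ and $t_{\zeta_1},\dots,t_{\zeta_n}$, and let $\phi$ be the automorphism of $\mathfrak t$ with $\phi(t_{\zeta_i})=t_{\zeta_{i+1}}$ and $\phi(z_i)=z_{i+1}$ for $1\le i\le n-1$, and $$\phi(t_{\zeta_n})=\zeta^{-1}t_{\zeta_1},\qquad \phi(z_n)=z_1+\kappa-\sum_{j=0}^{r-1}(d_{j-1}-d_{j-2})\epsilon_{1j}.$$ Then: (a) For $1\le i\le n-1$ and $f\in\mathfrak t$, $\sigma_if=(s_i.f)\sigma_i$. (b) For $f\in\mathfrak t$, $f\Phi=\Phi\,(\phi.f)$ and $f\Psi=\Psi\,(\phi^{-1}.f)$.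
   Context: $\zeta=e^{2\pi i/r}$; $G(r,1,n)$ is the group of $n\times n$ monomial matrices with nonzero entries $r$-th roots of $1$, acting on $\mathfrak h=\mathbb C^n$ (standard basis $y_1,\dots,y_n$) and contragrediently on $\mathfrak h^*$ (dual basis $x_1,\dots,x_n$). $\zeta_i$ is the diagonal matrix with $\zeta$ in position $i$ and $1$ elsewhere, $s_{ij}$ the transposition matrix, $s_i=s_{i,i+1}$. $\mathbb H$ is the $\mathbb C$-algebra generated by $\mathbb C[x_1,\dots,x_n]$, $\mathbb C[y_1,\dots,y_n]$ and $t_w$ ($w\in G(r,1,n)$) with relations $t_wt_v=t_{wv}$, $t_wx=(wx)t_w$, $t_wy=(wy)t_w$ for $x\in\mathfrak h^*$, $y\in\mathfrak h$, and $$y_ix_j=x_jy_i+c_0\sum_{l=0}^{r-1}\zeta^{-l}t_{\zeta_i^ls_{ij}\zeta_i^{-l}}\ (i\ne j),\qquad y_ix_i=x_iy_i+\kappa-\sum_{l=1}^{r-1}c_l(1-\zeta^{-l})t_{\zeta_i^l}-c_0\sum_{j\ne i}\sum_{l=0}^{r-1}t_{\zeta_i^ls_{ij}\zeta_i^{-l}}.$$ Definitions: $d_j=\sum_{l=1}^{r-1}\zeta^{lj}c_l$ for $j\in\mathbb Z$; $\epsilon_{ij}=\frac1r\sum_{l=0}^{r-1}\zeta^{-lj}t_{\zeta_i^l}$; $z_i=y_ix_i+c_0\sum_{1\le j<i}\sum_{l=0}^{r-1}t_{\zeta_i^ls_{ij}\zeta_i^{-l}}$ for $1\le i\le n$ (these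 commute pairwise and with all $t_{\zeta_j}$, and are algebraically independent); $$\pi_i=\sum_{l=0}^{r-1}t_{\zeta_i^l\zeta_{i+1}^{-l}},\qquad \sigma_i=t_{s_i}+\frac{c_0}{z_i-z_{i+1}}\pi_i\ (1\le i\le n-1),\qquad \Phi=x_nt_{s_{n-1}s_{n-2}\cdots s_1},\qquad \Psi=y_1t_{s_1s_2\cdots s_{n-1}}.$$ Let $A\subseteq\mathbb H$ be the subalgebra generated by $z_1,\dots,z_n$ and $\mathbb CG(r,1,n)$. Symmetric polynomials in $z_1,\dots,z_n$ are central in $A$; expressions with denominators in the $z_i$ (in particular $\sigma_i$) are read in the localization of $A$ at the nonzero symmetric polynomials in $z_1,\dots,z_n$. *)

theory Defs
  imports
    "Jordan_Normal_Form.Matrix"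
    "HOL-Algebra.QuotRing"
    "HOL-Algebra.Generated_Rings"
    "HOL-Algebra.Sym_Groups"
    "HOL-Algebra.Group_Action"
    "HOL-Combinatorics.Transposition"
    "HOL-Library.Poly_Mapping"
begin

section \<open>Free algebras\<close>

text \<open>
  Words form a monoid under concatenation, written additively so that they can
  serve as the exponents of a \<^type>\<open>poly_mapping\<close>. The finitely
  supported complex functions on words, with the convolution product of
  \<^theory>\<open>HOL-Library.Poly_Mapping\<close>, are the noncommutative polynomials.
\<close>

datatype 'g free_monoid = Word (letters: "'g list")

instantiation free_monoid :: (type) monoid_add
begin

definition zero_free_monoid :: "'a free_monoid" where
  "zero_free_monoid = Word []"

definition plus_free_monoid :: "'a free_monoid \<Rightarrow> 'a free_monoid \<Rightarrow> 'a free_monoid" where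
  "plus_free_monoid u v = Word (letters u @ letters v)"

instance
  by intro_classes (simp_all add: zero_free_monoid_def plus_free_monoid_def)

end

type_synonym 'g ncpoly = "'g free_monoid \<Rightarrow>\<^sub>0 complex"

definition var :: "'g \<Rightarrow> 'g ncpoly" where
  "var g = Poly_Mapping.single (Word [g]) 1"

definition scal :: "complex \<Rightarrow> 'g ncpoly" where
  "scal a = Poly_Mapping.single 0 a"

definition free_algebra :: "'g set \<Rightarrow> 'g ncpoly ring" where
  "free_algebra \<Gamma> =
     \<lparr> carrier = {p. \<forall>w \<in> Poly_Mapping.keys p. set (letters w) \<subseteq> \<Gamma>},
       mult = (*), one = 1, zero = 0, add = (+) \<rparr>"


section \<open>Localization at a central multiplicative set\<close>

text \<open>
  The definitions make sense for any ring and any subset; they yield a ring whenever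
  \<open>S\<close> is a multiplicative set of central elements.
\<close>

definition frac_rel :: "('a, 'm) ring_scheme \<Rightarrow> 'a set \<Rightarrow> (('a \<times> 'a) \<times> ('a \<times> 'a)) set" where
  "frac_rel R S =
     {((a, s), (b, t)). a \<in> carrier R \<and> b \<in> carrier R \<and> s \<in> S \<and> t \<in> S \<and>
        (\<exists>u \<in> S. u \<otimes>\<^bsub>R\<^esub> (t \<otimes>\<^bsub>R\<^esub> a) = u \<otimes>\<^bsub>R\<^esub> (s \<otimes>\<^bsub>R\<^esub> b))}"

definition fraction :: "('a, 'm) ring_scheme \<Rightarrow> 'a set \<Rightarrow> 'a \<Rightarrow> 'a \<Rightarrow> ('a \<times> 'a) set" where
  "fraction R S a s = frac_rel R S `` {(a, s)}"

definition localization :: "('a, 'm) ring_scheme \<Rightarrow> 'a set \<Rightarrow> ('a \<times> 'a) set ring" where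
  "localization R S =
     \<lparr> carrier = (carrier R \<times> S) // frac_rel R S,
       mult = (\<lambda>P Q. \<Union>(a, s) \<in> P. \<Union>(b, t) \<in> Q. fraction R S (a \<otimes>\<^bsub>R\<^esub> b) (s \<otimes>\<^bsub>R\<^esub> t)),
       one = fraction R S \<one>\<^bsub>R\<^esub> \<one>\<^bsub>R\<^esub>,
       zero = fraction R S \<zero>\<^bsub>R\<^esub> \<one>\<^bsub>R\<^esub>,
       add = (\<lambda>P Q. \<Union>(a, s) \<in> P. \<Union>(b, t) \<in> Q.
                fraction R S ((t \<otimes>\<^bsub>R\<^esub> a) \<oplus>\<^bsub>R\<^esub> (s \<otimes>\<^bsub>R\<^esub> b)) (s \<otimes>\<^bsub>R\<^esub> t)) \<rparr>"


section \<open>Symmetric polynomials\<close>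

text \<open>
  Polynomials in commuting variables indexed by \<open>{1..n}\<close>: finitely supported functions on
  exponent vectors. The permutation \<open>w\<close> acts by relabelling the variables.
\<close>

definition symmetric_polys :: "nat \<Rightarrow> ((nat \<Rightarrow>\<^sub>0 nat) \<Rightarrow>\<^sub>0 complex) set" where
  "symmetric_polys n =
     {p. (\<forall>m \<in> Poly_Mapping.keys p. Poly_Mapping.keys m \<subseteq> {1..n}) \<and>
         (\<forall>w m. w permutes {1..n} \<longrightarrow>
            Poly_Mapping.lookup p (Poly_Mapping.map_key w m) = Poly_Mapping.lookup p m)}"


section \<open>The group \<open>G(r,1,n)\<close> and the rational Cherednik algebra\<close>

text \<open>
  All indices of basis vectors run through \<open>{1..n}\<close>, whereas matrix entries are addressed
  from \<open>0\<close>; hence the shifts \<open>i - 1\<close> below.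
\<close>

datatype gen = X nat | Y nat | T "complex mat"

locale cherednik =
  fixes r n :: nat and \<kappa> :: complex and c :: "nat \<Rightarrow> complex"
begin

definition \<zeta> :: complex where
  "\<zeta> = exp (2 * of_real pi * \<i> / of_nat r)"

definition G :: "complex mat monoid" where
  "G = \<lparr> carrier = {M \<in> carrier_mat n n.
             (\<forall>a<n. \<exists>!b. b < n \<and> M $$ (a, b) \<noteq> 0) \<and>
             (\<forall>b<n. \<exists>!a. a < n \<and> M $$ (a, b) \<noteq> 0) \<and>
             (\<forall>a<n. \<forall>b<n. M $$ (a, b) \<noteq> 0 \<longrightarrow> M $$ (a, b) ^ r = 1)},
         mult = (*), one = 1\<^sub>m n \<rparr>"

definition zeta_mat :: "nat \<Rightarrow> complex mat" where
  "zeta_mat i = mat n n (\<lambda>(a, b). if a = b then (if a = i - 1 then \<zeta> else 1) else 0)"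

definition s :: "nat \<Rightarrow> nat \<Rightarrow> complex mat" where
  "s i j = mat n n (\<lambda>(a, b). if a = transpose (i - 1) (j - 1) b then 1 else 0)"

definition zeta_pow :: "nat \<Rightarrow> int \<Rightarrow> complex mat" where
  "zeta_pow i l = zeta_mat i [^]\<^bsub>G\<^esub> l"

definition s_conj :: "nat \<Rightarrow> nat \<Rightarrow> nat \<Rightarrow> complex mat" where
  "s_conj i j l = zeta_pow i (int l) \<otimes>\<^bsub>G\<^esub> s i j \<otimes>\<^bsub>G\<^esub> zeta_pow i (- int l)"

definition G_list_prod :: "complex mat list \<Rightarrow> complex mat" where
  "G_list_prod ws = foldr (\<lambda>v w. v \<otimes>\<^bsub>G\<^esub> w) ws \<one>\<^bsub>G\<^esub>"

definition gens :: "gen set" where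
  "gens = X ` {1..n} \<union> Y ` {1..n} \<union> T ` carrier G"

definition x :: "nat \<Rightarrow> gen ncpoly" where "x i = var (X i)"
definition y :: "nat \<Rightarrow> gen ncpoly" where "y i = var (Y i)"
definition t :: "complex mat \<Rightarrow> gen ncpoly" where "t w = var (T w)"

text \<open>
  \<open>w y\<^sub>j\<close> is given by the \<open>j\<close>-th column of \<open>w\<close>; \<open>w x\<^sub>j\<close> is determined by
  \<open>(w x\<^sub>j)(y\<^sub>i) = x\<^sub>j (w\<inverse> y\<^sub>i)\<close>.
\<close>

definition act_y :: "complex mat \<Rightarrow> nat \<Rightarrow> gen ncpoly" where
  "act_y w j = (\<Sum>i = 1..n. scal (w $$ (i - 1, j - 1)) * y i)"

definition act_x :: "complex mat \<Rightarrow> nat \<Rightarrow> gen ncpoly" where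
  "act_x w j = (\<Sum>i = 1..n. scal ((inv\<^bsub>G\<^esub> w) $$ (j - 1, i - 1)) * x i)"

text \<open>
  Each relation \<open>u = v\<close> is recorded as \<open>u - v\<close>. As \<open>w \<mapsto> t\<^sub>w\<close> is to map the group algebra
  to a unital subalgebra, \<open>t\<^sub>1 = 1\<close> is among the relations. By linearity,
  the relations with \<open>h\<close> and its dual are needed for basis vectors only.
\<close>

definition relations :: "gen ncpoly set" where
  "relations =
     {x i * x j - x j * x i | i j. i \<in> {1..n} \<and> j \<in> {1..n}} \<union>
     {y i * y j - y j * y i | i j. i \<in> {1..n} \<and> j \<in> {1..n}} \<union>
     {t \<one>\<^bsub>G\<^esub> - 1} \<union>
     {t w * t v - t (w \<otimes>\<^bsub>G\<^esub> v) | w v. w \<in> carrier G \<and> v \<in> carrier G} \<union>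
     {t w * x j - act_x w j * t w | w j. w \<in> carrier G \<and> j \<in> {1..n}} \<union>
     {t w * y j - act_y w j * t w | w j. w \<in> carrier G \<and> j \<in> {1..n}} \<union>
     {y i * x j -
        (x j * y i + scal (c 0) * (\<Sum>l<r. scal (\<zeta> powi (- int l)) * t (s_conj i j l)))
      | i j. i \<in> {1..n} \<and> j \<in> {1..n} \<and> i \<noteq> j} \<union>
     {y i * x i -
        (x i * y i + scal \<kappa>
         - (\<Sum>l = 1..<r. scal (c l * (1 - \<zeta> powi (- int l))) * t (zeta_pow i (int l)))
         - scal (c 0) * (\<Sum>j \<in> {1..n} - {i}. \<Sum>l<r. t (s_conj i j l)))
      | i. i \<in> {1..n}}"

definition rel_ideal :: "gen ncpoly set" where
  "rel_ideal = Idl\<^bsub>free_algebra gens\<^esub> relations"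

definition H :: "gen ncpoly set ring" where
  "H = free_algebra gens Quot rel_ideal"

text \<open>The canonical surjection from the free algebra; elements of \<open>H\<close> are written as
  images of noncommutative polynomials.\<close>

definition cls :: "gen ncpoly \<Rightarrow> gen ncpoly set" where
  "cls p = rel_ideal +>\<^bsub>free_algebra gens\<^esub> p"

definition subalgebra_gen :: "gen ncpoly set set \<Rightarrow> gen ncpoly set ring" where
  "subalgebra_gen E = H\<lparr>carrier := generate_ring H (range (\<lambda>a. cls (scal a)) \<union> E)\<rparr>"

definition d :: "int \<Rightarrow> complex" where
  "d j = (\<Sum>l = 1..<r. \<zeta> powi (int l * j) * c l)"

definition \<epsilon> :: "nat \<Rightarrow> int \<Rightarrow> gen ncpoly" where
  "\<epsilon> i j = scal (1 / of_nat r) *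
     (\<Sum>l<r. scal (\<zeta> powi (- int l * j)) * t (zeta_pow i (int l)))"

definition z :: "nat \<Rightarrow> gen ncpoly" where
  "z i = y i * x i + scal (c 0) * (\<Sum>j = 1..<i. \<Sum>l<r. t (s_conj i j l))"

definition \<pi> :: "nat \<Rightarrow> gen ncpoly" where
  "\<pi> i = (\<Sum>l<r. t (zeta_pow i (int l) \<otimes>\<^bsub>G\<^esub> zeta_pow (i + 1) (- int l)))"

definition \<Phi> :: "gen ncpoly set" where
  "\<Phi> = cls (x n * t (G_list_prod (map (\<lambda>i. s i (i + 1)) (rev [1..<n]))))"

definition \<Psi> :: "gen ncpoly set" where
  "\<Psi> = cls (y 1 * t (G_list_prod (map (\<lambda>i. s i (i + 1)) [1..<n])))"

definition \<tt> :: "gen ncpoly set ring" where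
  "\<tt> = subalgebra_gen ((\<lambda>i. cls (z i)) ` {1..n} \<union> (\<lambda>i. cls (t (zeta_mat i))) ` {1..n})"

definition A :: "gen ncpoly set ring" where
  "A = subalgebra_gen ((\<lambda>i. cls (z i)) ` {1..n} \<union> (\<lambda>w. cls (t w)) ` carrier G)"

definition eval_z :: "((nat \<Rightarrow>\<^sub>0 nat) \<Rightarrow>\<^sub>0 complex) \<Rightarrow> gen ncpoly set" where
  "eval_z p = cls (\<Sum>m \<in> Poly_Mapping.keys p.
     scal (Poly_Mapping.lookup p m) *
     prod_list (map (\<lambda>i. z i ^ Poly_Mapping.lookup m i) [1..<n + 1]))"

definition denominators :: "gen ncpoly set set" where
  "denominators = eval_z ` (symmetric_polys n - {0})"

definition A_loc :: "(gen ncpoly set \<times> gen ncpoly set) set ring" where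
  "A_loc = localization A denominators"

definition \<iota> :: "gen ncpoly set \<Rightarrow> (gen ncpoly set \<times> gen ncpoly set) set" where
  "\<iota> a = fraction A denominators a \<one>\<^bsub>A\<^esub>"

text \<open>\<open>z\<^sub>i - z\<^sub>i\<^sub>+\<^sub>1\<close> divides the symmetric polynomial \<open>\<Prod>\<^bsub>j < k\<^esub> (z\<^sub>j - z\<^sub>k)\<^sup>2\<close>, so it is a unit of
  the localization although it is not itself a denominator.\<close>

definition \<sigma> :: "nat \<Rightarrow> (gen ncpoly set \<times> gen ncpoly set) set" where
  "\<sigma> i = \<iota> (cls (t (s i (i + 1)))) \<oplus>\<^bsub>A_loc\<^esub>
     \<iota> (cls (scal (c 0))) \<otimes>\<^bsub>A_loc\<^esub> inv\<^bsub>A_loc\<^esub> (\<iota> (cls (z i - z (i + 1)))) \<otimes>\<^bsub>A_loc\<^esub> \<iota> (cls (\<pi> i))"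

definition algebra_aut :: "gen ncpoly set ring \<Rightarrow> (gen ncpoly set \<Rightarrow> gen ncpoly set) \<Rightarrow> bool" where
  "algebra_aut B f \<longleftrightarrow> f \<in> ring_iso B B \<and> (\<forall>a. f (cls (scal a)) = cls (scal a))"

definition permutation_action :: "((nat \<Rightarrow> nat) \<Rightarrow> gen ncpoly set \<Rightarrow> gen ncpoly set) \<Rightarrow> bool" where
  "permutation_action act \<longleftrightarrow>
     group_action (sym_group n) (carrier \<tt>) act \<and>
     (\<forall>w. w permutes {1..n} \<longrightarrow>
        algebra_aut \<tt> (act w) \<and>
        (\<forall>i \<in> {1..n}. act w (cls (z i)) = cls (z (w i)) \<and>
                      act w (cls (t (zeta_mat i))) = cls (t (zeta_mat (w i)))))"

definition shift_automorphism :: "(gen ncpoly set \<Rightarrow> gen ncpoly set) \<Rightarrow> bool" where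
  "shift_automorphism f \<longleftrightarrow>
     algebra_aut \<tt> f \<and>
     (\<forall>i \<in> {1..<n}. f (cls (t (zeta_mat i))) = cls (t (zeta_mat (i + 1))) \<and>
                    f (cls (z i)) = cls (z (i + 1))) \<and>
     f (cls (t (zeta_mat n))) = cls (scal (inverse \<zeta>) * t (zeta_mat 1)) \<and>
     f (cls (z n)) =
       cls (z 1 + scal \<kappa>
            - (\<Sum>j<r. scal (d (int j - 1) - d (int j - 2)) * \<epsilon> 1 (int j)))"

end

end

theory Submission
  imports Defs
begin

text \<open>
  Write \<open>Y\<^sub>i = y\<^sub>i x\<^sub>i\<close> and let \<open>B\<^sub>i\<^sub>j\<close> be the sum of the reflections
  \<open>\<zeta>\<^sub>i\<^sup>l s\<^sub>i\<^sub>j \<zeta>\<^sub>i\<^sup>-\<^sup>l\<close>, so that \<open>z\<^sub>i = Y\<^sub>i + c\<^sub>0 \<Sum>\<^bsub>j<i\<^esub> B\<^sub>i\<^sub>j\<close>. Conjugation by a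
  monomial matrix permutes the \<open>Y\<^sub>i\<close> and the \<open>B\<^sub>i\<^sub>j\<close>. With \<open>[Y\<^sub>i, Y\<^sub>j] = c\<^sub>0 (Y\<^sub>j - Y\<^sub>i) B\<^sub>i\<^sub>j\<close>
  and the Jucys-Murphy argument this shows that the \<open>z\<^sub>i\<close> commute, and it gives
  \<open>t\<^bsub>s\<^sub>i\<^esub> z\<^sub>i = z\<^sub>i\<^sub>+\<^sub>1 t\<^bsub>s\<^sub>i\<^esub> - c\<^sub>0 \<pi>\<^sub>i\<close>. Hence \<open>(z\<^sub>i - z\<^sub>i\<^sub>+\<^sub>1) \<sigma>\<^sub>i\<close> intertwines the generators of
  \<open>\<tt>\<close>, and the intertwining passes from generators to the whole subalgebra. For \<open>\<Phi>\<close> and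
  \<open>\<Psi>\<close> one moves \<open>x\<^sub>n\<close> and \<open>y\<^sub>1\<close> past \<open>z\<^sub>i\<close>. The localization makes sense because
  symmetric polynomials in the \<open>z\<^sub>i\<close> are central, and \<open>z\<^sub>i - z\<^sub>i\<^sub>+\<^sub>1\<close> is invertible there because it
  divides \<open>\<Prod>\<^bsub>w\<^esub> (z\<^bsub>w(i)\<^esub> - z\<^bsub>w(i+1)\<^esub>)\<close>, the product over all permutations.
\<close>

section \<open>Linear extensions of monoid homomorphisms\<close>

text \<open>Inside H every step would carry a membership condition, and the simplification rules of
  type classes could not be used. Hence all identities are derived in a locale over an arbitrary
  ring type and carried over to H by an embedding of the quotient. Group elements appear there as a
  permutation with coefficients, and sums over exponents l as sums over roots of unity. The
  automorphisms are known only through their values on generators; therefore each claim is cast as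
  h(f) v = v k(f) with ring homomorphisms h and k, a form that survives sums, products and
  negatives. Symmetric polynomials are central for this reason: s_i commutes with z_i + z_{i+1} and
  with z_i z_{i+1}, since the terms in \<pi>_i cancel, and each monomial plus its image under s_i is
  a polynomial in these two and the other z_j. The formula for \<phi>(z_n) arises because
  \<zeta>_n^l picks up the scalar \<zeta>^{-l} when it passes x_n; Fourier inversion on Z/r turns
  the resulting sum over l into a combination of idempotents with coefficients d_{j-1} -
  d_{j-2}.\<close>

definition monoid_ext :: "(complex \<Rightarrow> 'b::ring) \<Rightarrow> ('m \<Rightarrow> 'b) \<Rightarrow> ('m \<Rightarrow>\<^sub>0 complex) \<Rightarrow> 'b" where
  "monoid_ext S M p = (\<Sum>m \<in> Poly_Mapping.keys p. S (Poly_Mapping.lookup p m) * M m)"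

lemma sum_singles: "p = (\<Sum>m \<in> Poly_Mapping.keys p. Poly_Mapping.single m (Poly_Mapping.lookup p m))"
proof (rule poly_mapping_eqI)
  fix k
  show "Poly_Mapping.lookup p k =
      Poly_Mapping.lookup (\<Sum>m \<in> Poly_Mapping.keys p. Poly_Mapping.single m (Poly_Mapping.lookup p m)) k"
    by (cases "k \<in> Poly_Mapping.keys p")
      (auto simp: lookup_sum lookup_single when_def in_keys_iff
         intro: sum.neutral)
qed

text \<open>Three maps are of this kind: the retraction onto words in given letters, the relabelling
  of variables, and evaluation at the z_i. The target class is \<open>ring\<close>, without a unit,
  because evaluation takes values in \<open>quotients\<close>.\<close>

locale monoid_extension =
  fixes S :: "complex \<Rightarrow> 'b::ring" and M :: "'m::monoid_add \<Rightarrow> 'b"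
  assumes S_add: "S (a + b) = S a + S b"
    and S_mult: "S (a * b) = S a * S b"
    and S_M: "M m * S a = S a * M m"
    and M_add: "M (m + k) = M m * M k"
begin

lemma S_0: "S 0 = 0"
  using S_add[of 0 0] by simp

abbreviation "ext \<equiv> monoid_ext S M"

lemma ext_superset:
  assumes "finite F" "Poly_Mapping.keys p \<subseteq> F"
  shows "ext p = (\<Sum>m \<in> F. S (Poly_Mapping.lookup p m) * M m)"
  unfolding monoid_ext_def
  by (rule sum.mono_neutral_left) (use assms S_0 in \<open>auto simp: in_keys_iff\<close>)

lemma ext_0: "ext 0 = 0"
  by (simp add: monoid_ext_def)

lemma ext_single: "ext (Poly_Mapping.single m a) = S a * M m"
  by (subst ext_superset[of "{m}"]) auto

lemma ext_add: "ext (p + q) = ext p + ext q"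
proof -
  let ?F = "Poly_Mapping.keys p \<union> Poly_Mapping.keys q"
  have "ext (p + q) = (\<Sum>m \<in> ?F. S (Poly_Mapping.lookup (p + q) m) * M m)"
    by (rule ext_superset) (use keys_add[of p q] in auto)
  then show ?thesis
    by (simp add: ext_superset[of ?F p] ext_superset[of ?F q] lookup_add S_add distrib_right sum.distrib)
qed

lemma ext_sum: "ext (sum f F) = (\<Sum>i \<in> F. ext (f i))"
  by (induction F rule: infinite_finite_induct) (simp_all add: ext_0 ext_add)

lemma ext_uminus: "ext (- p) = - ext p"
  using ext_add[of p "- p"] by (simp add: ext_0 minus_unique)

lemma ext_diff: "ext (p - q) = ext p - ext q"
  using ext_add[of p "- q"] by (simp add: ext_uminus)

lemma ext_single_mult: "ext (Poly_Mapping.single m a * Poly_Mapping.single k b) =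
    ext (Poly_Mapping.single m a) * ext (Poly_Mapping.single k b)"
proof -
  have "S a * S b * (M m * M k) = S a * M m * (S b * M k)"
    by (metis S_M mult.assoc)
  then show ?thesis
    by (simp add: mult_single ext_single S_mult M_add)
qed

lemma ext_mult: "ext (p * q) = ext p * ext q"
proof -
  let ?s = "\<lambda>p m. Poly_Mapping.single m (Poly_Mapping.lookup p m)"
  have "p * q = (\<Sum>m \<in> Poly_Mapping.keys p. ?s p m) * (\<Sum>k \<in> Poly_Mapping.keys q. ?s q k)"
    by (simp flip: sum_singles)
  then have "ext (p * q) = (\<Sum>m \<in> Poly_Mapping.keys p. \<Sum>k \<in> Poly_Mapping.keys q. ext (?s p m * ?s q k))"
    by (simp add: sum_product ext_sum)
  also have "\<dots> = ext (\<Sum>m \<in> Poly_Mapping.keys p. ?s p m) * ext (\<Sum>k \<in> Poly_Mapping.keys q. ?s q k)"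
    by (simp add: ext_single_mult ext_sum sum_product)
  finally show ?thesis
    by (simp flip: sum_singles)
qed

end


section \<open>The product of all quotients of a ring\<close>

text \<open>
  A quotient by an ideal that depends on parameters is not a type. The product over all
  ideals is one, and each individual quotient embeds into it as a ring, though not unitally.
  Identities in a single quotient thus become identities in an instance of
  \<^class>\<open>ring\<close>.
\<close>

definition two_sided :: "'a::ring set \<Rightarrow> bool" where
  "two_sided K \<longleftrightarrow> 0 \<in> K \<and> (\<forall>a \<in> K. \<forall>b \<in> K. a - b \<in> K) \<and> (\<forall>a \<in> K. \<forall>b. a * b \<in> K \<and> b * a \<in> K)"

lemma two_sided_diff: "two_sided K \<Longrightarrow> a \<in> K \<Longrightarrow> b \<in> K \<Longrightarrow> a - b \<in> K"
  and two_sided_zero: "two_sided K \<Longrightarrow> 0 \<in> K"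
  and two_sided_mult_right: "two_sided K \<Longrightarrow> a \<in> K \<Longrightarrow> a * b \<in> K"
  and two_sided_mult_left: "two_sided K \<Longrightarrow> a \<in> K \<Longrightarrow> b * a \<in> K"
  by (auto simp: two_sided_def)

lemma two_sided_uminus: "two_sided K \<Longrightarrow> a \<in> K \<Longrightarrow> - a \<in> K"
  using two_sided_diff[of K 0 a] by (auto simp: two_sided_zero)

lemma two_sided_add: "two_sided K \<Longrightarrow> a \<in> K \<Longrightarrow> b \<in> K \<Longrightarrow> a + b \<in> K"
  using two_sided_diff[of K a "- b"] by (auto simp: two_sided_uminus)

text \<open>A function on all subsets stands for the family of its classes modulo K; its values at
  sets that are not two-sided ideals are ignored.\<close>

definition quotients_rel :: "('a::ring set \<Rightarrow> 'a) \<Rightarrow> ('a set \<Rightarrow> 'a) \<Rightarrow> bool" where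
  "quotients_rel f g \<longleftrightarrow> (\<forall>K. two_sided K \<longrightarrow> f K - g K \<in> K)"

quotient_type (overloaded) 'a quotients = "'a::ring set \<Rightarrow> 'a" / quotients_rel
proof (rule equivpI)
  show "reflp (quotients_rel :: ('a set \<Rightarrow> 'a) \<Rightarrow> _)"
    by (auto simp: reflp_def quotients_rel_def two_sided_zero)
  show "symp (quotients_rel :: ('a set \<Rightarrow> 'a) \<Rightarrow> _)"
    unfolding symp_def quotients_rel_def by (metis two_sided_uminus minus_diff_eq)
  show "transp (quotients_rel :: ('a set \<Rightarrow> 'a) \<Rightarrow> _)"
    unfolding transp_def quotients_rel_def by (metis two_sided_add diff_add_cancel add_diff_eq)
qed

instantiation quotients :: (ring) ring
begin

lift_definition zero_quotients :: "'a quotients" is "\<lambda>_. 0" .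

lift_definition plus_quotients :: "'a quotients \<Rightarrow> 'a quotients \<Rightarrow> 'a quotients"
  is "\<lambda>f g K. f K + g K"
  by (simp add: quotients_rel_def add_diff_add two_sided_add)

lift_definition uminus_quotients :: "'a quotients \<Rightarrow> 'a quotients" is "\<lambda>f K. - f K"
proof -
  fix f g :: "'a set \<Rightarrow> 'a"
  assume *: "quotients_rel f g"
  have "- f K - - g K = - (f K - g K)" for K
    by simp
  then show "quotients_rel (\<lambda>K. - f K) (\<lambda>K. - g K)"
    using * by (metis quotients_rel_def two_sided_uminus)
qed

lift_definition minus_quotients :: "'a quotients \<Rightarrow> 'a quotients \<Rightarrow> 'a quotients"
  is "\<lambda>f g K. f K - g K"
proof -
  fix f f' g g' :: "'a set \<Rightarrow> 'a"
  assume *: "quotients_rel f f'" "quotients_rel g g'"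
  have "f K - g K - (f' K - g' K) = (f K - f' K) - (g K - g' K)" for K
    by (simp add: algebra_simps)
  then show "quotients_rel (\<lambda>K. f K - g K) (\<lambda>K. f' K - g' K)"
    using * unfolding quotients_rel_def by (metis two_sided_diff)
qed

lift_definition times_quotients :: "'a quotients \<Rightarrow> 'a quotients \<Rightarrow> 'a quotients"
  is "\<lambda>f g K. f K * g K"
proof -
  fix f f' g g' :: "'a set \<Rightarrow> 'a"
  assume *: "quotients_rel f f'" "quotients_rel g g'"
  have "f K * g K - f' K * g' K = (f K - f' K) * g K + f' K * (g K - g' K)" for K
    by (simp add: algebra_simps)
  then show "quotients_rel (\<lambda>K. f K * g K) (\<lambda>K. f' K * g' K)"
    using * unfolding quotients_rel_def
    by (metis two_sided_add two_sided_mult_left two_sided_mult_right)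
qed

instance
  by (intro_classes; transfer) (auto simp: quotients_rel_def algebra_simps two_sided_zero)

end

lift_definition quotient_emb :: "'a set \<Rightarrow> 'a::ring \<Rightarrow> 'a quotients"
  is "\<lambda>K a K'. if K' = K then a else 0" .

lemma quotient_emb_eq_iff: "two_sided K \<Longrightarrow> quotient_emb K a = quotient_emb K b \<longleftrightarrow> a - b \<in> K"
  by transfer (auto simp: quotients_rel_def two_sided_zero)

lemma quotient_emb_0 [simp]: "quotient_emb K 0 = 0"
  by transfer (auto simp: quotients_rel_def two_sided_zero)

lemma quotient_emb_add: "quotient_emb K (a + b) = quotient_emb K a + quotient_emb K b"
  by transfer (auto simp: quotients_rel_def two_sided_zero)

lemma quotient_emb_diff: "quotient_emb K (a - b) = quotient_emb K a - quotient_emb K b"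
  by transfer (auto simp: quotients_rel_def two_sided_zero)

lemma quotient_emb_mult: "quotient_emb K (a * b) = quotient_emb K a * quotient_emb K b"
  by transfer (auto simp: quotients_rel_def two_sided_zero)

lemma quotient_emb_sum: "quotient_emb K (sum f F) = (\<Sum>i \<in> F. quotient_emb K (f i))"
  by (induction F rule: infinite_finite_induct) (simp_all add: quotient_emb_add)

section \<open>Localization of noncommutative rings\<close>

locale central_localization = ring R for R (structure) +
  fixes S
  assumes S_carrier: "S \<subseteq> carrier R"
    and one_S: "\<one> \<in> S"
    and mult_S: "s \<in> S \<Longrightarrow> t \<in> S \<Longrightarrow> s \<otimes> t \<in> S"
    and central: "s \<in> S \<Longrightarrow> a \<in> carrier R \<Longrightarrow> s \<otimes> a = a \<otimes> s"
begin

abbreviation "L \<equiv> localization R S"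
abbreviation "fr \<equiv> fraction R S"

lemma S_in: "s \<in> S \<Longrightarrow> s \<in> carrier R"
  using S_carrier by auto

lemma central_lcomm:
  assumes "s \<in> S" "a \<in> carrier R" "b \<in> carrier R"
  shows "s \<otimes> (a \<otimes> b) = a \<otimes> (s \<otimes> b)"
  using assms central[of s a] by (simp add: S_in flip: m_assoc)

text \<open>Only \<open>t\<close> has to move past \<open>a\<close>, so its centrality is enough.
  With this exchange fractions are multiplied and compared factor by factor.\<close>

lemma interchange:
  assumes "s \<in> carrier R" "t \<in> S" "a \<in> carrier R" "b \<in> carrier R"
  shows "(s \<otimes> t) \<otimes> (a \<otimes> b) = (s \<otimes> a) \<otimes> (t \<otimes> b)"
  using assms central_lcomm[of t a b] by (simp add: S_in m_assoc)

lemma frac_relI: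
  assumes "u \<in> S" "u \<otimes> (t \<otimes> a) = u \<otimes> (s \<otimes> b)" "a \<in> carrier R" "b \<in> carrier R" "s \<in> S" "t \<in> S"
  shows "((a, s), (b, t)) \<in> frac_rel R S"
  using assms unfolding frac_rel_def by auto

lemma frac_relE:
  assumes "((a, s), (b, t)) \<in> frac_rel R S"
  obtains u where "u \<in> S" "u \<otimes> (t \<otimes> a) = u \<otimes> (s \<otimes> b)" "a \<in> carrier R" "b \<in> carrier R" "s \<in> S" "t \<in> S"
  using assms unfolding frac_rel_def by auto

text \<open>Elements of \<open>S\<close> may be zero divisors, so the middle denominator
  \<open>t\<close> cannot be cancelled; it joins \<open>u\<close> and \<open>v\<close> in the
  witness \<open>u \<otimes> v \<otimes> t\<close>.\<close>

lemma frac_rel_trans: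
  assumes "((a, s), (b, t)) \<in> frac_rel R S" "((b, t), (d, q)) \<in> frac_rel R S"
  shows "((a, s), (d, q)) \<in> frac_rel R S"
proof -
  obtain u where u: "u \<in> S" "u \<otimes> (t \<otimes> a) = u \<otimes> (s \<otimes> b)"
      "a \<in> carrier R" "b \<in> carrier R" "s \<in> S" "t \<in> S"
    using assms(1) by (rule frac_relE)
  obtain v where v: "v \<in> S" "v \<otimes> (q \<otimes> b) = v \<otimes> (t \<otimes> d)" "d \<in> carrier R" "q \<in> S"
    using assms(2) by (rule frac_relE)
  note [simp] = S_in u v
  have "(u \<otimes> v \<otimes> t) \<otimes> (q \<otimes> a) = v \<otimes> (q \<otimes> (u \<otimes> (t \<otimes> a)))"
    using central_lcomm[of u v "t \<otimes> (q \<otimes> a)"] central_lcomm[of t q a] central_lcomm[of u q "t \<otimes> a"]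
    by (simp add: m_assoc)
  also have "\<dots> = u \<otimes> (s \<otimes> (v \<otimes> (q \<otimes> b)))"
    unfolding u(2) using central_lcomm[of u q "s \<otimes> b"] central_lcomm[of s q b]
      central_lcomm[of u v "s \<otimes> (q \<otimes> b)"] central_lcomm[of s v "q \<otimes> b"]
    by simp
  also have "\<dots> = (u \<otimes> v \<otimes> t) \<otimes> (s \<otimes> d)"
    unfolding v(2) using central_lcomm[of s v "t \<otimes> d"] central_lcomm[of s t d] by (simp add: m_assoc)
  finally show ?thesis
    by (intro frac_relI[of "u \<otimes> v \<otimes> t"] mult_S) auto
qed

lemma frac_rel_sym: "((a, s), (b, t)) \<in> frac_rel R S \<Longrightarrow> ((b, t), (a, s)) \<in> frac_rel R S"
  by (erule frac_relE) (rule frac_relI[OF _ sym]; assumption)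

lemma frac_rel_refl: "a \<in> carrier R \<Longrightarrow> s \<in> S \<Longrightarrow> ((a, s), (a, s)) \<in> frac_rel R S"
  by (rule frac_relI[OF one_S]) auto

lemma fraction_eqI:
  assumes "((a, s), (b, t)) \<in> frac_rel R S"
  shows "fr a s = fr b t"
proof (rule Set.set_eqI)
  fix P show "P \<in> fr a s \<longleftrightarrow> P \<in> fr b t"
    by (cases P) (simp add: fraction_def, metis assms frac_rel_trans frac_rel_sym)
qed

lemma fraction_eqI':
  assumes "t \<otimes> a = s \<otimes> b" "a \<in> carrier R" "b \<in> carrier R" "s \<in> S" "t \<in> S"
  shows "fr a s = fr b t"
  by (rule fraction_eqI, rule frac_relI[OF one_S]) (use assms in auto)

lemma localization_carrier: "carrier L = {fr a s |a s. a \<in> carrier R \<and> s \<in> S}"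
  by (auto simp: localization_def quotient_def fraction_def)

text \<open>The operations of \<open>localization\<close> are unions over all representatives. A
  family that is constant on a nonempty class has that constant as its union, so independence of
  representatives is all that remains to be shown.\<close>

lemma UN_fraction:
  assumes "a \<in> carrier R" "s \<in> S"
    and "\<And>a' s'. ((a, s), (a', s')) \<in> frac_rel R S \<Longrightarrow> F a' s' = C"
  shows "(\<Union>(a', s') \<in> fr a s. F a' s') = C"
proof -
  have "(\<Union>(a', s') \<in> fr a s. F a' s') = (\<Union>p \<in> fr a s. C)"
    using assms(3) by (intro SUP_cong) (auto simp: fraction_def)
  moreover have "(a, s) \<in> fr a s"
    using frac_rel_refl[OF assms(1,2)] by (simp add: fraction_def)
  ultimately show ?thesis
    by auto
qed

lemma localization_mult:
  assumes "a \<in> carrier R" "s \<in> S" "b \<in> carrier R" "t \<in> S"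
  shows "fr a s \<otimes>\<^bsub>L\<^esub> fr b t = fr (a \<otimes> b) (s \<otimes> t)"
proof -
  have "fr (a' \<otimes> b') (s' \<otimes> t') = fr (a \<otimes> b) (s \<otimes> t)"
    if *: "((a, s), (a', s')) \<in> frac_rel R S" "((b, t), (b', t')) \<in> frac_rel R S" for a' s' b' t'
  proof -
    obtain u where u: "u \<in> S" "u \<otimes> (s' \<otimes> a) = u \<otimes> (s \<otimes> a')" "a' \<in> carrier R" "s' \<in> S"
      using *(1) by (rule frac_relE)
    obtain v where v: "v \<in> S" "v \<otimes> (t' \<otimes> b) = v \<otimes> (t \<otimes> b')" "b' \<in> carrier R" "t' \<in> S"
      using *(2) by (rule frac_relE)
    note [simp] = S_in u(1,3,4) v(1,3,4) assms
    have "(u \<otimes> v) \<otimes> ((s' \<otimes> t') \<otimes> (a \<otimes> b)) = (u \<otimes> (s' \<otimes> a)) \<otimes> (v \<otimes> (t' \<otimes> b))"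
      using interchange[of u v "s' \<otimes> a" "t' \<otimes> b"] by (simp add: interchange[of s' t' a b])
    also have "\<dots> = (u \<otimes> v) \<otimes> ((s \<otimes> t) \<otimes> (a' \<otimes> b'))"
      using interchange[of u v "s \<otimes> a'" "t \<otimes> b'"] by (simp add: interchange[of s t a' b'] u(2) v(2))
    finally have "((a \<otimes> b, s \<otimes> t), (a' \<otimes> b', s' \<otimes> t')) \<in> frac_rel R S"
      by (intro frac_relI[of "u \<otimes> v"] mult_S) auto
    then show ?thesis
      by (rule fraction_eqI[symmetric])
  qed
  then show ?thesis
    unfolding localization_def by (simp add: UN_fraction assms)
qed

lemma localization_add:
  assumes "a \<in> carrier R" "s \<in> S" "b \<in> carrier R" "t \<in> S"
  shows "fr a s \<oplus>\<^bsub>L\<^esub> fr b t = fr ((t \<otimes> a) \<oplus> (s \<otimes> b)) (s \<otimes> t)"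
proof -
  have "fr ((t' \<otimes> a') \<oplus> (s' \<otimes> b')) (s' \<otimes> t') = fr ((t \<otimes> a) \<oplus> (s \<otimes> b)) (s \<otimes> t)"
    if *: "((a, s), (a', s')) \<in> frac_rel R S" "((b, t), (b', t')) \<in> frac_rel R S" for a' s' b' t'
  proof -
    obtain u where u: "u \<in> S" "u \<otimes> (s' \<otimes> a) = u \<otimes> (s \<otimes> a')" "a' \<in> carrier R" "s' \<in> S"
      using *(1) by (rule frac_relE)
    obtain v where v: "v \<in> S" "v \<otimes> (t' \<otimes> b) = v \<otimes> (t \<otimes> b')" "b' \<in> carrier R" "t' \<in> S"
      using *(2) by (rule frac_relE)
    note [simp] = S_in u(1,3,4) v(1,3,4) assms
    \<comment> \<open>The two summands of the numerator are compared separately. The first is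
      written as \<open>a \<otimes> t\<close>, so that \<open>interchange\<close> pairs
      \<open>s'\<close> with \<open>a\<close> and \<open>t'\<close> with \<open>t\<close>.\<close>
    have "(u \<otimes> v) \<otimes> ((s' \<otimes> t') \<otimes> (a \<otimes> t)) = (u \<otimes> (s' \<otimes> a)) \<otimes> (v \<otimes> (t' \<otimes> t))"
      using interchange[of u v "s' \<otimes> a" "t' \<otimes> t"] by (simp add: interchange[of s' t' a t])
    also have "\<dots> = (u \<otimes> v) \<otimes> ((s \<otimes> t) \<otimes> (a' \<otimes> t'))"
      using central[of t t'] interchange[of u v "s \<otimes> a'" "t \<otimes> t'"]
      by (simp add: interchange[of s t a' t'] u(2))
    finally have 1: "(u \<otimes> v) \<otimes> ((s' \<otimes> t') \<otimes> (t \<otimes> a)) = (u \<otimes> v) \<otimes> ((s \<otimes> t) \<otimes> (t' \<otimes> a'))"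
      using central[of t a] central[of t' a'] by simp
    have "(u \<otimes> v) \<otimes> ((s' \<otimes> t') \<otimes> (s \<otimes> b)) = (u \<otimes> (s' \<otimes> s)) \<otimes> (v \<otimes> (t' \<otimes> b))"
      using interchange[of u v "s' \<otimes> s" "t' \<otimes> b"] by (simp add: interchange[of s' t' s b])
    also have "\<dots> = (u \<otimes> v) \<otimes> ((s \<otimes> t) \<otimes> (s' \<otimes> b'))"
      using central[of s s'] interchange[of u v "s \<otimes> s'" "t \<otimes> b'"]
      by (simp add: interchange[of s t s' b'] v(2))
    finally have 2: "(u \<otimes> v) \<otimes> ((s' \<otimes> t') \<otimes> (s \<otimes> b)) = (u \<otimes> v) \<otimes> ((s \<otimes> t) \<otimes> (s' \<otimes> b'))" .
    have "((t \<otimes> a \<oplus> s \<otimes> b, s \<otimes> t), (t' \<otimes> a' \<oplus> s' \<otimes> b', s' \<otimes> t')) \<in> frac_rel R S"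
      by (intro frac_relI[of "u \<otimes> v"] mult_S) (auto simp: r_distr 1 2)
    then show ?thesis
      by (rule fraction_eqI[symmetric])
  qed
  then show ?thesis
    unfolding localization_def by (simp add: UN_fraction assms)
qed

lemma fraction_closed: "a \<in> carrier R \<Longrightarrow> s \<in> S \<Longrightarrow> fr a s \<in> carrier L"
  by (auto simp: localization_carrier)

lemma localization_one: "\<one>\<^bsub>L\<^esub> = fr \<one> \<one>"
  by (simp add: localization_def)

lemma localization_monoid: "Group.monoid L"
proof (rule monoidI)
  fix P Q U assume "P \<in> carrier L" "Q \<in> carrier L" "U \<in> carrier L"
  then show "P \<otimes>\<^bsub>L\<^esub> Q \<otimes>\<^bsub>L\<^esub> U = P \<otimes>\<^bsub>L\<^esub> (Q \<otimes>\<^bsub>L\<^esub> U)"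
    by (auto simp: localization_carrier localization_mult mult_S S_in m_assoc)
next
  fix P Q assume "P \<in> carrier L" "Q \<in> carrier L"
  then obtain a s b t where "P = fr a s" "Q = fr b t" "a \<in> carrier R" "s \<in> S" "b \<in> carrier R" "t \<in> S"
    by (auto simp: localization_carrier)
  then show "P \<otimes>\<^bsub>L\<^esub> Q \<in> carrier L"
    by (simp add: localization_mult fraction_closed mult_S)
qed (use one_S in \<open>auto simp: localization_carrier localization_one localization_mult S_in\<close>)

text \<open>\<open>a\<close> itself need not be a denominator; a multiple
  \<open>a \<otimes> g\<close> that lies in \<open>S\<close> is enough to invert it.\<close>

lemma fraction_inverse:
  assumes "a \<in> carrier R" "g \<in> carrier R" "a \<otimes> g \<in> S" "g \<otimes> a = a \<otimes> g"
  shows "inv\<^bsub>L\<^esub> (fr a \<one>) = fr g (a \<otimes> g)"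
proof -
  interpret L: Group.monoid L by (rule localization_monoid)
  have "fr (a \<otimes> g) (a \<otimes> g) = fr \<one> \<one>"
    by (rule fraction_eqI') (use assms one_S in auto)
  then show ?thesis
    by (intro L.inv_unique'[symmetric])
      (use assms one_S in \<open>auto simp: localization_one localization_mult fraction_closed S_in\<close>)
qed

text \<open>Over the common denominator \<open>v \<otimes> g\<close> the element \<sigma> is a
  single fraction, and the claim becomes the identity of numerators in \<open>R\<close>.\<close>

lemma fraction_intertwine:
  assumes N: "\<sigma> = fr a \<one> \<oplus>\<^bsub>L\<^esub> fr k \<one> \<otimes>\<^bsub>L\<^esub> inv\<^bsub>L\<^esub> (fr v \<one>) \<otimes>\<^bsub>L\<^esub> fr b \<one>"
    and carr: "a \<in> carrier R" "k \<in> carrier R" "v \<in> carrier R" "b \<in> carrier R" "g \<in> carrier R"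
      "f \<in> carrier R" "f' \<in> carrier R"
    and g: "v \<otimes> g \<in> S" "g \<otimes> v = v \<otimes> g"
    and intertwine: "(v \<otimes> g \<otimes> a \<oplus> k \<otimes> g \<otimes> b) \<otimes> f = f' \<otimes> (v \<otimes> g \<otimes> a \<oplus> k \<otimes> g \<otimes> b)"
  shows "\<sigma> \<otimes>\<^bsub>L\<^esub> fr f \<one> = fr f' \<one> \<otimes>\<^bsub>L\<^esub> \<sigma>"
proof -
  have "\<sigma> = fr (v \<otimes> g \<otimes> a \<oplus> k \<otimes> g \<otimes> b) (v \<otimes> g)"
    unfolding N using carr g one_S
    by (simp add: fraction_inverse localization_mult localization_add S_in)
  then show ?thesis
    using carr g one_S intertwine by (simp add: localization_mult)
qed

end

section \<open>Computations with the defining relations\<close>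

declare One_nat_def [simp del]

abbreviation unit_roots :: "nat \<Rightarrow> complex set" where
  "unit_roots r \<equiv> {\<xi>. \<xi> ^ r = 1}"

text \<open>Column coefficients of the reflection \<open>\<zeta>\<^sub>i\<^sup>l s\<^sub>i\<^sub>j \<zeta>\<^sub>i\<^sup>-\<^sup>l\<close> for \<open>\<xi> = \<zeta>\<^sup>l\<close>.\<close>

definition refl_coeff :: "nat \<Rightarrow> nat \<Rightarrow> complex \<Rightarrow> nat \<Rightarrow> complex" where
  "refl_coeff i j \<xi> = (\<lambda>_. 1)(j := \<xi>, i := inverse \<xi>)"

text \<open>
  \<open>t p a\<close> stands for the monomial matrix sending \<open>y\<^sub>j\<close> to \<open>a\<^sub>j y\<^bsub>p(j)\<^esub>\<close>,
  and \<open>e\<close> for the sum of the terms in \<open>y\<^sub>i x\<^sub>i\<close> that involve the parameters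
  \<open>c\<^sub>l\<close> with \<open>l > 0\<close>. The ring need not be unital; \<open>sc 1\<close> plays the role of the unit.
\<close>

locale cherednik_relations =
  fixes r n :: nat and c0 \<kappa> :: complex and \<gamma> :: "nat \<Rightarrow> complex" and \<zeta> :: complex
    and sc :: "complex \<Rightarrow> 'a::ring" and x y :: "nat \<Rightarrow> 'a"
    and t :: "(nat \<Rightarrow> nat) \<Rightarrow> (nat \<Rightarrow> complex) \<Rightarrow> 'a"
  assumes r_pos: "r > 0" and n_pos: "n > 0" and zeta_r: "\<zeta> ^ r = 1"
    and sc_add: "sc (u + v) = sc u + sc v"
    and sc_mult: "sc (u * v) = sc u * sc v"
    and x_sc: "x i * sc u = sc u * x i"
    and y_sc: "y i * sc u = sc u * y i"
    and t_sc: "t p a * sc u = sc u * t p a"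
    and sc_1_x: "sc 1 * x i = x i"
    and sc_1_y: "sc 1 * y i = y i"
    and sc_1_t: "sc 1 * t p a = t p a"
    and t_cong: "(\<And>i. i \<in> {1..n} \<Longrightarrow> p i = q i) \<Longrightarrow> (\<And>i. i \<in> {1..n} \<Longrightarrow> a i = b i) \<Longrightarrow> t p a = t q b"
    and t_one: "t id (\<lambda>_. 1) = sc 1"
    and t_mult: "p permutes {1..n} \<Longrightarrow> q permutes {1..n} \<Longrightarrow>
        (\<And>i. i \<in> {1..n} \<Longrightarrow> a i ^ r = 1) \<Longrightarrow> (\<And>i. i \<in> {1..n} \<Longrightarrow> b i ^ r = 1) \<Longrightarrow>
        t p a * t q b = t (p \<circ> q) (\<lambda>j. a (q j) * b j)"
    and t_x: "p permutes {1..n} \<Longrightarrow> (\<And>i. i \<in> {1..n} \<Longrightarrow> a i ^ r = 1) \<Longrightarrow> j \<in> {1..n} \<Longrightarrow>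
        t p a * x j = sc (inverse (a j)) * x (p j) * t p a"
    and t_y: "p permutes {1..n} \<Longrightarrow> (\<And>i. i \<in> {1..n} \<Longrightarrow> a i ^ r = 1) \<Longrightarrow> j \<in> {1..n} \<Longrightarrow>
        t p a * y j = sc (a j) * y (p j) * t p a"
    and x_x: "i \<in> {1..n} \<Longrightarrow> j \<in> {1..n} \<Longrightarrow> x i * x j = x j * x i"
    and y_y: "i \<in> {1..n} \<Longrightarrow> j \<in> {1..n} \<Longrightarrow> y i * y j = y j * y i"
    and y_x: "i \<in> {1..n} \<Longrightarrow> j \<in> {1..n} \<Longrightarrow> i \<noteq> j \<Longrightarrow>
        y i * x j = x j * y i +
          sc c0 * (\<Sum>\<xi> \<in> unit_roots r. sc (inverse \<xi>) * t (transpose i j) (refl_coeff i j \<xi>))"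
    and y_x_same: "i \<in> {1..n} \<Longrightarrow>
        y i * x i = x i * y i + sc \<kappa>
          - (\<Sum>l<r. sc (\<gamma> l) * t id ((\<lambda>_. 1)(i := \<zeta> ^ l)))
          - sc c0 * (\<Sum>j \<in> {1..n} - {i}. \<Sum>\<xi> \<in> unit_roots r. t (transpose i j) (refl_coeff i j \<xi>))"
begin

definition B :: "nat \<Rightarrow> nat \<Rightarrow> 'a" where
  "B i j = (\<Sum>\<xi> \<in> unit_roots r. t (transpose i j) (refl_coeff i j \<xi>))"

definition Y :: "nat \<Rightarrow> 'a" where
  "Y i = y i * x i"

definition z :: "nat \<Rightarrow> 'a" where
  "z i = Y i + sc c0 * (\<Sum>j = 1..<i. B i j)"

lemma sc_sc: "sc u * sc v = sc v * sc u"
  by (metis sc_mult mult.commute)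

lemma B_sc: "B i j * sc u = sc u * B i j"
  by (simp add: B_def sum_distrib_left sum_distrib_right t_sc)

lemma Y_sc: "Y i * sc u = sc u * Y i"
  by (metis Y_def x_sc y_sc mult.assoc)

lemma root_nonzero: "(a::complex) ^ r = 1 \<Longrightarrow> a \<noteq> 0"
  using r_pos by (auto simp: power_0_left)

lemma refl_coeff_root: "\<xi> ^ r = 1 \<Longrightarrow> refl_coeff i j \<xi> k ^ r = 1"
  by (simp add: refl_coeff_def power_inverse)

lemma inverse_root_sum: "(\<Sum>\<xi> \<in> unit_roots r. f (inverse \<xi>)) = (\<Sum>\<xi> \<in> unit_roots r. f \<xi>)"
  by (rule sum.reindex_bij_witness[of _ inverse inverse]) (auto simp: power_inverse)

text \<open>Exchanging the two indices replaces \<xi> by its inverse, which permutes the roots of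
  unity.\<close>

lemma B_sym: "i \<noteq> j \<Longrightarrow> B i j = B j i"
  unfolding B_def
  by (subst inverse_root_sum[symmetric])
    (auto simp: refl_coeff_def fun_upd_twist transpose_commute intro!: sum.cong)

section \<open>Conjugation of \<open>B\<close> and \<open>Y\<close> by monomial matrices\<close>

lemma transpose_permutes: "i \<in> {1..n} \<Longrightarrow> j \<in> {1..n} \<Longrightarrow> transpose i j permutes {1..n}"
  by (rule permutes_swap_id)

text \<open>Conjugation turns the reflection with parameter \<xi> into the one between
  \<open>p j\<close> and \<open>p k\<close> with parameter \<eta> \<xi>, where \<eta> = a_j / a_k.
  Since \<eta> is an r-th root of unity, the sum over all \<xi> absorbs it.\<close>

lemma t_B:
  assumes "p permutes {1..n}" "\<And>i. i \<in> {1..n} \<Longrightarrow> a i ^ r = 1"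
    and "j \<in> {1..n}" "k \<in> {1..n}" "j \<noteq> k"
  shows "t p a * B j k = B (p j) (p k) * t p a"
proof -
  have pj: "p j \<in> {1..n}" "p k \<in> {1..n}" "p j \<noteq> p k"
    using assms permutes_in_image[OF assms(1)] permutes_inj[OF assms(1)] by (auto dest: injD)
  define \<eta> where "\<eta> = a j / a k"
  have eta: "\<eta> ^ r = 1" "a j \<noteq> 0" "a k \<noteq> 0"
    using assms root_nonzero by (auto simp: \<eta>_def power_divide)
  have "t p a * B j k = (\<Sum>\<xi> \<in> unit_roots r. t p a * t (transpose j k) (refl_coeff j k \<xi>))"
    by (simp add: B_def sum_distrib_left)
  also have "\<dots> = (\<Sum>\<xi> \<in> unit_roots r. t (p \<circ> transpose j k) (\<lambda>i. a (transpose j k i) * refl_coeff j k \<xi> i))"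
    using assms by (intro sum.cong refl t_mult transpose_permutes) (auto intro: refl_coeff_root)
  also have "\<dots> = (\<Sum>\<xi> \<in> unit_roots r. t (transpose (p j) (p k) \<circ> p) (\<lambda>i. refl_coeff (p j) (p k) (\<eta> * \<xi>) (p i) * a i))"
  proof (intro sum.cong refl t_cong)
    fix \<xi> i assume "\<xi> \<in> unit_roots r" "i \<in> {1..n}"
    then have "\<xi> \<noteq> 0" using root_nonzero by auto
    show "(p \<circ> transpose j k) i = (transpose (p j) (p k) \<circ> p) i"
      using permutes_inj[OF assms(1)] by (auto simp: transpose_def dest: injD)
    show "a (transpose j k i) * refl_coeff j k \<xi> i = refl_coeff (p j) (p k) (\<eta> * \<xi>) (p i) * a i"
      using permutes_inj[OF assms(1)] assms(5) pj eta \<open>\<xi> \<noteq> 0\<close>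
      by (auto simp: transpose_def refl_coeff_def \<eta>_def field_simps dest: injD)
  qed
  also have "\<dots> = (\<Sum>\<xi> \<in> unit_roots r. t (transpose (p j) (p k) \<circ> p) (\<lambda>i. refl_coeff (p j) (p k) \<xi> (p i) * a i))"
    by (rule sum.reindex_bij_witness[of _ "\<lambda>\<xi>. \<xi> / \<eta>" "\<lambda>\<xi>. \<eta> * \<xi>"])
      (use eta root_nonzero[OF eta(1)] in \<open>auto simp: power_mult_distrib power_divide\<close>)
  also have "\<dots> = (\<Sum>\<xi> \<in> unit_roots r. t (transpose (p j) (p k)) (refl_coeff (p j) (p k) \<xi>) * t p a)"
    using assms pj by (intro sum.cong refl t_mult[symmetric] transpose_permutes) (auto intro: refl_coeff_root)
  finally show ?thesis
    by (simp add: B_def sum_distrib_right)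
qed

text \<open>The scalars picked up by y_j and x_j are inverse to each other, as the two bases are
  dual.\<close>

lemma t_Y:
  assumes "p permutes {1..n}" "\<And>i. i \<in> {1..n} \<Longrightarrow> a i ^ r = 1" "j \<in> {1..n}"
  shows "t p a * Y j = Y (p j) * t p a"
proof -
  have "a j \<noteq> 0" using assms root_nonzero by auto
  have "t p a * Y j = sc (a j) * y (p j) * (t p a * x j)"
    using t_y[of p a j] assms by (simp add: Y_def flip: mult.assoc)
  also have "\<dots> = sc (a j) * (y (p j) * sc (inverse (a j))) * x (p j) * t p a"
    using t_x[of p a j] assms by (simp add: mult.assoc)
  also have "\<dots> = sc (a j * inverse (a j)) * y (p j) * x (p j) * t p a"
    by (simp only: y_sc sc_mult mult.assoc)
  finally show ?thesis
    using \<open>a j \<noteq> 0\<close> by (simp add: Y_def sc_1_y)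
qed

lemma B_Y:
  assumes "i \<in> {1..n}" "j \<in> {1..n}" "k \<in> {1..n}"
  shows "B i j * Y k = Y (transpose i j k) * B i j"
  using assms by (simp add: B_def sum_distrib_left sum_distrib_right t_Y transpose_permutes refl_coeff_root)

section \<open>Commutators of the products y_i x_i\<close>

lemma y_sc_left: "y i * (sc u * a) = sc u * (y i * a)"
  by (metis y_sc mult.assoc)

text \<open>This is the relation between y_i and x_j multiplied by y_j from the left. The factor
  1/\<xi> in each term is exactly the scalar that arises when y_i is moved through the reflection
  and becomes y_j, so the correction is again a multiple of the unweighted sum \<open>B i j\<close>.
  The second form also uses that the y commute.\<close>

lemma x_y:
  assumes "i \<in> {1..n}" "j \<in> {1..n}" "i \<noteq> j"
  shows "y j * (x j * y i) = y j * (y i * x j) - sc c0 * (B i j * y i)"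
    and "y j * (x j * y i) = y i * Y j - sc c0 * (B i j * y i)"
proof -
  have *: "y j * (sc (inverse \<xi>) * t (transpose i j) (refl_coeff i j \<xi>)) =
      t (transpose i j) (refl_coeff i j \<xi>) * y i" if "\<xi> \<in> unit_roots r" for \<xi>
  proof -
    have "t (transpose i j) (refl_coeff i j \<xi>) * y i =
        sc (inverse \<xi>) * y j * t (transpose i j) (refl_coeff i j \<xi>)"
      using t_y[of "transpose i j" "refl_coeff i j \<xi>" i] assms that
      by (simp add: transpose_permutes refl_coeff_root) (simp add: refl_coeff_def)
    then show ?thesis
      by (simp add: y_sc flip: mult.assoc)
  qed
  have "y j * (x j * y i) = y j * (y i * x j - 
      sc c0 * (\<Sum>\<xi> \<in> unit_roots r. sc (inverse \<xi>) * t (transpose i j) (refl_coeff i j \<xi>)))"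
    using y_x[of i j] assms by simp
  also have "\<dots> = y j * (y i * x j) - sc c0 *
      (\<Sum>\<xi> \<in> unit_roots r. y j * (sc (inverse \<xi>) * t (transpose i j) (refl_coeff i j \<xi>)))"
    by (simp add: right_diff_distrib y_sc_left sum_distrib_left)
  also have "\<dots> = y j * (y i * x j) - sc c0 * (B i j * y i)"
    by (simp add: * B_def sum_distrib_right)
  finally show 1: "y j * (x j * y i) = y j * (y i * x j) - sc c0 * (B i j * y i)" .
  show "y j * (x j * y i) = y i * Y j - sc c0 * (B i j * y i)"
    unfolding 1 using y_y[of i j] assms by (simp add: Y_def flip: mult.assoc)
qed

text \<open>The leading term is chosen because it is symmetric in i and j and drops out of the
  commutator.\<close>

lemma Y_Y:
  assumes "i \<in> {1..n}" "j \<in> {1..n}" "i \<noteq> j"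
  shows "Y i * Y j = y i * y j * x i * x j - sc c0 * (Y i * B i j)"
proof -
  have "Y i * Y j = (y i * (x i * y j)) * x j"
    by (simp add: Y_def mult.assoc)
  also have "\<dots> = y i * y j * x i * x j - sc c0 * (B j i * Y j)"
    using x_y(1)[of j i] assms by (simp add: Y_def left_diff_distrib mult.assoc)
  also have "B j i * Y j = Y i * B i j"
    using B_Y[of j i j] B_sym[of i j] assms by simp
  finally show ?thesis .
qed

lemma Y_Y_commutator:
  assumes "i \<in> {1..n}" "j \<in> {1..n}" "i \<noteq> j"
  shows "Y i * Y j - Y j * Y i = sc c0 * (Y j * B i j - Y i * B i j)"
proof -
  have "y i * y j * x i * x j = y j * y i * x j * x i"
    using y_y[of i j] x_x[of i j] assms by (simp add: mult.assoc)
  then show ?thesis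
    using Y_Y[of i j] Y_Y[of j i] B_sym[of i j] assms by (simp add: algebra_simps)
qed

text \<open>The right side is indexed by the image under \<open>p\<close>, so the lemma serves both
  permutations that preserve \<open>{1..<i}\<close> and the n-cycles in \<Phi> and \<Psi>, which do
  not.\<close>

lemma B_sum:
  assumes "p permutes {1..n}" "\<And>i. i \<in> {1..n} \<Longrightarrow> a i ^ r = 1" "i \<in> {1..n}"
  shows "t p a * (\<Sum>j = 1..<i. B i j) = (\<Sum>j \<in> p ` {1..<i}. B (p i) j) * t p a"
proof -
  have "t p a * (\<Sum>j = 1..<i. B i j) = (\<Sum>j = 1..<i. B (p i) (p j) * t p a)"
    unfolding sum_distrib_left using assms by (intro sum.cong refl t_B) auto
  also have "\<dots> = (\<Sum>j \<in> p ` {1..<i}. B (p i) j) * t p a"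
    using permutes_inj[OF assms(1)] by (simp add: sum_distrib_right sum.reindex inj_def inj_on_def)
  finally show ?thesis .
qed

lemma t_z:
  assumes "p permutes {1..n}" "\<And>i. i \<in> {1..n} \<Longrightarrow> a i ^ r = 1" "i \<in> {1..n}"
    and "p i = i" "p ` {1..<i} = {1..<i}"
  shows "t p a * z i = z i * t p a"
proof -
  have "t p a * z i = t p a * Y i + sc c0 * (t p a * (\<Sum>j = 1..<i. B i j))"
    by (simp add: z_def distrib_left t_sc flip: mult.assoc)
  then show ?thesis
    using B_sum[of p a i] t_Y[of p a i] assms by (simp add: z_def distrib_right mult.assoc)
qed

lemma diag_z: "(\<And>i. i \<in> {1..n} \<Longrightarrow> a i ^ r = 1) \<Longrightarrow> i \<in> {1..n} \<Longrightarrow> t id a * z i = z i * t id a"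
  by (rule t_z) (auto simp: permutes_id)

lemma s_z_other:
  assumes "i \<in> {1..<n}" "j \<in> {1..n}" "j \<noteq> i" "j \<noteq> i + 1"
  shows "t (transpose i (i + 1)) (\<lambda>_. 1) * z j = z j * t (transpose i (i + 1)) (\<lambda>_. 1)"
proof (rule t_z)
  show "transpose i (i + 1) permutes {1..n}"
    using assms by (intro transpose_permutes) auto
  have "i \<in> {1..<j} \<longleftrightarrow> i + 1 \<in> {1..<j}"
    using assms by auto
  then show "transpose i (i + 1) ` {1..<j} = {1..<j}"
    by (rule transpose_image_eq)
qed (use assms in auto)

section \<open>Commutativity of the z_i\<close>

lemma mult_add_scaled:
  assumes "u * sc v = sc v * u" "w * sc v = sc v * w"
  shows "(u + sc v * w) * (u' + sc v * w') =
      u * u' + sc v * (u * w') + sc v * (w * u') + sc v * (sc v * (w * w'))"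
proof -
  have "u * (sc v * w') = sc v * (u * w')" "w * (sc v * w') = sc v * (w * w')"
    using assms by (metis mult.assoc)+
  then show ?thesis
    by (simp add: distrib_left distrib_right mult.assoc add.assoc)
qed

text \<open>For i < j every reflection in the Jucys-Murphy sum of i fixes j and permutes
  \<open>{1..<j}\<close>, so that sum commutes with the sum of j and with \<open>Y j\<close>. What
  remains are the commutators of \<open>Y i\<close> with \<open>Y j\<close> and with the sum of j;
  after multiplication of the latter by c_0 they cancel.\<close>

lemma z_z_less:
  assumes "i \<in> {1..n}" "j \<in> {1..n}" "i < j"
  shows "z i * z j = z j * z i"
proof -
  let ?L = "\<lambda>i. \<Sum>k = 1..<i. B i k"
  have B_L: "B i k * ?L j = ?L j * B i k" if "k \<in> {1..<i}" for k
  proof -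
    have *: "t (transpose i k) (refl_coeff i k \<xi>) * ?L j = ?L j * t (transpose i k) (refl_coeff i k \<xi>)"
      if "\<xi> \<in> unit_roots r" for \<xi>
    proof -
      have "transpose i k ` {1..<j} = {1..<j}"
        by (rule transpose_image_eq) (use assms \<open>k \<in> {1..<i}\<close> in auto)
      moreover have "transpose i k j = j"
        using assms \<open>k \<in> {1..<i}\<close> by auto
      ultimately show ?thesis
        using B_sum[of "transpose i k" "refl_coeff i k \<xi>" j] assms that \<open>k \<in> {1..<i}\<close>
        by (simp add: transpose_permutes refl_coeff_root)
    qed
    then show ?thesis
      by (simp add: B_def[of i k] sum_distrib_left[of _ _ "unit_roots r"] sum_distrib_right[of _ "unit_roots r"])
  qed
  have L_L: "?L i * ?L j = ?L j * ?L i"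
    by (simp add: sum_distrib_right[of _ "{1..<i}"] sum_distrib_left[of _ _ "{1..<i}"] B_L)
  have L_Y: "?L i * Y j = Y j * ?L i"
    unfolding sum_distrib_right sum_distrib_left
  proof (rule sum.cong)
    fix k assume "k \<in> {1..<i}"
    then show "B i k * Y j = Y j * B i k"
      using B_Y[of i k j] assms by simp
  qed simp
  \<comment> \<open>Of the reflections between j and k < j only those with k = i move
    \<open>Y i\<close>.\<close>
  have "Y i * B j k - B j k * Y i = (if k = i then Y i * B i j - Y j * B i j else 0)"
    if "k \<in> {1..<j}" for k
    using B_Y[of j k i] B_sym[of i j] assms that by auto
  then have "(\<Sum>k = 1..<j. Y i * B j k - B j k * Y i) = Y i * B i j - Y j * B i j"
    using assms by simp
  then have Y_L: "Y i * ?L j = ?L j * Y i + (Y i * B i j - Y j * B i j)"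
    by (simp add: sum_subtractf sum_distrib_left sum_distrib_right algebra_simps)
  have YY: "Y i * Y j = Y j * Y i - sc c0 * (Y i * B i j - Y j * B i j)"
    using Y_Y_commutator[of i j] assms by (simp add: algebra_simps)
  have L_sc: "?L k * sc u = sc u * ?L k" for k u
    by (simp add: sum_distrib_left sum_distrib_right B_sc)
  have "z i * z j = Y i * Y j + sc c0 * (Y i * ?L j) + sc c0 * (?L i * Y j) + sc c0 * (sc c0 * (?L i * ?L j))"
    unfolding z_def by (rule mult_add_scaled[OF Y_sc L_sc])
  moreover have "z j * z i = Y j * Y i + sc c0 * (Y j * ?L i) + sc c0 * (?L j * Y i) + sc c0 * (sc c0 * (?L j * ?L i))"
    unfolding z_def by (rule mult_add_scaled[OF Y_sc L_sc])
  ultimately show ?thesis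
    by (simp only: L_L L_Y Y_L YY distrib_left) simp
qed

lemma z_z: "i \<in> {1..n} \<Longrightarrow> j \<in> {1..n} \<Longrightarrow> z i * z j = z j * z i"
  using z_z_less[of i j] z_z_less[of j i] by (cases i j rule: linorder_cases) auto

end

lemma mult_intertwine:
  fixes a k l u v :: "'a::semigroup_mult"
  assumes "a * u = u * k" "v * l = k * v"
  shows "a * (u * v) = (u * v) * l"
  using assms by (metis mult.assoc)

context cherednik_relations
begin

section \<open>Adjacent transpositions and the intertwiners \<tau>_i\<close>

definition S :: "nat \<Rightarrow> 'a" where
  "S i = t (transpose i (i + 1)) (\<lambda>_. 1)"

definition D :: "nat \<Rightarrow> 'a" where
  "D i = t id ((\<lambda>_. 1)(i := \<zeta>))"

definition \<pi> :: "nat \<Rightarrow> 'a" where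
  "\<pi> i = (\<Sum>\<xi> \<in> unit_roots r. t id ((\<lambda>_. 1)(i := \<xi>, i + 1 := inverse \<xi>)))"

lemma adjacent_permutes: "i \<in> {1..<n} \<Longrightarrow> transpose i (i + 1) permutes {1..n}"
  by (rule transpose_permutes) auto

lemma diag_diag:
  assumes "\<And>i. i \<in> {1..n} \<Longrightarrow> a i ^ r = 1" "\<And>i. i \<in> {1..n} \<Longrightarrow> b i ^ r = 1"
  shows "t id a * t id b = t id b * t id a"
  using t_mult[OF permutes_id permutes_id, of a b] t_mult[OF permutes_id permutes_id, of b a] assms
  by (simp add: mult.commute)

lemma D_z: "i \<in> {1..n} \<Longrightarrow> D k * z i = z i * D k"
  unfolding D_def by (rule diag_z) (use zeta_r in auto)

lemma diag_\<pi>: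
  assumes "\<And>i. i \<in> {1..n} \<Longrightarrow> a i ^ r = 1"
  shows "t id a * \<pi> i = \<pi> i * t id a"
  unfolding \<pi>_def sum_distrib_left sum_distrib_right
  by (rule sum.cong[OF refl], rule diag_diag) (use assms in \<open>auto simp: power_inverse\<close>)

lemma D_\<pi>: "D k * \<pi> i = \<pi> i * D k"
  unfolding D_def by (rule diag_\<pi>) (use zeta_r in auto)

lemma \<pi>_z: "k \<in> {1..n} \<Longrightarrow> \<pi> i * z k = z k * \<pi> i"
  unfolding \<pi>_def sum_distrib_left sum_distrib_right
  by (rule sum.cong[OF refl], rule diag_z) (auto simp: power_inverse)

text \<open>A reflection between i and i+1 times s_i is diagonal, with mutually inverse entries in
  these two positions.\<close>

lemma B_S:
  assumes "i \<in> {1..<n}"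
  shows "B (i + 1) i * S i = \<pi> i"
proof -
  have "B (i + 1) i * S i = (\<Sum>\<xi> \<in> unit_roots r. t id (\<lambda>j. refl_coeff (i + 1) i \<xi> (transpose i (i + 1) j)))"
    unfolding B_def S_def sum_distrib_right
    using assms adjacent_permutes[OF assms]
    by (intro sum.cong refl, subst t_mult)
      (auto simp: transpose_commute[of "i + 1"] refl_coeff_root)
  \<comment> \<open>The entry \<xi> at i+1 is written as a double inverse to match the substitution
    of \<xi> by its inverse.\<close>
  also have "\<dots> = (\<Sum>\<xi> \<in> unit_roots r. t id ((\<lambda>_. 1)(i := inverse \<xi>, i + 1 := inverse (inverse \<xi>))))"
    by (intro sum.cong refl t_cong) (auto simp: refl_coeff_def transpose_def)
  also have "\<dots> = \<pi> i"
    unfolding \<pi>_def by (rule inverse_root_sum[of "\<lambda>\<xi>. t id ((\<lambda>_. 1)(i := \<xi>, i + 1 := inverse \<xi>))"])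
  finally show ?thesis .
qed

lemma z_Suc: "i \<in> {1..n} \<Longrightarrow> z (i + 1) = Y (i + 1) + sc c0 * (\<Sum>j = 1..<i. B (i + 1) j) + sc c0 * B (i + 1) i"
proof -
  assume "i \<in> {1..n}"
  then have "{1..<i + 1} = insert i {1..<i}" by auto
  then show ?thesis
    by (simp add: z_def distrib_left add.assoc add.commute)
qed

lemma S_partial_sum:
  assumes "i \<in> {1..<n}" "k \<in> {i, i + 1}"
  shows "S i * (\<Sum>j = 1..<i. B k j) = (\<Sum>j = 1..<i. B (transpose i (i + 1) k) j) * S i"
  unfolding sum_distrib_left sum_distrib_right S_def
proof (rule sum.cong[OF refl])
  fix j assume j: "j \<in> {1..<i}"
  show "t (transpose i (i + 1)) (\<lambda>_. 1) * B k j = B (transpose i (i + 1) k) j * t (transpose i (i + 1)) (\<lambda>_. 1)"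
    using t_B[OF adjacent_permutes[OF assms(1)], of "\<lambda>_. 1" k j] assms j by auto
qed

lemma S_Y: "i \<in> {1..<n} \<Longrightarrow> k \<in> {1..n} \<Longrightarrow> S i * Y k = Y (transpose i (i + 1) k) * S i"
  unfolding S_def by (rule t_Y[OF adjacent_permutes]) auto

lemma S_sc: "S i * (sc u * a) = sc u * (S i * a)"
  unfolding S_def by (metis t_sc mult.assoc)

text \<open>Conjugation by s_i carries z_i to z_{i+1} except for the summand c_0
  \<open>B (i + 1) i\<close>, which z_{i+1} has in addition; multiplied by s_i it is c_0
  \<pi>_i.\<close>

lemma S_z:
  assumes "i \<in> {1..<n}"
  shows "S i * z i = z (i + 1) * S i - sc c0 * \<pi> i"
proof -
  have "S i * z i = Y (i + 1) * S i + sc c0 * (\<Sum>j = 1..<i. B (i + 1) j) * S i"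
    using S_Y[of i i] S_partial_sum[of i i] assms by (simp add: z_def distrib_left S_sc mult.assoc)
  moreover have "z (i + 1) * S i = Y (i + 1) * S i + sc c0 * (\<Sum>j = 1..<i. B (i + 1) j) * S i + sc c0 * \<pi> i"
    using assms by (subst z_Suc) (auto simp: distrib_right mult.assoc B_S)
  ultimately show ?thesis by simp
qed

lemma S_z_Suc:
  assumes "i \<in> {1..<n}"
  shows "S i * z (i + 1) = z i * S i + sc c0 * \<pi> i"
proof -
  have "S i * B (i + 1) i = B i (i + 1) * S i"
    unfolding S_def using t_B[OF adjacent_permutes[OF assms], of "\<lambda>_. 1" "i + 1" i] assms by simp
  also have "\<dots> = \<pi> i"
    using B_sym[of i "i + 1"] B_S[OF assms] by simp
  finally have *: "S i * B (i + 1) i = \<pi> i" .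
  have "S i * z (i + 1) = S i * Y (i + 1) + sc c0 * (S i * (\<Sum>j = 1..<i. B (i + 1) j)) + sc c0 * \<pi> i"
    using assms by (subst z_Suc) (auto simp: distrib_left S_sc *)
  also have "\<dots> = z i * S i + sc c0 * \<pi> i"
    using S_Y[of i "i + 1"] S_partial_sum[of i "i + 1"] assms
    by (simp add: z_def distrib_right mult.assoc)
  finally show ?thesis .
qed

lemma S_z_other: "i \<in> {1..<n} \<Longrightarrow> j \<in> {1..n} \<Longrightarrow> j \<noteq> i \<Longrightarrow> j \<noteq> i + 1 \<Longrightarrow> S i * z j = z j * S i"
  unfolding S_def by (rule s_z_other)

lemma S_D:
  assumes "i \<in> {1..<n}"
  shows "S i * D k = D (transpose i (i + 1) k) * S i"
proof -
  have "S i * D k = t (transpose i (i + 1)) ((\<lambda>_. 1)(k := \<zeta>))"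
    unfolding S_def D_def using t_mult[OF adjacent_permutes[OF assms] permutes_id] zeta_r by (simp add: fun_upd_def)
  also have "\<dots> = D (transpose i (i + 1) k) * S i"
    unfolding S_def D_def using zeta_r
    by (subst t_mult[OF permutes_id adjacent_permutes[OF assms]])
      (auto simp: fun_upd_def transpose_eq_iff intro!: t_cong)
  finally show ?thesis .
qed

text \<open>Substituting \<xi>/\<zeta> for \<xi> in \<pi>_i moves a factor \<zeta> from position i
  to position i+1.\<close>

lemma \<pi>_D: "i \<in> {1..<n} \<Longrightarrow> \<pi> i * D k = \<pi> i * D (transpose i (i + 1) k)"
proof -
  assume i: "i \<in> {1..<n}"
  have \<pi>_D_aux: "\<pi> i * D i = \<pi> i * D (i + 1)"
  proof -
    have "\<pi> i * D i = (\<Sum>\<xi> \<in> unit_roots r. t id ((\<lambda>_. 1)(i := \<xi> * \<zeta>, i + 1 := inverse \<xi>)))"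
      unfolding \<pi>_def D_def sum_distrib_right
      by (intro sum.cong refl, subst t_mult)
        (auto simp: permutes_id zeta_r power_inverse intro!: t_cong)
    also have "\<dots> = (\<Sum>\<xi> \<in> unit_roots r. t id ((\<lambda>_. 1)(i := \<xi>, i + 1 := inverse \<xi> * \<zeta>)))"
      by (rule sum.reindex_bij_witness[of _ "\<lambda>\<xi>. \<xi> / \<zeta>" "\<lambda>\<xi>. \<xi> * \<zeta>"])
        (use zeta_r root_nonzero[OF zeta_r] in \<open>auto simp: power_mult_distrib power_divide field_simps\<close>)
    also have "\<dots> = \<pi> i * D (i + 1)"
      unfolding \<pi>_def D_def sum_distrib_right
      by (intro sum.cong refl, subst t_mult)
        (auto simp: permutes_id zeta_r power_inverse intro!: t_cong)
    finally show ?thesis .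
  qed
  show ?thesis
    using \<pi>_D_aux by (auto simp: transpose_def)
qed

text \<open>\<open>\<sigma>\<^sub>i\<close> multiplied by \<open>z\<^sub>i - z\<^sub>i\<^sub>+\<^sub>1\<close>.\<close>

definition \<tau> :: "nat \<Rightarrow> 'a" where
  "\<tau> i = (z i - z (i + 1)) * S i + sc c0 * \<pi> i"

lemma z_sc: "z i * sc u = sc u * z i"
  by (simp add: z_def distrib_left distrib_right Y_sc sum_distrib_left sum_distrib_right)
    (metis (no_types, lifting) B_sc mult.assoc sc_sc sum.cong)

lemma z_sc_left: "z i * (sc u * a) = sc u * (z i * a)"
  by (metis z_sc mult.assoc)

text \<open>The second summand of \<tau>_i is made for k = i: the error term -c_0 (z_i - z_{i+1})
  \<pi>_i from \<open>S_z\<close> and the term c_0 z_i \<pi>_i add up to c_0 z_{i+1} \<pi>_i. For k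
  = i+1 the signs are reversed, and for other k all factors commute with z_k.\<close>

lemma \<tau>_z:
  assumes i: "i \<in> {1..<n}" and k: "k \<in> {1..n}"
  shows "\<tau> i * z k = z (transpose i (i + 1) k) * \<tau> i"
proof -
  have zz: "z i * z (i + 1) = z (i + 1) * z i"
    using z_z i by auto
  have assoc: "(z i - z (i + 1)) * S i * z k = (z i - z (i + 1)) * (S i * z k)"
    by (simp add: mult.assoc)
  consider "k = i" | "k = i + 1" | "k \<noteq> i" "k \<noteq> i + 1" by blast
  then show ?thesis
  proof cases
    case 1
    have "\<tau> i * z k = (z i - z (i + 1)) * (z (i + 1) * S i) - (z i - z (i + 1)) * (sc c0 * \<pi> i) + sc c0 * (\<pi> i * z i)"
      unfolding \<tau>_def distrib_right assoc unfolding 1 S_z[OF i] by (simp only: right_diff_distrib mult.assoc)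
    also have "(z i - z (i + 1)) * (z (i + 1) * S i) = z (i + 1) * ((z i - z (i + 1)) * S i)"
      by (simp add: left_diff_distrib right_diff_distrib zz flip: mult.assoc)
    also have "\<pi> i * z i = z i * \<pi> i"
      using \<pi>_z i by auto
    finally show ?thesis
      using 1 by (simp add: \<tau>_def distrib_left z_sc_left left_diff_distrib right_diff_distrib)
  next
    case 2
    have "\<tau> i * z k = (z i - z (i + 1)) * (z i * S i) + (z i - z (i + 1)) * (sc c0 * \<pi> i) + sc c0 * (\<pi> i * z (i + 1))"
      unfolding \<tau>_def distrib_right assoc unfolding 2 S_z_Suc[OF i] by (simp only: distrib_left mult.assoc)
    also have "(z i - z (i + 1)) * (z i * S i) = z i * ((z i - z (i + 1)) * S i)"
      by (simp add: left_diff_distrib right_diff_distrib zz flip: mult.assoc)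
    also have "\<pi> i * z (i + 1) = z (i + 1) * \<pi> i"
      using \<pi>_z i by auto
    finally show ?thesis
      using 2 by (simp add: \<tau>_def distrib_left z_sc_left left_diff_distrib right_diff_distrib)
  next
    case 3
    have "z i * z k = z k * z i" "z (i + 1) * z k = z k * z (i + 1)"
      using z_z i k by auto
    then have "(z i - z (i + 1)) * z k = z k * (z i - z (i + 1))"
      by (simp add: left_diff_distrib right_diff_distrib)
    then have "(z i - z (i + 1)) * S i * z k = z k * ((z i - z (i + 1)) * S i)"
      using mult_intertwine[OF sym S_z_other[OF i k 3]] by simp
    then show ?thesis
      using 3 \<pi>_z[OF k, of i] by (simp add: \<tau>_def distrib_left distrib_right z_sc_left mult.assoc)
  qed
qed

lemma x_sc_left: "x i * (sc u * a) = sc u * (x i * a)"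
  by (metis x_sc mult.assoc)

lemma t_sc_left: "t p b * (sc u * a) = sc u * (t p b * a)"
  by (metis t_sc mult.assoc)

lemma D_sc_left: "D k * (sc u * a) = sc u * (D k * a)"
  unfolding D_def by (metis t_sc mult.assoc)

lemma \<tau>_D:
  assumes i: "i \<in> {1..<n}"
  shows "\<tau> i * D k = D (transpose i (i + 1) k) * \<tau> i"
proof -
  let ?k = "transpose i (i + 1) k"
  have "(z i - z (i + 1)) * D ?k = D ?k * (z i - z (i + 1))"
    using D_z[of i ?k] D_z[of "i + 1" ?k] i by (simp add: left_diff_distrib right_diff_distrib)
  then have "(z i - z (i + 1)) * S i * D k = D ?k * ((z i - z (i + 1)) * S i)"
    using mult_intertwine[OF sym S_D[OF i, of k]] by simp
  moreover have "\<pi> i * D k = D ?k * \<pi> i"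
    using \<pi>_D[OF i, of k] D_\<pi>[of ?k i] by simp
  ultimately show ?thesis
    by (simp add: \<tau>_def distrib_left distrib_right D_sc_left mult.assoc)
qed

text \<open>The difference \<phi>(z_n) - z_1, expanded in powers of \<zeta>_1 instead of
  idempotents. The factor inverse to \<zeta>^l is the scalar that \<zeta>_n^l picks up when it
  passes x_n.\<close>

definition \<delta> :: 'a where
  "\<delta> = sc \<kappa> - (\<Sum>l<r. sc (\<gamma> l * inverse (\<zeta> ^ l)) * t id ((\<lambda>_. 1)(1 := \<zeta> ^ l)))"

section \<open>Moving x_n and y_1 past the z_i\<close>

lemma diag_root: "((\<lambda>_. 1)(i := \<zeta> ^ l)) k ^ r = 1"
  by (simp flip: power_mult) (simp add: mult.commute[of l] power_mult zeta_r)

text \<open>In the commutator of y_i and x_n the weight 1/\<xi> is cancelled by the scalar \<xi>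
  that turns x_i into x_n, which leaves x_n times c_0 \<open>B i n\<close>. The reflections in z_i
  itself involve only indices at most i < n and commute with x_n.\<close>

lemma z_x:
  assumes "i \<in> {1..<n}"
  shows "z i * x n = x n * (z i + sc c0 * B i n)"
proof -
  have i: "i \<in> {1..n}" "n \<in> {1..n}" "i \<noteq> n" using assms by auto
  have 1: "sc (inverse \<xi>) * t (transpose i n) (refl_coeff i n \<xi>) * x i = x n * t (transpose i n) (refl_coeff i n \<xi>)"
    if "\<xi> \<in> unit_roots r" for \<xi>
  proof -
    have "\<xi> \<noteq> 0" using that root_nonzero by auto
    have "t (transpose i n) (refl_coeff i n \<xi>) * x i = sc \<xi> * x n * t (transpose i n) (refl_coeff i n \<xi>)"
      using t_x[OF transpose_permutes[OF i(1,2)], of "refl_coeff i n \<xi>" i] i that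
      by (simp add: refl_coeff_root) (simp add: refl_coeff_def)
    then have "sc (inverse \<xi>) * t (transpose i n) (refl_coeff i n \<xi>) * x i =
        sc (inverse \<xi> * \<xi>) * x n * t (transpose i n) (refl_coeff i n \<xi>)"
      by (simp add: sc_mult mult.assoc)
    then show ?thesis
      using \<open>\<xi> \<noteq> 0\<close> by (simp add: sc_1_x)
  qed
  have "Y i * x n = (y i * x n) * x i"
    using x_x[OF i(1,2)] by (simp add: Y_def mult.assoc)
  also have "\<dots> = x n * Y i + sc c0 * (\<Sum>\<xi> \<in> unit_roots r. sc (inverse \<xi>) * t (transpose i n) (refl_coeff i n \<xi>) * x i)"
    using y_x[OF i] by (simp add: Y_def distrib_right mult.assoc sum_distrib_right)
  also have "\<dots> = x n * Y i + x n * (sc c0 * B i n)"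
    by (simp add: 1 B_def sum_distrib_left[symmetric] x_sc flip: mult.assoc)
  finally have Yx: "Y i * x n = x n * Y i + x n * (sc c0 * B i n)" .
  have "B i j * x n = x n * B i j" if "j \<in> {1..<i}" for j
    unfolding B_def sum_distrib_left sum_distrib_right
  proof (rule sum.cong[OF refl])
    fix \<xi> assume "\<xi> \<in> unit_roots r"
    have j: "j \<in> {1..n}" "j \<noteq> n" using that i by auto
    show "t (transpose i j) (refl_coeff i j \<xi>) * x n = x n * t (transpose i j) (refl_coeff i j \<xi>)"
      using t_x[OF transpose_permutes[OF i(1) j(1)], of "refl_coeff i j \<xi>" n] i j \<open>\<xi> \<in> unit_roots r\<close>
      by (simp add: refl_coeff_root) (simp add: refl_coeff_def sc_1_x)
  qed
  then have "(\<Sum>j = 1..<i. B i j) * x n = x n * (\<Sum>j = 1..<i. B i j)"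
    by (simp add: sum_distrib_left sum_distrib_right)
  then have "sc c0 * (\<Sum>j = 1..<i. B i j) * x n = x n * (sc c0 * (\<Sum>j = 1..<i. B i j))"
    by (simp add: x_sc_left mult.assoc)
  then show ?thesis
    unfolding z_def distrib_right distrib_left Yx by (simp add: algebra_simps)
qed

text \<open>The Jucys-Murphy sum in z_n contains all reflections through n and therefore cancels the
  reflection part of the relation for y_n x_n. So z_n is x_n y_n plus diagonal terms, and x_n can be
  taken out on the left.\<close>

lemma z_n_x:
  shows "z n * x n = x n * (Y n + sc \<kappa> - (\<Sum>l<r. sc (\<gamma> l * inverse (\<zeta> ^ l)) * t id ((\<lambda>_. 1)(n := \<zeta> ^ l))))"
proof -
  have n: "n \<in> {1..n}" using n_pos by auto
  let ?d = "\<lambda>l. t id ((\<lambda>_. 1)(n := \<zeta> ^ l))"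
  have "{1..n} - {n} = {1..<n}" by auto
  then have "y n * x n = x n * y n + sc \<kappa> - (\<Sum>l<r. sc (\<gamma> l) * ?d l) - sc c0 * (\<Sum>j = 1..<n. B n j)"
    using y_x_same[OF n] by (simp add: B_def)
  then have "z n = x n * y n + sc \<kappa> - (\<Sum>l<r. sc (\<gamma> l) * ?d l)"
    by (simp add: z_def Y_def)
  then have "z n * x n = x n * Y n + sc \<kappa> * x n - (\<Sum>l<r. sc (\<gamma> l) * (?d l * x n))"
    by (simp add: Y_def distrib_right left_diff_distrib mult.assoc sum_distrib_right)
  also have "(\<Sum>l<r. sc (\<gamma> l) * (?d l * x n)) = (\<Sum>l<r. x n * (sc (\<gamma> l * inverse (\<zeta> ^ l)) * ?d l))"
  proof (rule sum.cong[OF refl])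
    fix l
    have "?d l * x n = sc (inverse (\<zeta> ^ l)) * x n * ?d l"
      using t_x[OF permutes_id, of "(\<lambda>_. 1)(n := \<zeta> ^ l)" n] diag_root[of n l] n by auto
    then show "sc (\<gamma> l) * (?d l * x n) = x n * (sc (\<gamma> l * inverse (\<zeta> ^ l)) * ?d l)"
      by (simp add: sc_mult x_sc_left mult.assoc)
  qed
  finally show ?thesis
    by (simp add: distrib_left right_diff_distrib x_sc sum_distrib_left)
qed

lemma t_diag:
  assumes "p permutes {1..n}" "k \<in> {1..n}"
  shows "t p (\<lambda>_. 1) * t id ((\<lambda>_. 1)(k := \<zeta> ^ l)) = t id ((\<lambda>_. 1)(p k := \<zeta> ^ l)) * t p (\<lambda>_. 1)"
proof -
  have root: "(\<zeta> ^ l) ^ r = 1"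
    using diag_root[of k l k] by simp
  have "t p (\<lambda>_. 1) * t id ((\<lambda>_. 1)(k := \<zeta> ^ l)) = t p ((\<lambda>_. 1)(k := \<zeta> ^ l))"
    using t_mult[OF assms(1) permutes_id, of "\<lambda>_. 1" "(\<lambda>_. 1)(k := \<zeta> ^ l)"] root
    by (simp add: fun_upd_def)
  also have "\<dots> = t p (\<lambda>j. ((\<lambda>_. 1)(p k := \<zeta> ^ l)) (p j))"
    using permutes_inj[OF assms(1)] by (intro t_cong) (auto dest: injD)
  also have "\<dots> = t id ((\<lambda>_. 1)(p k := \<zeta> ^ l)) * t p (\<lambda>_. 1)"
    using t_mult[OF permutes_id assms(1), of "(\<lambda>_. 1)(p k := \<zeta> ^ l)" "\<lambda>_. 1"] root
    by (simp add: fun_upd_def)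
  finally show ?thesis .
qed

lemma t_D:
  assumes "p permutes {1..n}" "k \<in> {1..n}"
  shows "t p (\<lambda>_. 1) * D k = D (p k) * t p (\<lambda>_. 1)"
  using t_diag[OF assms, of 1] by (simp add: D_def)

lemma D_x:
  assumes "i \<in> {1..n}" "k \<in> {1..n}"
  shows "D i * x k = sc (if k = i then inverse \<zeta> else 1) * x k * D i"
  unfolding D_def using t_x[OF permutes_id, of "(\<lambda>_. 1)(i := \<zeta>)" k] assms zeta_r by auto

lemma D_y:
  assumes "i \<in> {1..n}" "k \<in> {1..n}"
  shows "D i * y k = sc (if k = i then \<zeta> else 1) * y k * D i"
  unfolding D_def using t_y[OF permutes_id, of "(\<lambda>_. 1)(i := \<zeta>)" k] assms zeta_r by auto

context
  fixes w :: "nat \<Rightarrow> nat"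
  assumes w: "w permutes {1..n}" and w_1: "w 1 = n" and w_Suc: "\<And>i. i \<in> {1..<n} \<Longrightarrow> w (i + 1) = i"
begin

text \<open>\<open>w\<close> stands for the permutation of s_{n-1} ... s_1; only its values matter
  here, and \<open>descending_perm\<close> supplies them.\<close>

definition \<Phi> :: "'a" where
  "\<Phi> = x n * t w (\<lambda>_. 1)"

lemma w_image: "i \<in> {1..<n} \<Longrightarrow> w ` {1..<i + 1} = insert n {1..<i}"
proof -
  assume i: "i \<in> {1..<n}"
  have "{1..<i + 1} = insert 1 ((\<lambda>j. j + 1) ` {1..<i})"
    using i by (auto simp: image_iff)
  then have "w ` {1..<i + 1} = insert n ((\<lambda>j. w (j + 1)) ` {1..<i})"
    by (simp only: image_insert w_1 image_image)
  also have "(\<lambda>j. w (j + 1)) ` {1..<i} = (\<lambda>j. j) ` {1..<i}"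
    by (rule image_cong) (use i w_Suc in auto)
  finally show ?thesis by simp
qed

text \<open>\<open>w\<close> maps \<open>{1..<i + 1}\<close> onto \<open>{1..<i}\<close> together
  with n, so it turns z_{i+1} into z_i + c_0 \<open>B i n\<close>. The same extra term arises when
  z_i is moved past x_n.\<close>

lemma z_\<Phi>:
  assumes i: "i \<in> {1..<n}"
  shows "z i * \<Phi> = \<Phi> * z (i + 1)"
proof -
  have i': "i + 1 \<in> {1..n}" using i by auto
  have "t w (\<lambda>_. 1) * z (i + 1) = t w (\<lambda>_. 1) * Y (i + 1) + sc c0 * (t w (\<lambda>_. 1) * (\<Sum>j = 1..<i + 1. B (i + 1) j))"
    by (simp add: z_def distrib_left t_sc_left)
  also have "t w (\<lambda>_. 1) * (\<Sum>j = 1..<i + 1. B (i + 1) j) = (\<Sum>j \<in> w ` {1..<i + 1}. B (w (i + 1)) j) * t w (\<lambda>_. 1)"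
    by (rule B_sum[OF w _ i']) simp
  also have "\<dots> = (B i n + (\<Sum>j = 1..<i. B i j)) * t w (\<lambda>_. 1)"
    using i by (simp only: w_image w_Suc) simp
  also have "t w (\<lambda>_. 1) * Y (i + 1) = Y i * t w (\<lambda>_. 1)"
    using t_Y[OF w _ i', of "\<lambda>_. 1"] w_Suc[OF i] by simp
  finally have "t w (\<lambda>_. 1) * z (i + 1) = (z i + sc c0 * B i n) * t w (\<lambda>_. 1)"
    by (simp add: z_def algebra_simps)
  then show ?thesis
    unfolding \<Phi>_def by (rule mult_intertwine[OF z_x[OF i]])
qed

text \<open>z_1 is just \<open>Y 1\<close>, its sum being empty; as \<open>w\<close> sends 1 to n,
  it carries z_1 + \<delta> to the factor left by \<open>z_n_x\<close>.\<close>

lemma z_n_\<Phi>: "z n * \<Phi> = \<Phi> * (z 1 + \<delta>)"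
proof -
  have 1: "1 \<in> {1..n}" using n_pos by auto
  have "t w (\<lambda>_. 1) * (z 1 + \<delta>) =
      t w (\<lambda>_. 1) * Y 1 + t w (\<lambda>_. 1) * sc \<kappa> - 
        (\<Sum>l<r. sc (\<gamma> l * inverse (\<zeta> ^ l)) * (t w (\<lambda>_. 1) * t id ((\<lambda>_. 1)(1 := \<zeta> ^ l))))"
    by (simp add: z_def \<delta>_def distrib_left right_diff_distrib sum_distrib_left t_sc_left)
  also have "\<dots> = (Y n + sc \<kappa> - (\<Sum>l<r. sc (\<gamma> l * inverse (\<zeta> ^ l)) * t id ((\<lambda>_. 1)(n := \<zeta> ^ l)))) * t w (\<lambda>_. 1)"
    using t_Y[OF w _ 1, of "\<lambda>_. 1"] t_diag[OF w 1]
    by (simp add: w_1 t_sc distrib_right left_diff_distrib sum_distrib_right mult.assoc)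
  finally show ?thesis
    unfolding \<Phi>_def by (rule mult_intertwine[OF z_n_x])
qed

lemma D_\<Phi>: "i \<in> {1..<n} \<Longrightarrow> D i * \<Phi> = \<Phi> * D (i + 1)"
proof -
  assume i: "i \<in> {1..<n}"
  have "D i * x n = x n * D i"
    using D_x[of i n] i n_pos by (auto simp: sc_1_x)
  moreover have "t w (\<lambda>_. 1) * D (i + 1) = D i * t w (\<lambda>_. 1)"
    using t_D[OF w, of "i + 1"] i w_Suc by auto
  ultimately show ?thesis
    unfolding \<Phi>_def by (rule mult_intertwine)
qed

lemma D_n_\<Phi>: "D n * \<Phi> = \<Phi> * (sc (inverse \<zeta>) * D 1)"
proof -
  have "D n * x n = x n * (sc (inverse \<zeta>) * D n)"
    using D_x[of n n] n_pos x_sc[of n] by (auto simp: simp flip: mult.assoc)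
  moreover have "t w (\<lambda>_. 1) * (sc (inverse \<zeta>) * D 1) = sc (inverse \<zeta>) * D n * t w (\<lambda>_. 1)"
    using t_D[OF w, of 1] n_pos w_1 by (auto simp: t_sc_left mult.assoc)
  ultimately show ?thesis
    unfolding \<Phi>_def by (rule mult_intertwine)
qed

end

text \<open>Moving y_1 past \<open>Y (i + 1)\<close> costs -c_0 \<open>B (i + 1) 1\<close>, which
  removes the summand j = 1 of z_{i+1}. The remaining reflections fix the index 1 and commute with
  y_1.\<close>

lemma z_y:
  assumes "i \<in> {1..<n}"
  shows "z (i + 1) * y 1 = y 1 * (Y (i + 1) + sc c0 * (\<Sum>j \<in> {2..<i + 1}. B (i + 1) j))"
proof -
  have i: "1 \<in> {1..n}" "i + 1 \<in> {1..n}" "1 \<noteq> i + 1" using assms by auto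
  have By: "B (i + 1) j * y 1 = y 1 * B (i + 1) j" if j: "j \<in> {2..<i + 1}" for j
    unfolding B_def sum_distrib_left sum_distrib_right
  proof (rule sum.cong[OF refl])
    fix \<xi> assume "\<xi> \<in> unit_roots r"
    have j': "j \<in> {1..n}" "1 \<noteq> j" using j i by auto
    then have "transpose (i + 1) j 1 = 1" using i by (simp add: transpose_apply_other)
    then show "t (transpose (i + 1) j) (refl_coeff (i + 1) j \<xi>) * y 1 = y 1 * t (transpose (i + 1) j) (refl_coeff (i + 1) j \<xi>)"
      using t_y[OF transpose_permutes[OF i(2) j'(1)], of "refl_coeff (i + 1) j \<xi>" 1] i j' \<open>\<xi> \<in> unit_roots r\<close>
      by (simp add: refl_coeff_root) (simp add: refl_coeff_def sc_1_y)
  qed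
  have "{1..<i + 1} = insert 1 {2..<i + 1}" using assms by auto
  then have "z (i + 1) = Y (i + 1) + sc c0 * B (i + 1) 1 + sc c0 * (\<Sum>j \<in> {2..<i + 1}. B (i + 1) j)"
    by (simp add: z_def distrib_left add.assoc)
  then have "z (i + 1) * y 1 = Y (i + 1) * y 1 + sc c0 * (B (i + 1) 1 * y 1) +
      sc c0 * ((\<Sum>j \<in> {2..<i + 1}. B (i + 1) j) * y 1)"
    by (simp add: distrib_right mult.assoc)
  also have "Y (i + 1) * y 1 = y 1 * Y (i + 1) - sc c0 * (B (i + 1) 1 * y 1)"
    using x_y(2)[OF i] B_sym[OF i(3)] by (simp add: Y_def mult.assoc)
  also have "(\<Sum>j \<in> {2..<i + 1}. B (i + 1) j) * y 1 = y 1 * (\<Sum>j \<in> {2..<i + 1}. B (i + 1) j)"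
    unfolding sum_distrib_left sum_distrib_right by (rule sum.cong[OF refl By])
  finally show ?thesis
    by (simp add: distrib_left y_sc_left)
qed

text \<open>When \<zeta>_1^l passes y_1, the scalar \<zeta>^l cancels its inverse in \<delta>. After
  y_1 is taken out, x_1 y_1 remains with exactly the diagonal terms of its defining relation, which
  exchanges them for \<open>Y 1\<close> and the reflections through 1.\<close>

lemma z_1_y: "(z 1 + \<delta>) * y 1 = y 1 * (Y 1 + sc c0 * (\<Sum>j \<in> {1..n} - {1}. B 1 j))"
proof -
  have 1: "1 \<in> {1..n}" using n_pos by auto
  let ?d = "\<lambda>l. t id ((\<lambda>_. 1)(1 := \<zeta> ^ l))"
  have "(\<Sum>l<r. sc (\<gamma> l * inverse (\<zeta> ^ l)) * ?d l) * y 1 = (\<Sum>l<r. y 1 * (sc (\<gamma> l) * ?d l))"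
    unfolding sum_distrib_right
  proof (rule sum.cong[OF refl])
    fix l
    have "\<zeta> ^ l \<noteq> 0" using root_nonzero[OF zeta_r] by simp
    have "?d l * y 1 = sc (\<zeta> ^ l) * y 1 * ?d l"
      using t_y[OF permutes_id, of "(\<lambda>_. 1)(1 := \<zeta> ^ l)" 1] diag_root[of 1 l] 1 by auto
    then have "sc (\<gamma> l * inverse (\<zeta> ^ l)) * ?d l * y 1 = sc (\<gamma> l * inverse (\<zeta> ^ l) * \<zeta> ^ l) * y 1 * ?d l"
      by (simp add: sc_mult mult.assoc)
    then show "sc (\<gamma> l * inverse (\<zeta> ^ l)) * ?d l * y 1 = y 1 * (sc (\<gamma> l) * ?d l)"
      using \<open>\<zeta> ^ l \<noteq> 0\<close> by (simp add: y_sc_left mult.assoc)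
  qed
  moreover have "x 1 * y 1 + sc \<kappa> - (\<Sum>l<r. sc (\<gamma> l) * ?d l) = Y 1 + sc c0 * (\<Sum>j \<in> {1..n} - {1}. B 1 j)"
    using y_x_same[OF 1] by (simp add: Y_def B_def)
  moreover have "(z 1 + \<delta>) * y 1 = y 1 * (x 1 * y 1) + y 1 * sc \<kappa> - (\<Sum>l<r. sc (\<gamma> l * inverse (\<zeta> ^ l)) * ?d l) * y 1"
    by (simp add: z_def Y_def \<delta>_def distrib_right left_diff_distrib mult.assoc y_sc)
  ultimately show ?thesis
    by (simp only: distrib_left[symmetric] right_diff_distrib[symmetric] sum_distrib_left[symmetric])
qed

context
  fixes w :: "nat \<Rightarrow> nat"
  assumes w: "w permutes {1..n}" and w_n: "w n = 1" and w_less: "\<And>i. i \<in> {1..<n} \<Longrightarrow> w i = i + 1"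
begin

definition \<Psi> :: "'a" where
  "\<Psi> = y 1 * t w (\<lambda>_. 1)"

lemma w_image': "i \<in> {1..n} \<Longrightarrow> w ` {1..<i} = {2..<i + 1}"
proof -
  assume i: "i \<in> {1..n}"
  have "w ` {1..<i} = (\<lambda>j. j + 1) ` {1..<i}"
    by (rule image_cong) (use i w_less in auto)
  also have "\<dots> = {2..<i + 1}"
    by (auto simp: image_iff)
  finally show ?thesis .
qed

text \<open>The sum starts at 2 because \<open>w\<close> sends only n to 1. For i < n it is the sum
  left by \<open>z_y\<close>, and for i = n the one left by \<open>z_1_y\<close>.\<close>

lemma t_w_z:
  assumes "i \<in> {1..n}"
  shows "t w (\<lambda>_. 1) * z i = (Y (w i) + sc c0 * (\<Sum>j \<in> {2..<i + 1}. B (w i) j)) * t w (\<lambda>_. 1)"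
proof -
  have "t w (\<lambda>_. 1) * z i = t w (\<lambda>_. 1) * Y i + sc c0 * (t w (\<lambda>_. 1) * (\<Sum>j = 1..<i. B i j))"
    by (simp add: z_def distrib_left t_sc_left)
  then show ?thesis
    using B_sum[OF w _ assms, of "\<lambda>_. 1"] t_Y[OF w _ assms, of "\<lambda>_. 1"] w_image'[OF assms]
    by (simp add: distrib_right mult.assoc)
qed

lemma z_\<Psi>: "i \<in> {1..<n} \<Longrightarrow> z (i + 1) * \<Psi> = \<Psi> * z i"
proof -
  assume i: "i \<in> {1..<n}"
  have "t w (\<lambda>_. 1) * z i = (Y (i + 1) + sc c0 * (\<Sum>j \<in> {2..<i + 1}. B (i + 1) j)) * t w (\<lambda>_. 1)"
    using t_w_z[of i] w_less[OF i] i by auto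
  then show ?thesis
    unfolding \<Psi>_def by (rule mult_intertwine[OF z_y[OF i]])
qed

lemma z_1_\<Psi>: "(z 1 + \<delta>) * \<Psi> = \<Psi> * z n"
proof -
  have "{1..n} - {1} = {2..<n + 1}" by auto
  then have "t w (\<lambda>_. 1) * z n = (Y 1 + sc c0 * (\<Sum>j \<in> {1..n} - {1}. B 1 j)) * t w (\<lambda>_. 1)"
    using t_w_z[of n] w_n n_pos by auto
  then show ?thesis
    unfolding \<Psi>_def by (rule mult_intertwine[OF z_1_y])
qed

lemma D_\<Psi>: "i \<in> {1..<n} \<Longrightarrow> D (i + 1) * \<Psi> = \<Psi> * D i"
proof -
  assume i: "i \<in> {1..<n}"
  have "D (i + 1) * y 1 = y 1 * D (i + 1)"
    using D_y[of "i + 1" 1] i by (auto simp: sc_1_y)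
  moreover have "t w (\<lambda>_. 1) * D i = D (i + 1) * t w (\<lambda>_. 1)"
    using t_D[OF w, of i] i w_less by auto
  ultimately show ?thesis
    unfolding \<Psi>_def by (rule mult_intertwine)
qed

lemma D_1_\<Psi>: "sc (inverse \<zeta>) * D 1 * \<Psi> = \<Psi> * D n"
proof -
  have "\<zeta> \<noteq> 0" using root_nonzero[OF zeta_r] .
  have "D 1 * y 1 = sc \<zeta> * y 1 * D 1"
    using D_y[of 1 1] n_pos by auto
  then have "sc (inverse \<zeta>) * D 1 * y 1 = sc (inverse \<zeta> * \<zeta>) * y 1 * D 1"
    by (simp add: sc_mult mult.assoc)
  then have "sc (inverse \<zeta>) * D 1 * y 1 = y 1 * D 1"
    using \<open>\<zeta> \<noteq> 0\<close> by (simp add: sc_1_y)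
  moreover have "t w (\<lambda>_. 1) * D n = D 1 * t w (\<lambda>_. 1)"
    using t_D[OF w, of n] n_pos w_n by auto
  ultimately show ?thesis
    unfolding \<Psi>_def by (rule mult_intertwine)
qed

end

end

section \<open>The free algebra and its ideals\<close>

lemma scal_mult: "scal (a * b) = scal a * scal b"
  by (simp add: scal_def mult_single)

lemma scal_add: "scal (a + b) = scal a + scal b"
  by (simp add: scal_def single_add)

lemma scal_0: "scal 0 = 0"
  by (simp add: scal_def)

lemma scal_1: "scal 1 = 1"
  by (simp add: scal_def)

lemma scal_sum: "scal (sum f F) = (\<Sum>i \<in> F. scal (f i))"
  by (induction F rule: infinite_finite_induct) (simp_all add: scal_0 scal_add)

lemma scal_comm: "p * scal a = scal a * p"
proof -
  have "p * scal a = (\<Sum>m \<in> Poly_Mapping.keys p. Poly_Mapping.single m (Poly_Mapping.lookup p m)) * scal a"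
    by (simp flip: sum_singles)
  also have "\<dots> = scal a * (\<Sum>m \<in> Poly_Mapping.keys p. Poly_Mapping.single m (Poly_Mapping.lookup p m))"
    by (simp add: scal_def sum_distrib_left sum_distrib_right mult_single mult.commute)
  finally show ?thesis
    by (simp flip: sum_singles)
qed

lemma free_algebra_simps [simp]:
  "a \<otimes>\<^bsub>free_algebra \<Gamma>\<^esub> b = a * b" "a \<oplus>\<^bsub>free_algebra \<Gamma>\<^esub> b = a + b"
  "\<one>\<^bsub>free_algebra \<Gamma>\<^esub> = 1" "\<zero>\<^bsub>free_algebra \<Gamma>\<^esub> = 0"
  by (simp_all add: free_algebra_def)

lemma letters_plus [simp]: "letters (u + v) = letters u @ letters v"
  by (simp add: plus_free_monoid_def)

lemma letters_0 [simp]: "letters 0 = []"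
  by (simp add: zero_free_monoid_def)

lemma free_algebra_add:
  "p \<in> carrier (free_algebra \<Gamma>) \<Longrightarrow> q \<in> carrier (free_algebra \<Gamma>) \<Longrightarrow> p + q \<in> carrier (free_algebra \<Gamma>)"
  using Poly_Mapping.keys_add[of p q] by (fastforce simp: free_algebra_def)

lemma free_algebra_mult:
  assumes "p \<in> carrier (free_algebra \<Gamma>)" "q \<in> carrier (free_algebra \<Gamma>)"
  shows "p * q \<in> carrier (free_algebra \<Gamma>)"
proof -
  have "set (letters w) \<subseteq> \<Gamma>" if w: "w \<in> Poly_Mapping.keys (p * q)" for w
  proof -
    obtain u v where "w = u + v" "u \<in> Poly_Mapping.keys p" "v \<in> Poly_Mapping.keys q"
      using subsetD[OF keys_mult w] by blast
    then show ?thesis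
      using assms by (auto simp: free_algebra_def)
  qed
  then show ?thesis
    by (simp add: free_algebra_def)
qed

lemma free_algebra_uminus: "p \<in> carrier (free_algebra \<Gamma>) \<Longrightarrow> - p \<in> carrier (free_algebra \<Gamma>)"
  by (auto simp: free_algebra_def in_keys_iff)

lemma free_algebra_0: "0 \<in> carrier (free_algebra \<Gamma>)"
  by (simp add: free_algebra_def)

lemma free_algebra_scal: "scal a \<in> carrier (free_algebra \<Gamma>)"
  by (simp add: free_algebra_def scal_def)

lemma free_algebra_1: "1 \<in> carrier (free_algebra \<Gamma>)"
  using free_algebra_scal[of 1] by (simp add: scal_1)

lemma free_algebra_var: "g \<in> \<Gamma> \<Longrightarrow> var g \<in> carrier (free_algebra \<Gamma>)"
  by (simp add: free_algebra_def var_def)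

lemma free_algebra_diff:
  "p \<in> carrier (free_algebra \<Gamma>) \<Longrightarrow> q \<in> carrier (free_algebra \<Gamma>) \<Longrightarrow> p - q \<in> carrier (free_algebra \<Gamma>)"
  using free_algebra_add[of p \<Gamma> "- q"] free_algebra_uminus[of q] by simp

lemma free_algebra_sum:
  "(\<And>i. i \<in> F \<Longrightarrow> f i \<in> carrier (free_algebra \<Gamma>)) \<Longrightarrow> sum f F \<in> carrier (free_algebra \<Gamma>)"
  by (induction F rule: infinite_finite_induct) (auto intro: free_algebra_0 free_algebra_add)

lemma free_algebra_power: "p \<in> carrier (free_algebra \<Gamma>) \<Longrightarrow> p ^ k \<in> carrier (free_algebra \<Gamma>)"
  by (induction k) (auto intro: free_algebra_1 free_algebra_mult)

lemma free_algebra_prod_list: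
  "(\<And>i. i \<in> set xs \<Longrightarrow> f i \<in> carrier (free_algebra \<Gamma>)) \<Longrightarrow> prod_list (map f xs) \<in> carrier (free_algebra \<Gamma>)"
  by (induction xs) (auto intro: free_algebra_1 free_algebra_mult)

lemmas free_algebra_closed = free_algebra_add free_algebra_mult free_algebra_uminus free_algebra_0
  free_algebra_1 free_algebra_scal free_algebra_diff free_algebra_sum free_algebra_power free_algebra_prod_list

lemma free_algebra_ring: "ring (free_algebra \<Gamma>)"
proof (rule ringI)
  show "abelian_group (free_algebra \<Gamma>)"
  proof (rule abelian_groupI)
    fix p assume "p \<in> carrier (free_algebra \<Gamma>)"
    then show "\<exists>q \<in> carrier (free_algebra \<Gamma>). q \<oplus>\<^bsub>free_algebra \<Gamma>\<^esub> p = \<zero>\<^bsub>free_algebra \<Gamma>\<^esub>"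
      by (intro bexI[of _ "- p"]) (auto intro: free_algebra_closed)
  qed (auto intro: free_algebra_closed simp: add.assoc add.commute)
  show "Group.monoid (free_algebra \<Gamma>)"
    by (rule monoidI) (auto intro: free_algebra_closed simp: mult.assoc)
qed (auto simp: algebra_simps)

lemma free_algebra_a_inv:
  assumes "p \<in> carrier (free_algebra \<Gamma>)"
  shows "\<ominus>\<^bsub>free_algebra \<Gamma>\<^esub> p = - p"
proof -
  interpret ring "free_algebra \<Gamma>" by (rule free_algebra_ring)
  show ?thesis
    using assms by (intro minus_equality) (auto intro: free_algebra_closed)
qed

text \<open>
  Pulling an ideal of \<open>free_algebra \<Gamma>\<close> back along this retraction gives an ideal of the whole
  type, so that congruences can be multiplied by arbitrary elements.
\<close>

definition restrict_letters :: "'g set \<Rightarrow> 'g ncpoly \<Rightarrow> 'g ncpoly" where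
  "restrict_letters \<Gamma> = monoid_ext scal (\<lambda>w. if set (letters w) \<subseteq> \<Gamma> then Poly_Mapping.single w 1 else 0)"

lemma restrict_letters_extension:
  "monoid_extension scal (\<lambda>w. if set (letters w) \<subseteq> \<Gamma> then Poly_Mapping.single w 1 else 0)"
proof
  show "(if set (letters w) \<subseteq> \<Gamma> then Poly_Mapping.single w 1 else 0) * scal a =
      scal a * (if set (letters w) \<subseteq> \<Gamma> then Poly_Mapping.single w 1 else 0)" for a and w :: "'a free_monoid"
    by (rule scal_comm)
qed (auto simp: scal_add scal_mult mult_single)

lemma restrict_letters_closed: "restrict_letters \<Gamma> p \<in> carrier (free_algebra \<Gamma>)"
  unfolding restrict_letters_def monoid_ext_def
  by (intro free_algebra_sum free_algebra_mult free_algebra_scal) (simp add: free_algebra_def)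

lemma restrict_letters_id:
  assumes "p \<in> carrier (free_algebra \<Gamma>)"
  shows "restrict_letters \<Gamma> p = p"
proof -
  have "restrict_letters \<Gamma> p =
      (\<Sum>w \<in> Poly_Mapping.keys p. Poly_Mapping.single w (Poly_Mapping.lookup p w))"
    unfolding restrict_letters_def monoid_ext_def
    using assms by (intro sum.cong) (auto simp: free_algebra_def scal_def mult_single)
  then show ?thesis
    by (simp flip: sum_singles)
qed

definition extended_ideal :: "'g set \<Rightarrow> 'g ncpoly set \<Rightarrow> 'g ncpoly set" where
  "extended_ideal \<Gamma> I = {p. restrict_letters \<Gamma> p \<in> I}"

lemma two_sided_extended_ideal:
  assumes "ideal I (free_algebra \<Gamma>)"
  shows "two_sided (extended_ideal \<Gamma> I)"
proof -
  interpret I: ideal I "free_algebra \<Gamma>" by (rule assms)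
  interpret monoid_extension scal "\<lambda>w. if set (letters w) \<subseteq> \<Gamma> then Poly_Mapping.single w 1 else 0"
    by (rule restrict_letters_extension)
  have diff: "p - q \<in> I" if "p \<in> I" "q \<in> I" for p q
    using additive_subgroup.a_closed[OF ideal.axioms(1)[OF assms] that(1) I.I_l_closed[OF that(2), of "- 1"]]
    by (simp add: free_algebra_closed)
  have mult: "p * q \<in> I" "q * p \<in> I" if "p \<in> I" "q \<in> carrier (free_algebra \<Gamma>)" for p q
    using I.I_r_closed[OF that] I.I_l_closed[OF that] by simp_all
  show ?thesis
    unfolding two_sided_def extended_ideal_def
    using diff mult restrict_letters_closed[of \<Gamma>] additive_subgroup.zero_closed[OF ideal.axioms(1)[OF assms]]
    by (auto simp: restrict_letters_def ext_0 ext_diff ext_mult)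
qed


section \<open>Monomial matrices\<close>

context cherednik
begin

text \<open>The matrix sending \<open>y\<^sub>j\<close> to \<open>a\<^sub>j y\<^bsub>p(j)\<^esub>\<close>.\<close>

definition mono :: "(nat \<Rightarrow> nat) \<Rightarrow> (nat \<Rightarrow> complex) \<Rightarrow> complex mat" where
  "mono p a = mat n n (\<lambda>(i, j). if i + 1 = p (j + 1) then a (j + 1) else 0)"

lemma mono_cong:
  "(\<And>i. i \<in> {1..n} \<Longrightarrow> p i = q i) \<Longrightarrow> (\<And>i. i \<in> {1..n} \<Longrightarrow> a i = b i) \<Longrightarrow> mono p a = mono q b"
  unfolding mono_def by (rule cong_mat) auto

lemma mono_index: "i \<in> {1..n} \<Longrightarrow> j \<in> {1..n} \<Longrightarrow> mono p a $$ (i - 1, j - 1) = (if i = p j then a j else 0)"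
  by (auto simp: mono_def)

lemma mono_one: "mono id (\<lambda>_. 1) = 1\<^sub>m n"
  by (rule eq_matI) (auto simp: mono_def)

lemma mono_mult:
  assumes "q permutes {1..n}"
  shows "mono p a * mono q b = mono (p \<circ> q) (\<lambda>j. a (q j) * b j)"
proof (rule eq_matI)
  fix i j assume "i < dim_row (mono (p \<circ> q) (\<lambda>j. a (q j) * b j))" "j < dim_col (mono (p \<circ> q) (\<lambda>j. a (q j) * b j))"
  then have ij: "i < n" "j < n" by (auto simp: mono_def)
  have q: "q (j + 1) \<in> {1..n}"
    using permutes_in_image[OF assms, of "j + 1"] ij by auto
  have "(mono p a * mono q b) $$ (i, j) =
      (\<Sum>k = 0..<n. (if i + 1 = p (k + 1) then a (k + 1) else 0) * (if k + 1 = q (j + 1) then b (j + 1) else 0))"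
    using ij by (simp add: mono_def scalar_prod_def)
  also have "\<dots> = (\<Sum>k = 0..<n. if k = q (j + 1) - 1 then (if i + 1 = p (q (j + 1)) then a (q (j + 1)) else 0) * b (j + 1) else 0)"
    using q by (intro sum.cong) auto
  also have "\<dots> = (if i + 1 = p (q (j + 1)) then a (q (j + 1)) else 0) * b (j + 1)"
    using q by (subst sum.delta) auto
  finally show "(mono p a * mono q b) $$ (i, j) = mono (p \<circ> q) (\<lambda>j. a (q j) * b j) $$ (i, j)"
    using ij by (simp add: mono_def)
qed (auto simp: mono_def)

definition monomial_data :: "(nat \<Rightarrow> nat) \<Rightarrow> (nat \<Rightarrow> complex) \<Rightarrow> bool" where
  "monomial_data p a \<longleftrightarrow> p permutes {1..n} \<and> (\<forall>i \<in> {1..n}. a i ^ r = 1)"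

end

locale cherednik_pos = cherednik +
  assumes r_pos: "r > 0" and n_pos: "n > 0"
begin

lemma root_neq_0: "(u::complex) ^ r = 1 \<Longrightarrow> u \<noteq> 0"
  using r_pos by (auto simp: power_0_left)

lemma mono_in_G:
  assumes "monomial_data p a"
  shows "mono p a \<in> carrier G"
proof -
  have p: "p permutes {1..n}" using assms by (simp add: monomial_data_def)
  have a: "a (j + 1) ^ r = 1" "a (j + 1) \<noteq> 0" if "j < n" for j
  proof -
    show "a (j + 1) ^ r = 1" using assms that by (auto simp: monomial_data_def)
    then show "a (j + 1) \<noteq> 0" by (rule root_neq_0)
  qed
  have entry: "mono p a $$ (i, j) \<noteq> 0 \<longleftrightarrow> i + 1 = p (j + 1)" if "i < n" "j < n" for i j
    using that a[of j] by (simp add: mono_def)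
  have row: "\<exists>!j. j < n \<and> mono p a $$ (i, j) \<noteq> 0" if i: "i < n" for i
  proof -
    have inv_in: "Hilbert_Choice.inv p (i + 1) \<in> {1..n}"
      using permutes_in_image[OF permutes_inv[OF p], of "i + 1"] i by auto
    then have "Hilbert_Choice.inv p (i + 1) - 1 < n"
      by auto
    show ?thesis
    proof (rule ex1I[of _ "Hilbert_Choice.inv p (i + 1) - 1"])
      show "Hilbert_Choice.inv p (i + 1) - 1 < n \<and> mono p a $$ (i, Hilbert_Choice.inv p (i + 1) - 1) \<noteq> 0"
        using inv_in permutes_inverses(1)[OF p, of "i + 1"] i inv_in
          entry[OF i \<open>Hilbert_Choice.inv p (i + 1) - 1 < n\<close>] \<open>Hilbert_Choice.inv p (i + 1) - 1 < n\<close>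
        by auto
      fix j assume "j < n \<and> mono p a $$ (i, j) \<noteq> 0"
      then have "i + 1 = p (j + 1)" using entry i by auto
      then show "j = Hilbert_Choice.inv p (i + 1) - 1"
        using permutes_inverses(2)[OF p, of "j + 1"] by simp
    qed
  qed
  have col: "\<exists>!i. i < n \<and> mono p a $$ (i, j) \<noteq> 0" if j: "j < n" for j
  proof -
    have "p (j + 1) \<in> {1..n}"
      using permutes_in_image[OF p, of "j + 1"] j by auto
    then have *: "p (j + 1) - 1 < n" "p (j + 1) - 1 + 1 = p (j + 1)"
      by auto
    then show ?thesis
      using j entry[OF *(1) j] by (intro ex1I[of _ "p (j + 1) - 1"]) (auto simp: entry)
  qed
  have "mono p a $$ (i, j) ^ r = 1" if "i < n" "j < n" "mono p a $$ (i, j) \<noteq> 0" for i j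
    using that a[of j] by (auto simp: mono_def split: if_splits)
  then show ?thesis
    using row col by (simp add: G_def) (simp add: mono_def)
qed

lemma G_mono:
  assumes "M \<in> carrier G"
  obtains p a where "monomial_data p a" "M = mono p a"
proof -
  have M: "M \<in> carrier_mat n n"
    and row: "\<And>i. i < n \<Longrightarrow> \<exists>!j. j < n \<and> M $$ (i, j) \<noteq> 0"
    and col: "\<And>j. j < n \<Longrightarrow> \<exists>!i. i < n \<and> M $$ (i, j) \<noteq> 0"
    and root: "\<And>i j. i < n \<Longrightarrow> j < n \<Longrightarrow> M $$ (i, j) \<noteq> 0 \<Longrightarrow> M $$ (i, j) ^ r = 1"
    using assms by (auto simp: G_def)
  \<comment> \<open>Column j has its nonzero entry in row \<open>f j\<close>, and the condition on
    rows makes \<open>f\<close> injective. The permutation \<open>p\<close> below is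
    \<open>f\<close> moved from indices starting at 0 to indices starting at 1.\<close>
  obtain f where f: "f j < n" "M $$ (f j, j) \<noteq> 0" if "j < n" for j
    using col by metis
  have f_unique: "i = f j" if "i < n" "j < n" "M $$ (i, j) \<noteq> 0" for i j
    using that f col by blast
  define p where "p j = (if j \<in> {1..n} then f (j - 1) + 1 else j)" for j
  define a where "a j = M $$ (f (j - 1), j - 1)" for j
  have inj_f: "j = k" if "j < n" "k < n" "f j = f k" for j k
    using that f(1)[of j] f(2)[of j] f(2)[of k] row[of "f j"] by metis
  have p_in: "p j \<in> {1..n}" if "j \<in> {1..n}" for j
  proof -
    have "j - 1 < n" using that by auto
    then show ?thesis
      using that f(1)[of "j - 1"] by (simp add: p_def)
  qed
  have "inj_on p {1..n}"
  proof (rule inj_onI)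
    fix j k assume jk: "j \<in> {1..n}" "k \<in> {1..n}" "p j = p k"
    then have "j - 1 < n" "k - 1 < n" "f (j - 1) = f (k - 1)"
      by (auto simp: p_def)
    then have "j - 1 = k - 1"
      by (rule inj_f)
    then show "j = k" using jk by auto
  qed
  then have "bij_betw p {1..n} {1..n}"
    unfolding bij_betw_def using p_in by (intro conjI endo_inj_surj) auto
  then have "p permutes {1..n}"
    by (rule bij_imp_permutes) (auto simp: p_def)
  moreover have "a i ^ r = 1" if "i \<in> {1..n}" for i
  proof -
    have "i - 1 < n" using that by auto
    then show ?thesis
      unfolding a_def using f by (intro root)
  qed
  ultimately have "monomial_data p a"
    by (simp add: monomial_data_def)
  moreover have "M = mono p a"
  proof (rule eq_matI)
    fix i j assume "i < dim_row (mono p a)" "j < dim_col (mono p a)"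
    then have ij: "i < n" "j < n" by (auto simp: mono_def)
    then show "M $$ (i, j) = mono p a $$ (i, j)"
      using f_unique[of i j] by (auto simp: mono_def p_def a_def)
  qed (use M in \<open>auto simp: mono_def\<close>)
  ultimately show thesis
    by (rule that)
qed

lemma monomial_data_comp:
  assumes "monomial_data p a" "monomial_data q b"
  shows "monomial_data (p \<circ> q) (\<lambda>j. a (q j) * b j)"
  using assms permutes_in_image[of q "{1..n}"]
  by (simp add: monomial_data_def permutes_compose power_mult_distrib)

lemma monomial_data_id: "monomial_data id (\<lambda>_. 1)"
  by (simp add: monomial_data_def permutes_id)

lemma G_mult_mono: "monomial_data p a \<Longrightarrow> monomial_data q b \<Longrightarrow>
    mono p a \<otimes>\<^bsub>G\<^esub> mono q b = mono (p \<circ> q) (\<lambda>j. a (q j) * b j)"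
  by (simp add: G_def mono_mult monomial_data_def)

lemma G_one: "\<one>\<^bsub>G\<^esub> = mono id (\<lambda>_. 1)"
  by (simp add: G_def mono_one)

lemma G_carrier_mat: "M \<in> carrier G \<Longrightarrow> M \<in> carrier_mat n n"
  by (simp add: G_def)

lemma G_mult: "M \<otimes>\<^bsub>G\<^esub> N = M * N"
  by (simp add: G_def)

lemma G_monoid: "Group.monoid G"
proof (rule monoidI)
  fix M N assume "M \<in> carrier G" "N \<in> carrier G"
  then obtain p a q b where "monomial_data p a" "monomial_data q b" "M = mono p a" "N = mono q b"
    by (elim G_mono)
  then show "M \<otimes>\<^bsub>G\<^esub> N \<in> carrier G"
    by (simp add: G_mult_mono mono_in_G monomial_data_comp)
next
  show "\<one>\<^bsub>G\<^esub> \<in> carrier G"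
    unfolding G_one by (rule mono_in_G[OF monomial_data_id])
next
  fix M N P assume "M \<in> carrier G" "N \<in> carrier G" "P \<in> carrier G"
  then show "M \<otimes>\<^bsub>G\<^esub> N \<otimes>\<^bsub>G\<^esub> P = M \<otimes>\<^bsub>G\<^esub> (N \<otimes>\<^bsub>G\<^esub> P)"
    unfolding G_mult by (intro assoc_mult_mat[of _ n n _ n _ n] G_carrier_mat)
next
  fix M assume "M \<in> carrier G"
  then show "\<one>\<^bsub>G\<^esub> \<otimes>\<^bsub>G\<^esub> M = M" "M \<otimes>\<^bsub>G\<^esub> \<one>\<^bsub>G\<^esub> = M"
    using G_carrier_mat[of M] by (simp_all add: G_mult G_one mono_one)
qed

lemma monomial_data_inv:
  assumes "monomial_data p a"
  shows "monomial_data (Hilbert_Choice.inv p) (\<lambda>i. inverse (a (Hilbert_Choice.inv p i)))"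
  using assms permutes_in_image[OF permutes_inv, of p "{1..n}"]
  by (simp add: monomial_data_def permutes_inv power_inverse)

lemma G_inv_mono:
  assumes "monomial_data p a"
  shows "inv\<^bsub>G\<^esub> (mono p a) = mono (Hilbert_Choice.inv p) (\<lambda>i. inverse (a (Hilbert_Choice.inv p i)))"
proof -
  interpret Gm: Group.monoid G by (rule G_monoid)
  have p: "p permutes {1..n}" and a: "\<And>i. i \<in> {1..n} \<Longrightarrow> a i \<noteq> 0"
    using assms root_neq_0 by (auto simp: monomial_data_def)
  have inv_in: "Hilbert_Choice.inv p i \<in> {1..n}" if "i \<in> {1..n}" for i
    using permutes_in_image[OF permutes_inv[OF p]] that by auto
  show ?thesis
  proof (rule Gm.inv_unique'[symmetric])
    show "mono p a \<otimes>\<^bsub>G\<^esub> mono (Hilbert_Choice.inv p) (\<lambda>i. inverse (a (Hilbert_Choice.inv p i))) = \<one>\<^bsub>G\<^esub>"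
      unfolding G_one G_mult_mono[OF assms monomial_data_inv[OF assms]]
      using a inv_in by (intro mono_cong) (auto simp: permutes_inverses[OF p])
    show "mono (Hilbert_Choice.inv p) (\<lambda>i. inverse (a (Hilbert_Choice.inv p i))) \<otimes>\<^bsub>G\<^esub> mono p a = \<one>\<^bsub>G\<^esub>"
      unfolding G_one G_mult_mono[OF monomial_data_inv[OF assms] assms]
      using a by (intro mono_cong) (auto simp: permutes_inverses[OF p])
  qed (use assms monomial_data_inv mono_in_G in auto)
qed

lemma zeta_cis: "\<zeta> = cis (2 * pi / r)"
  by (simp add: \<zeta>_def cis_conv_exp mult_ac)

lemma zeta_root: "\<zeta> ^ r = 1"
  using r_pos by (simp add: zeta_cis DeMoivre)

lemma zeta_neq_0: "\<zeta> \<noteq> 0"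
  using root_neq_0[OF zeta_root] .

lemma bij_zeta: "bij_betw (\<lambda>l. \<zeta> ^ l) {..<r} (unit_roots r)"
proof -
  have "(\<lambda>l. \<zeta> ^ l) = (\<lambda>k. cis (2 * pi * real k / real r))"
    by (simp add: zeta_cis DeMoivre mult_ac)
  then show ?thesis
    using Complex.bij_betw_roots_unity[OF r_pos] by simp
qed

lemma zeta_mat_mono: "i \<in> {1..n} \<Longrightarrow> zeta_mat i = mono id ((\<lambda>_. 1)(i := \<zeta>))"
  unfolding zeta_mat_def mono_def by (rule cong_mat) auto

lemma s_mono: "i \<in> {1..n} \<Longrightarrow> j \<in> {1..n} \<Longrightarrow> s i j = mono (transpose i j) (\<lambda>_. 1)"
  unfolding s_def mono_def by (rule cong_mat) (auto simp: transpose_def split: if_splits)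

lemma monomial_data_s: "i \<in> {1..n} \<Longrightarrow> j \<in> {1..n} \<Longrightarrow> monomial_data (transpose i j) (\<lambda>_. 1)"
  by (auto simp: monomial_data_def intro!: permutes_swap_id)

lemma monomial_data_diag: "u ^ r = 1 \<Longrightarrow> monomial_data id ((\<lambda>_. 1)(i := u))"
  by (simp add: monomial_data_def permutes_id)

lemma zeta_power_root: "(\<zeta> ^ l) ^ r = 1"
  by (metis mult.commute power_mult power_one zeta_root)

lemma zeta_pow_nat: "i \<in> {1..n} \<Longrightarrow> zeta_pow i (int l) = mono id ((\<lambda>_. 1)(i := \<zeta> ^ l))"
proof -
  assume i: "i \<in> {1..n}"
  have "zeta_mat i [^]\<^bsub>G\<^esub> l = mono id ((\<lambda>_. 1)(i := \<zeta> ^ l))"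
  proof (induction l)
    case 0
    show ?case
      by (simp add: G_one) (rule mono_cong, auto)
  next
    case (Suc l)
    have "zeta_mat i [^]\<^bsub>G\<^esub> Suc l = mono id ((\<lambda>_. 1)(i := \<zeta> ^ l)) \<otimes>\<^bsub>G\<^esub> mono id ((\<lambda>_. 1)(i := \<zeta>))"
      unfolding nat_pow_Suc Suc unfolding zeta_mat_mono[OF i] ..
    also have "\<dots> = mono id ((\<lambda>_. 1)(i := \<zeta> ^ Suc l))"
      by (subst G_mult_mono) (auto intro!: monomial_data_diag mono_cong simp: zeta_power_root zeta_root)
    finally show ?case .
  qed
  then show ?thesis
    by (simp add: zeta_pow_def int_pow_int)
qed

lemma zeta_pow_neg: "i \<in> {1..n} \<Longrightarrow> zeta_pow i (- int l) = mono id ((\<lambda>_. 1)(i := inverse (\<zeta> ^ l)))"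
proof -
  assume i: "i \<in> {1..n}"
  have "zeta_pow i (- int l) = inv\<^bsub>G\<^esub> (zeta_pow i (int l))"
  proof (cases "l = 0")
    \<comment> \<open>The exponent -0 is not negative, so \<open>int_pow\<close> does not unfold to
      an inverse here.\<close>
    case True
    then show ?thesis
      using Group.monoid.inv_one[OF G_monoid] by (simp add: zeta_pow_def int_pow_def nat_pow_def)
  next
    case False
    then show ?thesis
      by (simp add: zeta_pow_def int_pow_int) (simp add: int_pow_def2)
  qed
  also have "\<dots> = mono id ((\<lambda>_. 1)(i := inverse (\<zeta> ^ l)))"
    unfolding zeta_pow_nat[OF i]
    by (subst G_inv_mono) (auto intro!: monomial_data_diag mono_cong simp: zeta_power_root)
  finally show ?thesis .
qed

lemma monomial_data_refl:
  "i \<in> {1..n} \<Longrightarrow> j \<in> {1..n} \<Longrightarrow> \<xi> ^ r = 1 \<Longrightarrow> monomial_data (transpose i j) (refl_coeff i j \<xi>)"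
  by (auto simp: monomial_data_def refl_coeff_def power_inverse intro!: permutes_swap_id)

lemma s_conj_mono:
  assumes "i \<in> {1..n}" "j \<in> {1..n}" "i \<noteq> j"
  shows "s_conj i j l = mono (transpose i j) (refl_coeff i j (\<zeta> ^ l))"
proof -
  have inv: "monomial_data id ((\<lambda>_. 1)(i := inverse (\<zeta> ^ l)))"
    by (rule monomial_data_diag) (simp add: power_inverse zeta_power_root)
  have pow: "monomial_data id ((\<lambda>_. 1)(i := \<zeta> ^ l))"
    by (rule monomial_data_diag) (rule zeta_power_root)
  note data = inv pow monomial_data_s[OF assms(1,2)]
  show ?thesis
    unfolding s_conj_def zeta_pow_nat[OF assms(1)] zeta_pow_neg[OF assms(1)] s_mono[OF assms(1,2)]
    using assms(3)
    by (simp add: G_mult_mono data monomial_data_comp[OF pow data(3), simplified])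
      (rule mono_cong; auto simp: refl_coeff_def transpose_def)
qed

end

section \<open>The rational Cherednik algebra\<close>

context cherednik_pos
begin

abbreviation "car \<equiv> carrier (free_algebra gens)"

lemma x_closed: "i \<in> {1..n} \<Longrightarrow> x i \<in> car"
  unfolding x_def by (rule free_algebra_var) (simp add: gens_def)

lemma y_closed: "i \<in> {1..n} \<Longrightarrow> y i \<in> car"
  unfolding y_def by (rule free_algebra_var) (simp add: gens_def)

lemma t_closed: "w \<in> carrier G \<Longrightarrow> t w \<in> car"
  unfolding t_def by (rule free_algebra_var) (simp add: gens_def)

lemma act_x_closed: "act_x w j \<in> car"
  unfolding act_x_def by (intro free_algebra_sum free_algebra_mult free_algebra_scal x_closed)

lemma act_y_closed: "act_y w j \<in> car"
  unfolding act_y_def by (intro free_algebra_sum free_algebra_mult free_algebra_scal y_closed)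

lemma s_conj_closed: "i \<in> {1..n} \<Longrightarrow> j \<in> {1..n} \<Longrightarrow> i \<noteq> j \<Longrightarrow> s_conj i j l \<in> carrier G"
  by (simp add: s_conj_mono mono_in_G monomial_data_refl zeta_power_root)

lemma zeta_pow_closed: "i \<in> {1..n} \<Longrightarrow> zeta_pow i (int l) \<in> carrier G"
  by (simp add: zeta_pow_nat mono_in_G monomial_data_diag zeta_power_root)

lemma zeta_mat_closed: "i \<in> {1..n} \<Longrightarrow> zeta_mat i \<in> carrier G"
  by (simp add: zeta_mat_mono mono_in_G monomial_data_diag zeta_root)

lemma s_closed: "i \<in> {1..n} \<Longrightarrow> j \<in> {1..n} \<Longrightarrow> s i j \<in> carrier G"
  by (simp add: s_mono mono_in_G monomial_data_s)

lemma G_closed: "w \<in> carrier G \<Longrightarrow> v \<in> carrier G \<Longrightarrow> w \<otimes>\<^bsub>G\<^esub> v \<in> carrier G"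
  by (rule Group.monoid.m_closed[OF G_monoid])

lemmas closed = x_closed y_closed t_closed act_x_closed act_y_closed s_conj_closed zeta_pow_closed
  zeta_mat_closed s_closed G_closed free_algebra_closed

lemma relations_closed: "relations \<subseteq> car"
proof -
  have "\<one>\<^bsub>G\<^esub> \<in> carrier G"
    by (rule Group.monoid.one_closed[OF G_monoid])
  then show ?thesis
    unfolding relations_def by (intro Un_least subsetI) (auto intro!: closed)
qed

sublocale F: ring "free_algebra gens"
  by (rule free_algebra_ring)

lemma rel_ideal: "ideal rel_ideal (free_algebra gens)"
  unfolding rel_ideal_def by (rule F.genideal_ideal[OF relations_closed])

sublocale H: ring H
  unfolding H_def by (rule ideal.quotient_is_ring[OF rel_ideal])

section \<open>Equations in H as equations in a ring type\<close>

definition K :: "gen ncpoly set" where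
  "K = extended_ideal gens rel_ideal"

text \<open>\<open>q\<close> replaces \<open>cls\<close> in computations: it is additive and
  multiplicative on the whole type, without conditions on the letters that occur.\<close>

definition q :: "gen ncpoly \<Rightarrow> gen ncpoly quotients" where
  "q = quotient_emb K"

lemma two_sided_K: "two_sided K"
  unfolding K_def by (rule two_sided_extended_ideal[OF rel_ideal])

lemma q_0: "q 0 = 0"
  and q_add: "q (p + p') = q p + q p'"
  and q_diff: "q (p - p') = q p - q p'"
  and q_mult: "q (p * p') = q p * q p'"
  and q_sum: "q (sum f F) = (\<Sum>i \<in> F. q (f i))"
  by (simp_all add: q_def quotient_emb_add quotient_emb_diff quotient_emb_mult quotient_emb_sum)

lemmas q_simps = q_0 q_add q_diff q_mult q_sum

lemma q_relation:
  assumes "u \<in> relations"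
  shows "q u = 0"
proof -
  have "u \<in> rel_ideal" "u \<in> car"
    using assms F.genideal_self[OF relations_closed] relations_closed by (auto simp: rel_ideal_def)
  then have "u - 0 \<in> K"
    by (simp add: K_def extended_ideal_def restrict_letters_id)
  then have "q u = q 0"
    unfolding q_def by (rule iffD2[OF quotient_emb_eq_iff[OF two_sided_K]])
  then show ?thesis
    by (simp add: q_0)
qed

text \<open>On polynomials in the generators the retraction is the identity, so there
  \<open>K\<close> and the relation ideal have the same members. This is how results return from the
  ring type to H.\<close>

lemma cls_eq_iff:
  assumes "p \<in> car" "p' \<in> car"
  shows "cls p = cls p' \<longleftrightarrow> q p = q p'"
proof -
  have "p - p' \<in> car"
    using assms by (rule free_algebra_diff)
  moreover have "q p = q p' \<longleftrightarrow> p - p' \<in> K"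
    unfolding q_def by (rule quotient_emb_eq_iff[OF two_sided_K])
  ultimately have "q p = q p' \<longleftrightarrow> p - p' \<in> rel_ideal"
    by (simp add: K_def extended_ideal_def restrict_letters_id)
  also have "p - p' = p \<ominus>\<^bsub>free_algebra gens\<^esub> p'"
    using assms by (simp add: a_minus_def free_algebra_a_inv)
  finally show ?thesis
    unfolding cls_def using F.quotient_eq_iff_same_a_r_cos[OF rel_ideal assms] by simp
qed

lemma cls_hom: "cls \<in> ring_hom (free_algebra gens) H"
  using ideal.rcos_ring_hom[OF rel_ideal] by (simp add: H_def cls_def[abs_def])

lemma cls_closed: "p \<in> car \<Longrightarrow> cls p \<in> carrier H"
  using ring_hom_closed[OF cls_hom] .

lemma cls_add: "p \<in> car \<Longrightarrow> p' \<in> car \<Longrightarrow> cls (p + p') = cls p \<oplus>\<^bsub>H\<^esub> cls p'"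
  using ring_hom_add[OF cls_hom, of p p'] by simp

lemma cls_mult: "p \<in> car \<Longrightarrow> p' \<in> car \<Longrightarrow> cls (p * p') = cls p \<otimes>\<^bsub>H\<^esub> cls p'"
  using ring_hom_mult[OF cls_hom, of p p'] by simp

lemma cls_one: "cls 1 = \<one>\<^bsub>H\<^esub>"
  using ring_hom_one[OF cls_hom] by simp

section \<open>The defining relations in terms of monomial matrices\<close>

lemma act_x_mono:
  assumes "monomial_data p a" "j \<in> {1..n}"
  shows "act_x (mono p a) j = scal (inverse (a j)) * x (p j)"
proof -
  have p: "p permutes {1..n}" using assms by (simp add: monomial_data_def)
  have eq: "j = Hilbert_Choice.inv p i \<longleftrightarrow> i = p j" for i
    using permutes_inv_eq[OF p, of i j] by auto
  have "act_x (mono p a) j = (\<Sum>i = 1..n. if i = p j then scal (inverse (a j)) * x i else 0)"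
    unfolding act_x_def G_inv_mono[OF assms(1)]
    using assms(2) by (intro sum.cong refl) (auto simp: mono_index eq scal_0 permutes_inverses(2)[OF p])
  then show ?thesis
    using permutes_in_image[OF p, of j] assms(2) by simp
qed

lemma act_y_mono:
  assumes "monomial_data p a" "j \<in> {1..n}"
  shows "act_y (mono p a) j = scal (a j) * y (p j)"
proof -
  have p: "p permutes {1..n}" using assms by (simp add: monomial_data_def)
  have "act_y (mono p a) j = (\<Sum>i = 1..n. if i = p j then scal (a j) * y i else 0)"
    unfolding act_y_def using assms(2) by (intro sum.cong refl) (auto simp: mono_index scal_0)
  then show ?thesis
    using permutes_in_image[OF p, of j] assms(2) by simp
qed

text \<open>With roots of unity as summation variables, a shift of exponents is multiplication by a
  root, and no reduction modulo r is needed.\<close>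

lemma sum_zeta_roots: "(\<Sum>l<r. g (\<zeta> ^ l)) = (\<Sum>\<xi> \<in> unit_roots r. g \<xi>)"
  by (rule sum.reindex_bij_betw[OF bij_zeta])

lemma q_scal_comm: "q p * q (scal a) = q (scal a) * q p"
  by (metis q_mult scal_comm)

lemma q_scal_1: "q (scal 1) * q p = q p"
  by (simp add: scal_1 flip: q_mult)

text \<open>The defining relations sum over \<open>1 \<le> l < r\<close>; the index \<open>l = 0\<close> may be added, because its
  coefficient vanishes, whatever \<open>c\<^sub>0\<close> is.\<close>

sublocale rel: cherednik_relations r n "c 0" \<kappa> "\<lambda>l. c l * (1 - \<zeta> powi (- int l))" \<zeta>
  "\<lambda>a. q (scal a)" "\<lambda>i. q (x i)" "\<lambda>i. q (y i)" "\<lambda>p a. q (t (mono p a))"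
proof
  show "r > 0" "n > 0" "\<zeta> ^ r = 1"
    by (rule r_pos n_pos zeta_root)+
  show "q (scal (u + v)) = q (scal u) + q (scal v)" "q (scal (u * v)) = q (scal u) * q (scal v)" for u v
    by (simp_all add: scal_add scal_mult q_simps)
  show "q (x i) * q (scal u) = q (scal u) * q (x i)" "q (y i) * q (scal u) = q (scal u) * q (y i)"
    "q (t (mono p a)) * q (scal u) = q (scal u) * q (t (mono p a))" for i u p a
    by (rule q_scal_comm)+
  show "q (scal 1) * q (x i) = q (x i)" "q (scal 1) * q (y i) = q (y i)"
    "q (scal 1) * q (t (mono p a)) = q (t (mono p a))" for i p a
    by (rule q_scal_1)+
  show "q (t (mono p a)) = q (t (mono p' b))"
    if "\<And>i. i \<in> {1..n} \<Longrightarrow> p i = p' i" "\<And>i. i \<in> {1..n} \<Longrightarrow> a i = b i" for p p' a b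
    using mono_cong[OF that] by simp
  have "t \<one>\<^bsub>G\<^esub> - 1 \<in> relations"
    unfolding relations_def by blast
  then show "q (t (mono id (\<lambda>_. 1))) = q (scal 1)"
    using q_relation[of "t \<one>\<^bsub>G\<^esub> - 1"] by (simp add: q_simps G_one scal_1)
  show "q (t (mono p a)) * q (t (mono p' b)) = q (t (mono (p \<circ> p') (\<lambda>j. a (p' j) * b j)))"
    if "p permutes {1..n}" "p' permutes {1..n}"
      "\<And>i. i \<in> {1..n} \<Longrightarrow> a i ^ r = 1" "\<And>i. i \<in> {1..n} \<Longrightarrow> b i ^ r = 1" for p p' a b
  proof -
    have data: "monomial_data p a" "monomial_data p' b"
      using that by (auto simp: monomial_data_def)
    have "t (mono p a) * t (mono p' b) - t (mono p a \<otimes>\<^bsub>G\<^esub> mono p' b) \<in> relations"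
      unfolding relations_def using data[THEN mono_in_G] by blast
    then show ?thesis
      using q_relation by (fastforce simp: q_simps G_mult_mono[OF data])
  qed
  show "q (t (mono p a)) * q (x j) = q (scal (inverse (a j))) * q (x (p j)) * q (t (mono p a))"
    if "p permutes {1..n}" "\<And>i. i \<in> {1..n} \<Longrightarrow> a i ^ r = 1" "j \<in> {1..n}" for p a j
  proof -
    have data: "monomial_data p a"
      using that by (auto simp: monomial_data_def)
    have "t (mono p a) * x j - act_x (mono p a) j * t (mono p a) \<in> relations"
      unfolding relations_def using mono_in_G[OF data] that(3) by blast
    then show ?thesis
      using q_relation by (fastforce simp: q_simps act_x_mono[OF data that(3)])
  qed
  show "q (t (mono p a)) * q (y j) = q (scal (a j)) * q (y (p j)) * q (t (mono p a))"
    if "p permutes {1..n}" "\<And>i. i \<in> {1..n} \<Longrightarrow> a i ^ r = 1" "j \<in> {1..n}" for p a j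
  proof -
    have data: "monomial_data p a"
      using that by (auto simp: monomial_data_def)
    have "t (mono p a) * y j - act_y (mono p a) j * t (mono p a) \<in> relations"
      unfolding relations_def using mono_in_G[OF data] that(3) by blast
    then show ?thesis
      using q_relation by (fastforce simp: q_simps act_y_mono[OF data that(3)])
  qed
  fix i j assume i: "i \<in> {1..n}"
  have "y i * x i -
        (x i * y i + scal \<kappa>
         - (\<Sum>l = 1..<r. scal (c l * (1 - \<zeta> powi (- int l))) * t (zeta_pow i (int l)))
         - scal (c 0) * (\<Sum>j \<in> {1..n} - {i}. \<Sum>l<r. t (s_conj i j l))) \<in> relations"
    unfolding relations_def using i by blast
  then have "q (y i) * q (x i) = q (x i) * q (y i) + q (scal \<kappa>)
      - (\<Sum>l = 1..<r. q (scal (c l * (1 - \<zeta> powi (- int l)))) * q (t (zeta_pow i (int l))))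
      - q (scal (c 0)) * (\<Sum>j \<in> {1..n} - {i}. \<Sum>l<r. q (t (s_conj i j l)))"
    using q_relation by (fastforce simp: q_simps)
  also have "(\<Sum>l = 1..<r. q (scal (c l * (1 - \<zeta> powi (- int l)))) * q (t (zeta_pow i (int l)))) =
      (\<Sum>l<r. q (scal (c l * (1 - \<zeta> powi (- int l)))) * q (t (zeta_pow i (int l))))"
    by (rule sum.mono_neutral_left) (auto simp: not_le scal_0 q_0)
  also have "\<dots> = (\<Sum>l<r. q (scal (c l * (1 - \<zeta> powi (- int l)))) * q (t (mono id ((\<lambda>_. 1)(i := \<zeta> ^ l)))))"
    by (simp add: zeta_pow_nat[OF i])
  also have "(\<Sum>j \<in> {1..n} - {i}. \<Sum>l<r. q (t (s_conj i j l))) =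
      (\<Sum>j \<in> {1..n} - {i}. \<Sum>\<xi> \<in> unit_roots r. q (t (mono (transpose i j) (refl_coeff i j \<xi>))))"
  proof (rule sum.cong[OF refl])
    fix j assume "j \<in> {1..n} - {i}"
    then have "(\<Sum>l<r. q (t (s_conj i j l))) = (\<Sum>l<r. q (t (mono (transpose i j) (refl_coeff i j (\<zeta> ^ l)))))"
      using i by (simp add: s_conj_mono)
    also have "\<dots> = (\<Sum>\<xi> \<in> unit_roots r. q (t (mono (transpose i j) (refl_coeff i j \<xi>))))"
      by (rule sum_zeta_roots)
    finally show "(\<Sum>l<r. q (t (s_conj i j l))) = (\<Sum>\<xi> \<in> unit_roots r. q (t (mono (transpose i j) (refl_coeff i j \<xi>))))" .
  qed
  finally show "q (y i) * q (x i) = q (x i) * q (y i) + q (scal \<kappa>)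
      - (\<Sum>l<r. q (scal (c l * (1 - \<zeta> powi (- int l)))) * q (t (mono id ((\<lambda>_. 1)(i := \<zeta> ^ l)))))
      - q (scal (c 0)) * (\<Sum>j \<in> {1..n} - {i}. \<Sum>\<xi> \<in> unit_roots r. q (t (mono (transpose i j) (refl_coeff i j \<xi>))))" .
  assume j: "j \<in> {1..n}"
  have "x i * x j - x j * x i \<in> relations" "y i * y j - y j * y i \<in> relations"
    unfolding relations_def using i j by blast+
  then show "q (x i) * q (x j) = q (x j) * q (x i)" "q (y i) * q (y j) = q (y j) * q (y i)"
    using q_relation by (fastforce simp: q_simps)+
  assume ij: "i \<noteq> j"
  have "y i * x j - (x j * y i + scal (c 0) * (\<Sum>l<r. scal (\<zeta> powi (- int l)) * t (s_conj i j l))) \<in> relations"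
    unfolding relations_def using i j ij by blast
  then have "q (y i) * q (x j) = q (x j) * q (y i) +
      q (scal (c 0)) * (\<Sum>l<r. q (scal (\<zeta> powi (- int l))) * q (t (s_conj i j l)))"
    using q_relation by (fastforce simp: q_simps)
  also have "(\<Sum>l<r. q (scal (\<zeta> powi (- int l))) * q (t (s_conj i j l))) =
      (\<Sum>l<r. q (scal (inverse (\<zeta> ^ l))) * q (t (mono (transpose i j) (refl_coeff i j (\<zeta> ^ l)))))"
    using i j ij by (simp add: s_conj_mono power_int_minus)
  also have "\<dots> = (\<Sum>\<xi> \<in> unit_roots r. q (scal (inverse \<xi>)) * q (t (mono (transpose i j) (refl_coeff i j \<xi>))))"
    by (rule sum_zeta_roots)
  finally show "q (y i) * q (x j) = q (x j) * q (y i) + q (scal (c 0)) *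
      (\<Sum>\<xi> \<in> unit_roots r. q (scal (inverse \<xi>)) * q (t (mono (transpose i j) (refl_coeff i j \<xi>))))" .
qed

lemma q_B:
  assumes "i \<in> {1..n}" "j \<in> {1..n}" "i \<noteq> j"
  shows "(\<Sum>l<r. q (t (s_conj i j l))) = rel.B i j"
proof -
  have "(\<Sum>l<r. q (t (s_conj i j l))) = (\<Sum>l<r. q (t (mono (transpose i j) (refl_coeff i j (\<zeta> ^ l)))))"
    using assms by (simp add: s_conj_mono)
  also have "\<dots> = rel.B i j"
    unfolding rel.B_def by (rule sum_zeta_roots)
  finally show ?thesis .
qed

lemma q_z: "i \<in> {1..n} \<Longrightarrow> q (z i) = rel.z i"
  by (simp add: z_def rel.z_def rel.Y_def q_simps q_B)

lemma z_closed: "i \<in> {1..n} \<Longrightarrow> z i \<in> car"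
  unfolding z_def by (auto intro!: closed)

lemma q_S: "i \<in> {1..<n} \<Longrightarrow> q (t (s i (i + 1))) = rel.S i"
  by (simp add: rel.S_def s_mono)

lemma q_D: "i \<in> {1..n} \<Longrightarrow> q (t (zeta_mat i)) = rel.D i"
  by (simp add: rel.D_def zeta_mat_mono)

lemma pi_factor:
  assumes "i \<in> {1..<n}"
  shows "zeta_pow i (int l) \<otimes>\<^bsub>G\<^esub> zeta_pow (i + 1) (- int l) =
      mono id ((\<lambda>_. 1)(i := \<zeta> ^ l, i + 1 := inverse (\<zeta> ^ l)))"
proof -
  have i: "i \<in> {1..n}" "i + 1 \<in> {1..n}" using assms by auto
  show ?thesis
    unfolding zeta_pow_nat[OF i(1)] zeta_pow_neg[OF i(2)]
    by (subst G_mult_mono) (auto intro!: monomial_data_diag mono_cong simp: zeta_power_root power_inverse)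
qed

lemma q_pi: "i \<in> {1..<n} \<Longrightarrow> q (\<pi> i) = rel.\<pi> i"
proof -
  assume i: "i \<in> {1..<n}"
  have "q (\<pi> i) = (\<Sum>l<r. q (t (mono id ((\<lambda>_. 1)(i := \<zeta> ^ l, i + 1 := inverse (\<zeta> ^ l))))))"
    by (simp add: \<pi>_def q_sum pi_factor[OF i])
  also have "\<dots> = rel.\<pi> i"
    unfolding rel.\<pi>_def by (rule sum_zeta_roots)
  finally show ?thesis .
qed

lemma pi_closed: "i \<in> {1..<n} \<Longrightarrow> \<pi> i \<in> car"
  unfolding \<pi>_def
  by (intro free_algebra_sum t_closed, subst pi_factor)
    (auto simp: monomial_data_def permutes_id zeta_power_root power_inverse intro!: mono_in_G)

text \<open>Orthogonality of the characters of Z/r: a geometric sum over an r-th root of unity other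
  than 1 vanishes.\<close>

lemma zeta_orthogonality:
  assumes "l < r" "m < r"
  shows "(\<Sum>j<r. (\<zeta> ^ m / \<zeta> ^ l) ^ j) = (if l = m then of_nat r else 0)"
proof (cases "l = m")
  case True
  then show ?thesis using zeta_neq_0 by simp
next
  case False
  define \<omega> where "\<omega> = \<zeta> ^ m / \<zeta> ^ l"
  have "\<zeta> ^ m \<noteq> \<zeta> ^ l"
    using bij_zeta False assms by (auto simp: bij_betw_def inj_on_def)
  then have "\<omega> \<noteq> 1"
    using zeta_neq_0 by (simp add: \<omega>_def)
  moreover have "\<omega> ^ r = 1"
    by (simp add: \<omega>_def power_divide zeta_power_root)
  ultimately have "(\<Sum>j<r. \<omega> ^ j) = 0"
    by (simp add: geometric_sum)
  then show ?thesis
    using False by (simp add: \<omega>_def)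
qed

text \<open>d is the Fourier transform of c on Z/r. The shifts of its argument by 1 and 2 multiply
  the m-th term by \<zeta>^{-m} and \<zeta>^{-2m}, whose difference is \<zeta>^{-m} (1 -
  \<zeta>^{-m}); orthogonality then extracts the term m = l.\<close>

lemma fourier_coefficient:
  assumes "l < r"
  shows "(\<Sum>j<r. (d (int j - 1) - d (int j - 2)) * (1 / of_nat r * \<zeta> powi (- int l * int j))) =
    c l * (1 - \<zeta> powi (- int l)) * inverse (\<zeta> ^ l)"
proof -
  have d_diff: "d (int j - 1) - d (int j - 2) =
      (\<Sum>m<r. c m * (1 - \<zeta> powi (- int m)) * inverse (\<zeta> ^ m) * (\<zeta> ^ m) ^ j)" for j
  proof -
    have "d (int j - 1) - d (int j - 2) =
        (\<Sum>m = 1..<r. (\<zeta> powi (int m * (int j - 1)) - \<zeta> powi (int m * (int j - 2))) * c m)"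
      by (simp add: d_def sum_subtractf left_diff_distrib)
    also have "\<dots> = (\<Sum>m = 1..<r. c m * (1 - \<zeta> powi (- int m)) * inverse (\<zeta> ^ m) * (\<zeta> ^ m) ^ j)"
    proof (rule sum.cong[OF refl])
      fix m
      have pow: "\<zeta> powi (int m * int j) = (\<zeta> ^ m) ^ j"
        by (simp add: power_int_mult)
      have "\<zeta> powi (int m * (int j - 1)) = (\<zeta> ^ m) ^ j * inverse (\<zeta> ^ m)"
        using zeta_neq_0 by (simp add: right_diff_distrib power_int_diff pow divide_inverse)
      moreover have "int m * (int j - 2) = int m * (int j - 1) - int m"
        by (simp add: right_diff_distrib)
      then have "\<zeta> powi (int m * (int j - 2)) = \<zeta> powi (int m * (int j - 1)) * inverse (\<zeta> ^ m)"
        using zeta_neq_0 power_int_diff[of \<zeta> "int m * (int j - 1)" "int m"] by (simp add: divide_inverse)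
      ultimately show "(\<zeta> powi (int m * (int j - 1)) - \<zeta> powi (int m * (int j - 2))) * c m =
          c m * (1 - \<zeta> powi (- int m)) * inverse (\<zeta> ^ m) * (\<zeta> ^ m) ^ j"
        by (simp add: power_int_minus algebra_simps)
    qed
    \<comment> \<open>The index 0 may be added since 1 - \<zeta>^0 = 0, although \<open>c 0\<close>
      need not vanish.\<close>
    also have "\<dots> = (\<Sum>m<r. c m * (1 - \<zeta> powi (- int m)) * inverse (\<zeta> ^ m) * (\<zeta> ^ m) ^ j)"
      by (rule sum.mono_neutral_left) (auto simp: not_le)
    finally show ?thesis .
  qed
  have pow: "\<zeta> powi (- int l * int j) = inverse (\<zeta> ^ l) ^ j" for j
    by (simp add: power_int_minus power_inverse power_int_mult)
  let ?e = "\<lambda>m. c m * (1 - \<zeta> powi (- int m)) * inverse (\<zeta> ^ m)"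
  have "(\<Sum>j<r. (d (int j - 1) - d (int j - 2)) * (1 / of_nat r * \<zeta> powi (- int l * int j))) =
      (\<Sum>j<r. \<Sum>m<r. ?e m / of_nat r * (\<zeta> ^ m / \<zeta> ^ l) ^ j)"
    unfolding d_diff pow sum_distrib_right
    by (intro sum.cong refl) (simp add: power_mult_distrib divide_inverse power_inverse mult_ac)
  also have "\<dots> = (\<Sum>m<r. ?e m / of_nat r * (\<Sum>j<r. (\<zeta> ^ m / \<zeta> ^ l) ^ j))"
    by (subst sum.swap) (simp add: sum_distrib_left)
  also have "\<dots> = (\<Sum>m<r. if m = l then ?e l else 0)"
    using r_pos by (intro sum.cong refl) (auto simp: zeta_orthogonality[OF assms])
  also have "\<dots> = ?e l"
    using assms by simp
  finally show ?thesis .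
qed

definition \<delta> :: "gen ncpoly" where
  "\<delta> = scal \<kappa> - (\<Sum>j<r. scal (d (int j - 1) - d (int j - 2)) * \<epsilon> 1 (int j))"

lemma q_\<delta>: "q \<delta> = rel.\<delta>"
proof -
  have 1: "1 \<in> {1..n}" using n_pos by auto
  let ?t = "\<lambda>l. t (zeta_pow 1 (int l))"
  have "(\<Sum>j<r. scal (d (int j - 1) - d (int j - 2)) * \<epsilon> 1 (int j)) =
      (\<Sum>j<r. \<Sum>l<r. scal ((d (int j - 1) - d (int j - 2)) * (1 / of_nat r * \<zeta> powi (- int l * int j))) * ?t l)"
    by (simp only: \<epsilon>_def sum_distrib_left scal_mult mult.assoc)
  also have "\<dots> = (\<Sum>l<r. scal (\<Sum>j<r. (d (int j - 1) - d (int j - 2)) * (1 / of_nat r * \<zeta> powi (- int l * int j))) * ?t l)"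
    by (subst sum.swap) (simp only: scal_sum sum_distrib_right)
  also have "\<dots> = (\<Sum>l<r. scal (c l * (1 - \<zeta> powi (- int l)) * inverse (\<zeta> ^ l)) * ?t l)"
    by (intro sum.cong refl) (simp only: fourier_coefficient lessThan_iff)
  finally have "\<delta> = scal \<kappa> - (\<Sum>l<r. scal (c l * (1 - \<zeta> powi (- int l)) * inverse (\<zeta> ^ l)) * ?t l)"
    by (simp add: \<delta>_def)
  then show ?thesis
    by (simp add: rel.\<delta>_def q_simps zeta_pow_nat[OF 1])
qed

lemma \<delta>_closed: "\<delta> \<in> car"
  using n_pos unfolding \<delta>_def \<epsilon>_def by (auto intro!: closed)

section \<open>The permutations in \<Phi> and \<Psi>\<close>

definition list_perm :: "nat list \<Rightarrow> nat \<Rightarrow> nat" where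
  "list_perm is = foldr (\<lambda>i f. transpose i (i + 1) \<circ> f) is id"

lemma list_perm_Nil [simp]: "list_perm [] = id"
  by (rule ext) (simp add: list_perm_def)

lemma list_perm_Cons [simp]: "list_perm (i # is) = transpose i (i + 1) \<circ> list_perm is"
  by (rule ext) (simp add: list_perm_def)

lemma list_perm_append: "list_perm (is @ js) = list_perm is \<circ> list_perm js"
  by (induction "is") (auto simp: comp_assoc)

lemma list_perm_permutes: "set is \<subseteq> {1..<n} \<Longrightarrow> list_perm is permutes {1..n}"
proof (induction "is")
  case Nil
  then show ?case by (simp only: list_perm_Nil permutes_id)
next
  case (Cons i "is")
  then have "transpose i (i + 1) permutes {1..n}"
    by (intro rel.adjacent_permutes) auto
  then show ?case
    unfolding list_perm_Cons using Cons by (intro permutes_compose) auto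
qed

text \<open>Matrix product and composition have the same order: the last factor acts first.\<close>

lemma G_list_prod_mono:
  "set is \<subseteq> {1..<n} \<Longrightarrow> G_list_prod (map (\<lambda>i. s i (i + 1)) is) = mono (list_perm is) (\<lambda>_. 1)"
proof (induction "is")
  case Nil
  then show ?case by (simp add: G_list_prod_def G_one id_def)
next
  case (Cons i "is")
  then have i: "i \<in> {1..n}" "i + 1 \<in> {1..n}" by auto
  have "G_list_prod (map (\<lambda>i. s i (i + 1)) (i # is)) =
      mono (transpose i (i + 1)) (\<lambda>_. 1) \<otimes>\<^bsub>G\<^esub> mono (list_perm is) (\<lambda>_. 1)"
    using Cons by (simp add: G_list_prod_def s_mono[OF i])
  also have "\<dots> = mono (list_perm (i # is)) (\<lambda>_. 1)"
    using Cons monomial_data_s[OF i] list_perm_permutes[of "is"]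
    by (subst G_mult_mono) (auto simp: monomial_data_def)
  finally show ?case .
qed

text \<open>The last clause serves the induction: the next transposition exchanges m and m+1, and
  m+1 has to be fixed so far.\<close>

lemma descending_perm:
  "m \<ge> 1 \<Longrightarrow> list_perm (rev [1..<m]) 1 = m \<and>
    (\<forall>i \<in> {1..<m}. list_perm (rev [1..<m]) (i + 1) = i) \<and> (\<forall>i > m. list_perm (rev [1..<m]) i = i)"
proof (induction m rule: nat_induct_at_least)
  case base
  then show ?case by auto
next
  case (Suc m)
  have "rev [1..<Suc m] = [m] @ rev [1..<m]"
    using Suc by simp
  then have "list_perm (rev [1..<Suc m]) = transpose m (m + 1) \<circ> list_perm (rev [1..<m])"
    unfolding \<open>rev [1..<Suc m] = _\<close> list_perm_append by simp
  then show ?case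
    using Suc by (auto simp: transpose_def less_Suc_eq)
qed

lemma ascending_perm:
  "m \<ge> 1 \<Longrightarrow> list_perm [1..<m] m = 1 \<and>
    (\<forall>i \<in> {1..<m}. list_perm [1..<m] i = i + 1) \<and> (\<forall>i > m. list_perm [1..<m] i = i)"
proof (induction m rule: nat_induct_at_least)
  case base
  then show ?case by auto
next
  case (Suc m)
  have "[1..<Suc m] = [1..<m] @ [m]"
    using Suc by simp
  then have "list_perm [1..<Suc m] = list_perm [1..<m] \<circ> transpose m (m + 1)"
    unfolding \<open>[1..<Suc m] = _\<close> list_perm_append by simp
  then show ?case
    using Suc by (auto simp: transpose_def less_Suc_eq)
qed

definition \<Phi>' :: "gen ncpoly" where
  "\<Phi>' = x n * t (G_list_prod (map (\<lambda>i. s i (i + 1)) (rev [1..<n])))"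

definition \<Psi>' :: "gen ncpoly" where
  "\<Psi>' = y 1 * t (G_list_prod (map (\<lambda>i. s i (i + 1)) [1..<n]))"

lemma list_perm_data: "set is \<subseteq> {1..<n} \<Longrightarrow> monomial_data (list_perm is) (\<lambda>_. 1)"
  by (simp add: monomial_data_def list_perm_permutes)

lemma \<Phi>'_closed: "\<Phi>' \<in> car"
  using n_pos unfolding \<Phi>'_def
  by (subst G_list_prod_mono) (auto intro!: closed mono_in_G list_perm_data)

lemma \<Psi>'_closed: "\<Psi>' \<in> car"
  using n_pos unfolding \<Psi>'_def
  by (subst G_list_prod_mono) (auto intro!: closed mono_in_G list_perm_data)

lemma q_\<Phi>': "q \<Phi>' = rel.\<Phi> (list_perm (rev [1..<n]))"
proof -
  have "q \<Phi>' = q (x n) * q (t (mono (list_perm (rev [1..<n])) (\<lambda>_. 1)))"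
    unfolding \<Phi>'_def by (subst G_list_prod_mono) (auto simp: q_mult)
  then show ?thesis
    using descending_perm[of n] n_pos
    by (subst rel.\<Phi>_def) (auto intro!: list_perm_permutes)
qed

lemma q_\<Psi>': "q \<Psi>' = rel.\<Psi> (list_perm [1..<n])"
proof -
  have "q \<Psi>' = q (y 1) * q (t (mono (list_perm [1..<n]) (\<lambda>_. 1)))"
    unfolding \<Psi>'_def by (subst G_list_prod_mono) (auto simp: q_mult)
  then show ?thesis
    using ascending_perm[of n] n_pos
    by (subst rel.\<Psi>_def) (auto intro!: list_perm_permutes)
qed

lemma q_intertwine_\<Phi>:
  shows "i \<in> {1..<n} \<Longrightarrow> q (z i * \<Phi>') = q (\<Phi>' * z (i + 1))"
    and "q (z n * \<Phi>') = q (\<Phi>' * (z 1 + \<delta>))"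
    and "i \<in> {1..<n} \<Longrightarrow> q (t (zeta_mat i) * \<Phi>') = q (\<Phi>' * t (zeta_mat (i + 1)))"
    and "q (t (zeta_mat n) * \<Phi>') = q (\<Phi>' * (scal (inverse \<zeta>) * t (zeta_mat 1)))"
proof -
  let ?w = "list_perm (rev [1..<n])"
  have w: "?w permutes {1..n}" "?w 1 = n" "\<And>i. i \<in> {1..<n} \<Longrightarrow> ?w (i + 1) = i"
    using descending_perm[of n] n_pos by (auto intro!: list_perm_permutes)
  have n: "1 \<in> {1..n}" "n \<in> {1..n}" using n_pos by auto
  show "q (z n * \<Phi>') = q (\<Phi>' * (z 1 + \<delta>))"
    using rel.z_n_\<Phi>[OF w] n by (simp add: q_simps q_z q_\<delta> q_\<Phi>')
  show "q (t (zeta_mat n) * \<Phi>') = q (\<Phi>' * (scal (inverse \<zeta>) * t (zeta_mat 1)))"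
    using rel.D_n_\<Phi>[OF w] n by (simp add: q_simps q_D q_\<Phi>')
  assume i: "i \<in> {1..<n}"
  then have i': "i \<in> {1..n}" "i + 1 \<in> {1..n}" by auto
  show "q (z i * \<Phi>') = q (\<Phi>' * z (i + 1))"
    using rel.z_\<Phi>[OF w i] i' by (simp add: q_simps q_z q_\<Phi>')
  show "q (t (zeta_mat i) * \<Phi>') = q (\<Phi>' * t (zeta_mat (i + 1)))"
    using rel.D_\<Phi>[OF w i] i' by (simp add: q_simps q_D q_\<Phi>')
qed

lemma q_intertwine_\<Psi>:
  shows "i \<in> {1..<n} \<Longrightarrow> q (z (i + 1) * \<Psi>') = q (\<Psi>' * z i)"
    and "q ((z 1 + \<delta>) * \<Psi>') = q (\<Psi>' * z n)"
    and "i \<in> {1..<n} \<Longrightarrow> q (t (zeta_mat (i + 1)) * \<Psi>') = q (\<Psi>' * t (zeta_mat i))"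
    and "q (scal (inverse \<zeta>) * t (zeta_mat 1) * \<Psi>') = q (\<Psi>' * t (zeta_mat n))"
proof -
  let ?w = "list_perm [1..<n]"
  have w: "?w permutes {1..n}" "?w n = 1" "\<And>i. i \<in> {1..<n} \<Longrightarrow> ?w i = i + 1"
    using ascending_perm[of n] n_pos by (auto intro!: list_perm_permutes)
  have n: "1 \<in> {1..n}" "n \<in> {1..n}" using n_pos by auto
  show "q ((z 1 + \<delta>) * \<Psi>') = q (\<Psi>' * z n)"
    using rel.z_1_\<Psi>[OF w] n by (simp add: q_simps q_z q_\<delta> q_\<Psi>')
  show "q (scal (inverse \<zeta>) * t (zeta_mat 1) * \<Psi>') = q (\<Psi>' * t (zeta_mat n))"
    using rel.D_1_\<Psi>[OF w] n by (simp add: q_simps q_D q_\<Psi>')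
  assume i: "i \<in> {1..<n}"
  then have i': "i \<in> {1..n}" "i + 1 \<in> {1..n}" by auto
  show "q (z (i + 1) * \<Psi>') = q (\<Psi>' * z i)"
    using rel.z_\<Psi>[OF w i] i' by (simp add: q_simps q_z q_\<Psi>')
  show "q (t (zeta_mat (i + 1)) * \<Psi>') = q (\<Psi>' * t (zeta_mat i))"
    using rel.D_\<Psi>[OF w i] i' by (simp add: q_simps q_D q_\<Psi>')
qed

end

section \<open>Symmetric polynomials\<close>

type_synonym poly_z = "(nat \<Rightarrow>\<^sub>0 nat) \<Rightarrow>\<^sub>0 complex"

text \<open>\<open>map_key w\<close> precomposes exponents with \<open>w\<close>, so the variable
  with index w(i) becomes the one with index i: this is the action of the inverse permutation.
  Invariance under all permutations is the same for both.\<close>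

definition relabel :: "(nat \<Rightarrow> nat) \<Rightarrow> poly_z \<Rightarrow> poly_z" where
  "relabel w = monoid_ext (Poly_Mapping.single 0) (\<lambda>m. Poly_Mapping.single (Poly_Mapping.map_key w m) 1)"

lemma relabel_extension:
  "inj w \<Longrightarrow> monoid_extension (Poly_Mapping.single 0 :: complex \<Rightarrow> poly_z)
    (\<lambda>m. Poly_Mapping.single (Poly_Mapping.map_key w m) 1)"
  by unfold_locales (auto simp: single_add mult_single map_key_plus mult.commute)

lemma relabel_eq_sum:
  "relabel w p = (\<Sum>m \<in> Poly_Mapping.keys p. Poly_Mapping.single (Poly_Mapping.map_key w m) (Poly_Mapping.lookup p m))"
  by (simp add: relabel_def monoid_ext_def mult_single)

lemma lookup_map_key: "inj w \<Longrightarrow> Poly_Mapping.lookup (Poly_Mapping.map_key w m) i = Poly_Mapping.lookup m (w i)"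
  by (simp add: map_key.rep_eq)

lemma map_key_eq_iff:
  assumes "bij w"
  shows "Poly_Mapping.map_key w m = Poly_Mapping.map_key w k \<longleftrightarrow> m = k"
proof
  assume eq: "Poly_Mapping.map_key w m = Poly_Mapping.map_key w k"
  show "m = k"
  proof (rule poly_mapping_eqI)
    fix i
    obtain j where "i = w j" using assms by (meson bij_pointE)
    then show "Poly_Mapping.lookup m i = Poly_Mapping.lookup k i"
      using eq lookup_map_key[OF bij_is_inj[OF assms]] by metis
  qed
qed simp

lemma lookup_relabel:
  assumes "bij w"
  shows "Poly_Mapping.lookup (relabel w p) (Poly_Mapping.map_key w m) = Poly_Mapping.lookup p m"
proof -
  have "Poly_Mapping.lookup (relabel w p) (Poly_Mapping.map_key w m) =
      (\<Sum>k \<in> Poly_Mapping.keys p. if k = m then Poly_Mapping.lookup p k else 0)"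
    by (simp add: relabel_eq_sum lookup_sum lookup_single map_key_eq_iff[OF assms] when_def)
  then show ?thesis
    by (simp add: in_keys_iff)
qed

lemma relabel_eq_iff:
  assumes "bij w"
  shows "relabel w p = p \<longleftrightarrow> (\<forall>m. Poly_Mapping.lookup p (Poly_Mapping.map_key w m) = Poly_Mapping.lookup p m)"
proof
  assume "relabel w p = p"
  then show "\<forall>m. Poly_Mapping.lookup p (Poly_Mapping.map_key w m) = Poly_Mapping.lookup p m"
    using lookup_relabel[OF assms, of p] by simp
next
  assume *: "\<forall>m. Poly_Mapping.lookup p (Poly_Mapping.map_key w m) = Poly_Mapping.lookup p m"
  show "relabel w p = p"
  proof (rule poly_mapping_eqI)
    fix k :: "nat \<Rightarrow>\<^sub>0 nat"
    let ?v = "inv_into UNIV w"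
    have "bij ?v" "w \<circ> ?v = id" "?v \<circ> w = id"
      using assms by (auto simp: bij_imp_bij_inv fun_eq_iff bij_is_surj surj_f_inv_f bij_is_inj)
    then have "Poly_Mapping.map_key w (Poly_Mapping.map_key ?v k) = k"
      using map_key_compose[OF bij_is_inj[OF assms] bij_is_inj, of ?v k] map_key_id[of k] by (simp add: id_def)
    then obtain m where "k = Poly_Mapping.map_key w m" by metis
    then show "Poly_Mapping.lookup (relabel w p) k = Poly_Mapping.lookup p k"
      using * lookup_relabel[OF assms] by simp
  qed
qed

text \<open>Since \<open>relabel w\<close> is multiplicative, this form of symmetry passes to
  products at once, unlike the condition on coefficients.\<close>

lemma symmetric_polys_iff:
  "p \<in> symmetric_polys n \<longleftrightarrow> (\<forall>m \<in> Poly_Mapping.keys p. Poly_Mapping.keys m \<subseteq> {1..n}) \<and>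
    (\<forall>w. w permutes {1..n} \<longrightarrow> relabel w p = p)"
  unfolding symmetric_polys_def using relabel_eq_iff permutes_bij by blast

definition polys_in :: "nat \<Rightarrow> poly_z set" where
  "polys_in n = {p. \<forall>m \<in> Poly_Mapping.keys p. Poly_Mapping.keys m \<subseteq> {1..n}}"

lemma polys_in_mult:
  assumes "p \<in> polys_in n" "p' \<in> polys_in n"
  shows "p * p' \<in> polys_in n"
proof -
  have "Poly_Mapping.keys m \<subseteq> {1..n}" if m: "m \<in> Poly_Mapping.keys (p * p')" for m
  proof -
    obtain u v where "m = u + v" "u \<in> Poly_Mapping.keys p" "v \<in> Poly_Mapping.keys p'"
      using subsetD[OF keys_mult m] by blast
    then show ?thesis
      using assms Poly_Mapping.keys_add[of u v] unfolding polys_in_def by blast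
  qed
  then show ?thesis
    by (simp add: polys_in_def)
qed

lemma polys_in_1: "1 \<in> polys_in n"
  by (simp add: polys_in_def)

lemma polys_in_prod: "(\<And>i. i \<in> F \<Longrightarrow> f i \<in> polys_in n) \<Longrightarrow> prod f F \<in> polys_in n"
  by (induction F rule: infinite_finite_induct) (auto intro: polys_in_1 polys_in_mult)

definition X_z :: "nat \<Rightarrow> poly_z" where
  "X_z i = Poly_Mapping.single (Poly_Mapping.single i 1) 1"

lemma polys_in_X_diff: "i \<in> {1..n} \<Longrightarrow> j \<in> {1..n} \<Longrightarrow> X_z i - X_z j \<in> polys_in n"
  using keys_diff[of "X_z i" "X_z j"] by (auto simp: polys_in_def X_z_def)

lemma relabel_mult: "inj w \<Longrightarrow> relabel w (p * p') = relabel w p * relabel w p'"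
  unfolding relabel_def by (rule monoid_extension.ext_mult[OF relabel_extension])

lemma relabel_1: "inj w \<Longrightarrow> relabel w 1 = 1"
  by (simp add: relabel_eq_sum)

lemma relabel_prod: "inj w \<Longrightarrow> relabel w (prod f F) = (\<Prod>i \<in> F. relabel w (f i))"
  by (induction F rule: infinite_finite_induct) (auto simp: relabel_1 relabel_mult)

lemma relabel_X: "bij w \<Longrightarrow> relabel w (X_z (w i)) = X_z i"
  by (simp add: relabel_eq_sum X_z_def map_key_single bij_is_inj)

lemma relabel_diff: "inj w \<Longrightarrow> relabel w (p - p') = relabel w p - relabel w p'"
  unfolding relabel_def by (rule monoid_extension.ext_diff[OF relabel_extension])

lemma symmetric_mult: "p \<in> symmetric_polys n \<Longrightarrow> p' \<in> symmetric_polys n \<Longrightarrow> p * p' \<in> symmetric_polys n"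
  using polys_in_mult[of p n p'] permutes_inj[of _ "{1..n}"]
  by (auto simp: symmetric_polys_iff polys_in_def relabel_mult)

lemma symmetric_1: "1 \<in> symmetric_polys n"
  using permutes_inj[of _ "{1..n}"] by (auto simp: symmetric_polys_iff relabel_1)

text \<open>A product over all permutations is used rather than a squared Vandermonde product,
  because composing with a fixed permutation only reindexes the factors and no signs occur. The
  factor for the identity is the difference to be inverted.\<close>

definition orbit_prod :: "nat \<Rightarrow> nat \<Rightarrow> nat \<Rightarrow> poly_z" where
  "orbit_prod n i j = (\<Prod>w | w permutes {1..n}. X_z (w i) - X_z (w j))"

definition orbit_cofactor :: "nat \<Rightarrow> nat \<Rightarrow> nat \<Rightarrow> poly_z" where
  "orbit_cofactor n i j = (\<Prod>w \<in> {w. w permutes {1..n}} - {id}. X_z (w i) - X_z (w j))"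

lemma orbit_prod_eq: "orbit_prod n i j = (X_z i - X_z j) * orbit_cofactor n i j"
  unfolding orbit_prod_def orbit_cofactor_def
  by (subst prod.remove[of _ id]) (auto simp: finite_permutations permutes_id)

lemma X_z_inj: "X_z i = X_z j \<longleftrightarrow> i = j"
proof
  assume "X_z i = X_z j"
  then have "{Poly_Mapping.single i (1::nat)} = {Poly_Mapping.single j 1}"
    unfolding X_z_def by (metis keys_single zero_neq_one)
  then have "{i} = {j}"
    by (metis keys_single singleton_inject zero_neq_one)
  then show "i = j" by simp
qed simp

lemma orbit_prod_nonzero:
  assumes "i \<noteq> j"
  shows "orbit_prod n i j \<noteq> 0"
proof -
  have "X_z (w i) - X_z (w j) \<noteq> 0" if "w permutes {1..n}" for w
    using assms permutes_inj[OF that] by (auto simp: X_z_inj dest: injD)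
  then show ?thesis
    by (simp add: orbit_prod_def finite_permutations)
qed

lemma orbit_prod_symmetric:
  assumes "i \<in> {1..n}" "j \<in> {1..n}"
  shows "orbit_prod n i j \<in> symmetric_polys n"
proof -
  have "orbit_prod n i j \<in> polys_in n"
    unfolding orbit_prod_def using assms
    by (intro polys_in_prod polys_in_X_diff) (simp_all only: mem_Collect_eq permutes_in_image)
  moreover have "relabel w (orbit_prod n i j) = orbit_prod n i j" if w: "w permutes {1..n}" for w
  proof -
    let ?v = "inv_into UNIV w"
    have v: "?v permutes {1..n}" by (rule permutes_inv[OF w])
    have X: "relabel w (X_z k) = X_z (?v k)" for k
      using relabel_X[OF permutes_bij[OF w], of "?v k"] permutes_inverses(1)[OF w] by simp
    have "relabel w (orbit_prod n i j) =
        (\<Prod>u | u permutes {1..n}. X_z ((?v \<circ> u) i) - X_z ((?v \<circ> u) j))"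
      using permutes_inj[OF w] by (simp add: orbit_prod_def relabel_prod relabel_diff X)
    also have "\<dots> = orbit_prod n i j"
      unfolding orbit_prod_def
      by (rule prod.reindex_bij_witness[of _ "\<lambda>u. w \<circ> u" "\<lambda>u. ?v \<circ> u"])
        (use w v in \<open>auto simp: permutes_compose permutes_inverses fun_eq_iff\<close>)
    finally show ?thesis .
  qed
  ultimately show ?thesis
    by (simp add: symmetric_polys_iff polys_in_def)
qed


section \<open>Symmetric polynomials in the \<open>z\<^sub>i\<close> are central\<close>

context cherednik_pos
begin

text \<open>In the free algebra the z_i do not commute, so a monomial has to be lifted in some
  order. Evaluation becomes multiplicative only after \<open>q\<close>, where they do
  commute.\<close>

definition zmon :: "(nat \<Rightarrow>\<^sub>0 nat) \<Rightarrow> gen ncpoly" where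
  "zmon m = prod_list (map (\<lambda>i. z i ^ Poly_Mapping.lookup m i) [1..<n + 1])"

definition zpoly :: "poly_z \<Rightarrow> gen ncpoly" where
  "zpoly = monoid_ext scal zmon"

lemma eval_z_eq: "eval_z p = cls (zpoly p)"
  by (simp add: eval_z_def zpoly_def monoid_ext_def zmon_def)

definition commutes :: "gen ncpoly \<Rightarrow> gen ncpoly \<Rightarrow> bool" where
  "commutes a b \<longleftrightarrow> q a * q b = q b * q a"

lemma commutes_sym: "commutes a b \<longleftrightarrow> commutes b a"
  by (auto simp: commutes_def)

lemma commutes_1: "commutes a 1"
  by (simp add: commutes_def flip: q_mult)

lemma commutes_mult: "commutes a b \<Longrightarrow> commutes a b' \<Longrightarrow> commutes a (b * b')"
  unfolding commutes_def q_mult by (rule mult_intertwine[OF _ sym])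

lemma commutes_power: "commutes a b \<Longrightarrow> commutes a (b ^ k)"
  by (induction k) (auto intro: commutes_1 commutes_mult)

lemma commutes_prod_list: "(\<And>i. i \<in> set is \<Longrightarrow> commutes a (f i)) \<Longrightarrow> commutes a (prod_list (map f is))"
  by (induction "is") (auto intro: commutes_1 commutes_mult)

lemma commutes_zmon: "(\<And>i. i \<in> {1..n} \<Longrightarrow> commutes a (z i ^ Poly_Mapping.lookup m i)) \<Longrightarrow> commutes a (zmon m)"
  unfolding zmon_def by (rule commutes_prod_list) auto

lemma commutes_z_z: "i \<in> {1..n} \<Longrightarrow> j \<in> {1..n} \<Longrightarrow> commutes (z i) (z j)"
  by (simp add: commutes_def q_z rel.z_z)

lemma q_prod_list_powers:
  assumes "set is \<subseteq> {1..n}"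
  shows "q (prod_list (map (\<lambda>i. z i ^ (f i + g i)) is)) =
    q (prod_list (map (\<lambda>i. z i ^ f i) is)) * q (prod_list (map (\<lambda>i. z i ^ g i) is))"
  using assms
proof (induction "is")
  case Nil
  then show ?case by (simp flip: q_mult)
next
  case (Cons i "is")
  let ?P = "prod_list (map (\<lambda>i. z i ^ f i) is)"
  have "commutes (z i ^ g i) ?P"
    using Cons.prems
    by (intro commutes_prod_list commutes_power commutes_sym[THEN iffD1, OF commutes_power] commutes_z_z) auto
  then have "q (z i ^ g i) * (q ?P * a) = q ?P * (q (z i ^ g i) * a)" for a
    by (simp add: commutes_def flip: mult.assoc)
  then show ?case
    using Cons by (simp add: power_add q_mult mult.assoc)
qed

sublocale ev: monoid_extension "\<lambda>a. q (scal a)" "\<lambda>m. q (zmon m)"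
proof
  show "q (scal (a + b)) = q (scal a) + q (scal b)" "q (scal (a * b)) = q (scal a) * q (scal b)" for a b
    by (simp_all add: scal_add scal_mult q_simps)
  show "q (zmon m) * q (scal a) = q (scal a) * q (zmon m)" for m a
    by (rule q_scal_comm)
  show "q (zmon (m + k)) = q (zmon m) * q (zmon k)" for m k
    unfolding zmon_def lookup_add by (rule q_prod_list_powers) auto
qed

lemma q_zpoly: "q (zpoly p) = ev.ext p"
  by (simp add: zpoly_def monoid_ext_def q_simps)

lemma prod_list_ones: "prod_list (map (\<lambda>_. 1 :: 'b::monoid_mult) is) = 1"
  by (induction "is") auto

lemma prod_list_single:
  fixes f :: "nat \<Rightarrow> 'b::monoid_mult"
  shows "distinct is \<Longrightarrow> j \<in> set is \<Longrightarrow> (\<And>i. i \<noteq> j \<Longrightarrow> f i = 1) \<Longrightarrow> prod_list (map f is) = f j"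
proof (induction "is")
  case (Cons i "is")
  show ?case
  proof (cases "i = j")
    case True
    have "f k = 1" if "k \<in> set is" for k
      using Cons.prems(1) True that by (intro Cons.prems(3)) auto
    then have "prod_list (map f is) = prod_list (map (\<lambda>_. 1) is)"
      by (simp cong: map_cong)
    also have "\<dots> = 1"
      by (rule prod_list_ones)
    finally show ?thesis using True by simp
  next
    case False
    then show ?thesis using Cons by auto
  qed
qed simp

lemma ext_X: "j \<in> {1..n} \<Longrightarrow> ev.ext (X_z j) = q (z j)"
proof -
  assume j: "j \<in> {1..n}"
  have "zmon (Poly_Mapping.single j 1) = z j ^ Poly_Mapping.lookup (Poly_Mapping.single j 1) j"
    unfolding zmon_def by (rule prod_list_single) (use j in \<open>auto simp: lookup_single\<close>)
  then show ?thesis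
    by (simp add: X_z_def ev.ext_single q_scal_1)
qed

lemma ext_z: "j \<in> {1..n} \<Longrightarrow> ev.ext (X_z j) = rel.z j"
  by (simp only: ext_X q_z)

text \<open>For each \<open>a\<close> this is a subalgebra of the polynomial ring, so centrality is
  reduced to a few polynomials that generate what is needed.\<close>

definition comm_polys :: "gen ncpoly \<Rightarrow> poly_z set" where
  "comm_polys a = {p. q a * ev.ext p = ev.ext p * q a}"

lemma comm_polys_iff: "p \<in> comm_polys a \<longleftrightarrow> commutes a (zpoly p)"
  by (simp add: comm_polys_def commutes_def q_zpoly)

lemma comm_polys_add: "p \<in> comm_polys a \<Longrightarrow> p' \<in> comm_polys a \<Longrightarrow> p + p' \<in> comm_polys a"
  by (simp add: comm_polys_def ev.ext_add distrib_left distrib_right)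

lemma comm_polys_diff: "p \<in> comm_polys a \<Longrightarrow> p' \<in> comm_polys a \<Longrightarrow> p - p' \<in> comm_polys a"
  by (simp add: comm_polys_def ev.ext_diff left_diff_distrib right_diff_distrib)

lemma comm_polys_mult: "p \<in> comm_polys a \<Longrightarrow> p' \<in> comm_polys a \<Longrightarrow> p * p' \<in> comm_polys a"
  unfolding comm_polys_def ev.ext_mult mem_Collect_eq by (rule mult_intertwine[OF _ sym])

lemma comm_polys_single: "commutes a (zmon m) \<Longrightarrow> Poly_Mapping.single m u \<in> comm_polys a"
  unfolding comm_polys_def commutes_def ev.ext_single mem_Collect_eq
  by (rule mult_intertwine[OF q_scal_comm]) simp

lemma comm_polys_const: "Poly_Mapping.single 0 u \<in> comm_polys a"
proof -
  have "zmon 0 = prod_list (map (\<lambda>_. 1) [1..<n + 1])"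
    by (simp add: zmon_def)
  also have "\<dots> = 1"
    by (rule prod_list_ones)
  finally show ?thesis
    by (intro comm_polys_single) (simp add: commutes_1)
qed

lemma comm_polys_1: "1 \<in> comm_polys a"
  using comm_polys_const[of 1] by simp

lemma comm_polys_power: "p \<in> comm_polys a \<Longrightarrow> p ^ k \<in> comm_polys a"
  by (induction k) (auto intro: comm_polys_1 comm_polys_mult)

lemma comm_polys_sum: "(\<And>i. i \<in> F \<Longrightarrow> f i \<in> comm_polys a) \<Longrightarrow> sum f F \<in> comm_polys a"
  by (induction F rule: infinite_finite_induct)
    (use comm_polys_const[of 0] in \<open>auto intro: comm_polys_add\<close>)

lemma comm_polys_all: "(\<And>i. i \<in> {1..n} \<Longrightarrow> commutes a (z i)) \<Longrightarrow> p \<in> comm_polys a"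
  by (subst sum_singles[of p]) (intro comm_polys_sum comm_polys_single commutes_zmon commutes_power)

text \<open>Power sums in two variables are polynomials in u + v and u v, by the two-term recurrence
  that u and v satisfy as roots of a monic quadratic polynomial.\<close>

lemma power_sum_comm:
  assumes "u + v \<in> comm_polys a" "u * v \<in> comm_polys a"
  shows "u ^ k + v ^ k \<in> comm_polys a"
proof (induction k rule: less_induct)
  case (less k)
  consider "k = 0" | "k = 1" | l where "k = Suc (Suc l)"
    by (metis One_nat_def not0_implies_Suc)
  then show ?case
  proof cases
    case 3
    have "u ^ k + v ^ k = (u + v) * (u ^ Suc l + v ^ Suc l) - u * v * (u ^ l + v ^ l)"
      unfolding 3 by (simp add: algebra_simps)
    moreover have "u ^ Suc l + v ^ Suc l \<in> comm_polys a" "u ^ l + v ^ l \<in> comm_polys a"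
      by (rule less, simp add: 3)+
    ultimately show ?thesis
      using assms by (simp only: comm_polys_diff comm_polys_mult)
  qed (use assms comm_polys_add[OF comm_polys_1 comm_polys_1] in auto)
qed

text \<open>Taking out the common power of u v leaves an ordinary power sum.\<close>

lemma mixed_power_sum_comm:
  assumes "u + v \<in> comm_polys a" "u * v \<in> comm_polys a"
  shows "u ^ k * v ^ l + u ^ l * v ^ k \<in> comm_polys a"
proof -
  have *: "u ^ k * v ^ l + u ^ l * v ^ k \<in> comm_polys a" if le: "k \<le> l" for k l
  proof -
    obtain e where e: "l = k + e" using le_Suc_ex[OF le] by blast
    have "u ^ k * v ^ l + u ^ l * v ^ k = (u * v) ^ k * (u ^ e + v ^ e)"
      by (simp add: e power_add power_mult_distrib distrib_left mult_ac)
    also have "\<dots> \<in> comm_polys a"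
      by (intro comm_polys_mult comm_polys_power power_sum_comm assms)
    finally show ?thesis .
  qed
  show ?thesis
    using *[of k l] *[of l k] by (cases "k \<le> l") (simp_all add: add.commute)
qed

lemma X_power: "X_z i ^ k = Poly_Mapping.single (Poly_Mapping.single i k) 1"
  by (induction k) (auto simp: X_z_def mult_single simp flip: single_add Suc_eq_plus1_left)

text \<open>The part \<open>m0\<close> without the variables i and i+1 commutes with s_i. The rest
  is a mixed power sum in z_i and z_{i+1}, so only their sum and product need to commute with s_i;
  in both, the c_0 \<pi>_i terms of \<open>S_z\<close> and \<open>S_z_Suc\<close> cancel.\<close>

lemma symmetric_monomial_comm:
  assumes i: "i \<in> {1..<n}"
  shows "Poly_Mapping.single m 1 + Poly_Mapping.single (Poly_Mapping.map_key (transpose i (i + 1)) m) 1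
    \<in> comm_polys (t (s i (i + 1)))"
proof -
  let ?a = "t (s i (i + 1))"
  define m0 where "m0 = Poly_Mapping.update i 0 (Poly_Mapping.update (i + 1) 0 m)"
  define k where "k = Poly_Mapping.lookup m i"
  define l where "l = Poly_Mapping.lookup m (i + 1)"
  have m: "m = m0 + Poly_Mapping.single i k + Poly_Mapping.single (i + 1) l"
    by (rule poly_mapping_eqI) (auto simp: m0_def k_def l_def lookup_add lookup_update lookup_single when_def)
  have sm: "Poly_Mapping.map_key (transpose i (i + 1)) m = m0 + Poly_Mapping.single i l + Poly_Mapping.single (i + 1) k"
    by (rule poly_mapping_eqI)
      (auto simp: m0_def k_def l_def lookup_add lookup_update lookup_single when_def lookup_map_key transpose_def)
  have split: "Poly_Mapping.single (m0 + Poly_Mapping.single i k + Poly_Mapping.single (i + 1) l) 1 =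
      Poly_Mapping.single m0 1 * (X_z i ^ k * X_z (i + 1) ^ l)" for k l
    by (simp add: X_power mult_single add.assoc)
  have "Poly_Mapping.single m 1 + Poly_Mapping.single (Poly_Mapping.map_key (transpose i (i + 1)) m) 1 =
      Poly_Mapping.single m0 1 * (X_z i ^ k * X_z (i + 1) ^ l + X_z i ^ l * X_z (i + 1) ^ k)"
    unfolding sm by (subst m) (simp only: split distrib_left)
  moreover have "Poly_Mapping.single m0 1 \<in> comm_polys ?a"
  proof (intro comm_polys_single commutes_zmon)
    fix j assume j: "j \<in> {1..n}"
    show "commutes ?a (z j ^ Poly_Mapping.lookup m0 j)"
    proof (cases "j = i \<or> j = i + 1")
      case True
      then have "Poly_Mapping.lookup m0 j = 0"
        by (auto simp: m0_def lookup_update)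
      then show ?thesis by (simp add: commutes_1)
    next
      case False
      then show ?thesis
        using rel.S_z_other[OF i j] j by (intro commutes_power) (simp add: commutes_def q_S[OF i] q_z)
    qed
  qed
  moreover have i': "i \<in> {1..n}" "i + 1 \<in> {1..n}"
    using i by auto
  have "X_z i + X_z (i + 1) \<in> comm_polys ?a"
    using rel.S_z[OF i] rel.S_z_Suc[OF i]
    by (simp add: comm_polys_def ev.ext_add ext_z[OF i'(1)] ext_z[OF i'(2)] q_S[OF i] distrib_left distrib_right)
  moreover have "X_z i * X_z (i + 1) \<in> comm_polys ?a"
  proof -
    have "rel.S i * (rel.z i * rel.z (i + 1)) = (rel.S i * rel.z i) * rel.z (i + 1)"
      by (simp add: mult.assoc)
    also have "\<dots> = rel.z (i + 1) * (rel.S i * rel.z (i + 1)) - q (scal (c 0)) * (rel.\<pi> i * rel.z (i + 1))"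
      unfolding rel.S_z[OF i] by (simp add: left_diff_distrib mult.assoc)
    also have "\<dots> = rel.z (i + 1) * rel.z i * rel.S i"
      unfolding rel.S_z_Suc[OF i]
      by (simp add: distrib_left rel.\<pi>_z[OF i'(2)] rel.z_sc_left mult.assoc)
    also have "\<dots> = rel.z i * rel.z (i + 1) * rel.S i"
      using rel.z_z[OF i'] by simp
    finally show ?thesis
      by (simp add: comm_polys_def ev.ext_mult ext_z[OF i'(1)] ext_z[OF i'(2)] q_S[OF i])
  qed
  ultimately show ?thesis
    by (simp only: mixed_power_sum_comm comm_polys_mult)
qed

text \<open>As p equals its image under s_i, twice p is the sum of its monomials, each added to its
  own image and weighted by its coefficient. Halving is possible over the complex numbers.\<close>

lemma symmetric_comm_S:
  assumes "p \<in> symmetric_polys n" and i: "i \<in> {1..<n}"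
  shows "commutes (t (s i (i + 1))) (zpoly p)"
proof -
  let ?s = "transpose i (i + 1)"
  have "relabel ?s p = p"
    using assms rel.adjacent_permutes[OF i] by (auto simp: symmetric_polys_iff)
  then have "p + p = (\<Sum>m \<in> Poly_Mapping.keys p. Poly_Mapping.single 0 (Poly_Mapping.lookup p m) *
      (Poly_Mapping.single m 1 + Poly_Mapping.single (Poly_Mapping.map_key ?s m) 1))"
    using sum_singles[of p] by (simp add: relabel_eq_sum distrib_left mult_single sum.distrib)
  also have "\<dots> \<in> comm_polys (t (s i (i + 1)))"
    by (intro comm_polys_sum comm_polys_mult comm_polys_const symmetric_monomial_comm i)
  finally have "Poly_Mapping.single 0 (1 / 2) * (p + p) \<in> comm_polys (t (s i (i + 1)))"
    by (intro comm_polys_mult comm_polys_const)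
  moreover have "Poly_Mapping.single 0 (1 / 2) + Poly_Mapping.single 0 (1 / 2) = (1 :: poly_z)"
    by (simp flip: single_add Suc_eq_plus1_left)
  then have "Poly_Mapping.single 0 (1 / 2) * (p + p) = p"
    by (metis distrib_left distrib_right mult_1)
  ultimately show ?thesis
    by (simp only: comm_polys_iff)
qed

section \<open>From adjacent transpositions to the whole group\<close>

lemma q_mono_comp:
  assumes "monomial_data p a" "monomial_data p' b"
  shows "q (t (mono (p \<circ> p') (\<lambda>j. a (p' j) * b j))) = q (t (mono p a)) * q (t (mono p' b))"
  using assms by (intro rel.t_mult[symmetric]) (auto simp: monomial_data_def)

lemma commutes_q_mult:
  assumes "q e = q a * q b" "commutes a v" "commutes b v"
  shows "commutes e v"
  using mult_intertwine[of "q v" "q a" "q v" "q b" "q v"] assms by (simp add: commutes_def)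

text \<open>Induction on the distance: for i < j < k, conjugating (j k) by (i j) gives (i
  k).\<close>

lemma symmetric_comm_transposition:
  assumes "p \<in> symmetric_polys n" "i \<in> {1..n}" "j \<in> {1..n}" "i < j"
  shows "commutes (t (mono (transpose i j) (\<lambda>_. 1))) (zpoly p)"
  using assms(4,3,2)
proof (induction i j rule: less_Suc_induct)
  case (1 i)
  then show ?case
    using symmetric_comm_S[OF assms(1), of i] by (simp add: s_mono flip: Suc_eq_plus1)
next
  case (2 i j k)
  have data: "monomial_data (transpose i j) (\<lambda>_. 1)" "monomial_data (transpose j k) (\<lambda>_. 1)"
    using 2 by (auto intro!: monomial_data_s)
  have eq: "transpose i k = transpose i j \<circ> transpose j k \<circ> transpose i j"
    using 2 by (auto simp: transpose_def fun_eq_iff)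
  have eq1: "q (t (mono (transpose i k) (\<lambda>_. 1))) =
      q (t (mono (transpose i j \<circ> transpose j k) (\<lambda>_. 1))) * q (t (mono (transpose i j) (\<lambda>_. 1)))"
    using q_mono_comp[OF monomial_data_comp[OF data] data(1)] by (simp add: eq)
  have eq2: "q (t (mono (transpose i j \<circ> transpose j k) (\<lambda>_. 1))) =
      q (t (mono (transpose i j) (\<lambda>_. 1))) * q (t (mono (transpose j k) (\<lambda>_. 1)))"
    using q_mono_comp[OF data] by simp
  have comm: "commutes (t (mono (transpose i j) (\<lambda>_. 1))) (zpoly p)"
    "commutes (t (mono (transpose j k) (\<lambda>_. 1))) (zpoly p)"
    using 2 by auto
  show ?case
    by (rule commutes_q_mult[OF eq1 commutes_q_mult[OF eq2 comm] comm(1)])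
qed

lemma symmetric_comm_permutation:
  assumes p: "p \<in> symmetric_polys n" and "w permutes {1..n}"
  shows "commutes (t (mono w (\<lambda>_. 1))) (zpoly p)"
  using assms(2) finite_atLeastAtMost
proof (induction w rule: permutes_induct)
  case id
  have eq: "q (t (mono id (\<lambda>_. 1))) = q 1"
    using rel.t_one by (simp only: scal_1)
  show ?case
    unfolding commutes_def eq by (simp flip: q_mult)
next
  case (swap a b w)
  have comm: "commutes (t (mono (transpose a b) (\<lambda>_. 1))) (zpoly p)"
    using symmetric_comm_transposition[OF p, of a b] symmetric_comm_transposition[OF p, of b a] swap
    by (cases "a < b") (auto simp: transpose_commute)
  have eq: "q (t (mono (transpose a b \<circ> w) (\<lambda>_. 1))) = q (t (mono (transpose a b) (\<lambda>_. 1))) * q (t (mono w (\<lambda>_. 1)))"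
    using q_mono_comp[OF monomial_data_s[of a b], of w "\<lambda>_. 1"] swap by (simp add: monomial_data_def)
  show ?case
    using swap by (intro commutes_q_mult[OF eq comm]) auto
qed

lemma commutes_diag_zpoly:
  assumes "monomial_data id a"
  shows "commutes (t (mono id a)) (zpoly p)"
  unfolding comm_polys_iff[symmetric]
  by (rule comm_polys_all) (use assms rel.diag_z in \<open>auto simp: commutes_def q_z monomial_data_def\<close>)

text \<open>A monomial matrix is a permutation matrix times a diagonal one, and diagonal matrices
  already commute with each z_i.\<close>

lemma symmetric_comm_group:
  assumes "p \<in> symmetric_polys n" "w \<in> carrier G"
  shows "commutes (t w) (zpoly p)"
proof -
  obtain v a where w: "monomial_data v a" "w = mono v a"
    using assms(2) by (rule G_mono)
  have data: "monomial_data v (\<lambda>_. 1)" "monomial_data id a"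
    using w by (auto simp: monomial_data_def permutes_id)
  have eq: "q (t w) = q (t (mono v (\<lambda>_. 1))) * q (t (mono id a))"
    using q_mono_comp[OF data] w by simp
  have "commutes (t (mono v (\<lambda>_. 1))) (zpoly p)"
    using symmetric_comm_permutation[OF assms(1)] data(1) by (simp add: monomial_data_def)
  then show ?thesis
    by (rule commutes_q_mult[OF eq _ commutes_diag_zpoly[OF data(2)]])
qed

lemma commutes_z_zpoly: "i \<in> {1..n} \<Longrightarrow> commutes (z i) (zpoly p)"
  unfolding comm_polys_iff[symmetric] by (rule comm_polys_all) (rule commutes_z_z)

lemma commutes_scal: "commutes (scal a) p"
  unfolding commutes_def by (rule q_scal_comm[symmetric])

end

section \<open>Intertwining relations\<close>

context ring
begin

text \<open>\<open>generate_ring\<close> has a clause for negatives, about which the definition of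
  \<open>ring_hom\<close> is silent.\<close>

lemma hom_from_subring_a_inv:
  assumes h: "h \<in> ring_hom (R\<lparr>carrier := generate_ring R E\<rparr>) R"
    and f: "f \<in> generate_ring R E" and E: "E \<subseteq> carrier R"
  shows "h (\<ominus> f) = \<ominus> h f"
proof -
  have closed: "h g \<in> carrier R" if "g \<in> generate_ring R E" for g
    using ring_hom_closed[OF h] that by simp
  have add: "h (g \<oplus> g') = h g \<oplus> h g'" if "g \<in> generate_ring R E" "g' \<in> generate_ring R E" for g g'
    using ring_hom_add[OF h] that by simp
  have neg: "\<ominus> f \<in> generate_ring R E" and zero: "\<zero> \<in> generate_ring R E" and f': "f \<in> carrier R"
    using f generate_ring.a_inv[OF f] zero_in_generate generate_ring_in_carrier[OF E] by auto
  have "h \<zero> \<oplus> h \<zero> = h \<zero>"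
    using add[OF zero zero] by simp
  then have "h \<zero> = \<zero>"
    using closed[OF zero] by (metis add.l_cancel_one)
  then have "h (\<ominus> f) \<oplus> h f = \<zero>"
    using add[OF neg f] f' by (simp add: l_neg)
  then show ?thesis
    using minus_equality[OF _ closed[OF f] closed[OF neg]] by simp
qed

text \<open>Two homomorphisms are allowed so that one lemma covers all cases: \<phi> stands on the
  right of \<Phi>, but on the left of \<Psi>, and s_i on the left of \<sigma>_i; the other
  homomorphism is then the identity. With the identity on both sides it yields centrality.\<close>

lemma generate_ring_intertwine:
  assumes E: "E \<subseteq> carrier R" and v: "v \<in> carrier R"
    and h: "h \<in> ring_hom (R\<lparr>carrier := generate_ring R E\<rparr>) R"
    and k: "k \<in> ring_hom (R\<lparr>carrier := generate_ring R E\<rparr>) R"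
    and gen: "\<And>e. e \<in> E \<Longrightarrow> h e \<otimes> v = v \<otimes> k e"
    and f: "f \<in> generate_ring R E"
  shows "h f \<otimes> v = v \<otimes> k f"
proof -
  have closed: "h g \<in> carrier R" "k g \<in> carrier R" if "g \<in> generate_ring R E" for g
    using ring_hom_closed[OF h] ring_hom_closed[OF k] that by simp_all
  show ?thesis
    using f
  proof induction
    case one
    show ?case
      using ring_hom_one[OF h] ring_hom_one[OF k] v by simp
  next
    case (incl e)
    then show ?case by (rule gen)
  next
    case (a_inv f)
    then show ?case
      using closed[OF a_inv.hyps] v
      by (simp add: hom_from_subring_a_inv[OF h _ E] hom_from_subring_a_inv[OF k _ E] l_minus r_minus)
  next
    case (eng_add f g)
    then show ?case
      using closed[OF eng_add.hyps(1)] closed[OF eng_add.hyps(2)] v ring_hom_add[OF h, of f g] ring_hom_add[OF k, of f g]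
      by (simp add: l_distr r_distr)
  next
    case (eng_mult f g)
    have "h (f \<otimes> g) \<otimes> v = h f \<otimes> (h g \<otimes> v)"
      using closed[OF eng_mult.hyps(1)] closed[OF eng_mult.hyps(2)] v ring_hom_mult[OF h, of f g] eng_mult.hyps
      by (simp add: m_assoc)
    also have "\<dots> = (h f \<otimes> v) \<otimes> k g"
      unfolding eng_mult.IH(2) using closed[OF eng_mult.hyps(1)] closed[OF eng_mult.hyps(2)] v
      by (simp add: m_assoc)
    also have "\<dots> = v \<otimes> k (f \<otimes> g)"
      unfolding eng_mult.IH(1) using closed[OF eng_mult.hyps(1)] closed[OF eng_mult.hyps(2)] v ring_hom_mult[OF k, of f g] eng_mult.hyps
      by (simp add: m_assoc)
    finally show ?case .
  qed
qed

lemma id_ring_hom_subring: "E \<subseteq> carrier R \<Longrightarrow> id \<in> ring_hom (R\<lparr>carrier := generate_ring R E\<rparr>) R"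
  using generate_ring_in_carrier[of E] by (auto simp: ring_hom_def)

end

context cherednik_pos
begin

section \<open>Generators and elements of \<tt> and of A\<close>

abbreviation scalars :: "gen ncpoly set set" where
  "scalars \<equiv> range (\<lambda>a. cls (scal a))"

definition t_gens :: "gen ncpoly set set" where
  "t_gens = scalars \<union> ((\<lambda>i. cls (z i)) ` {1..n} \<union> (\<lambda>i. cls (t (zeta_mat i))) ` {1..n})"

definition A_gens :: "gen ncpoly set set" where
  "A_gens = scalars \<union> ((\<lambda>i. cls (z i)) ` {1..n} \<union> (\<lambda>w. cls (t w)) ` carrier G)"

lemma tt_eq: "\<tt> = H\<lparr>carrier := generate_ring H t_gens\<rparr>"
  by (simp add: \<tt>_def subalgebra_gen_def t_gens_def)

lemma A_eq: "A = H\<lparr>carrier := generate_ring H A_gens\<rparr>"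
  by (simp add: A_def subalgebra_gen_def A_gens_def)

lemma t_gens_cases:
  assumes "e \<in> t_gens"
  obtains a where "e = cls (scal a)" | i where "i \<in> {1..n}" "e = cls (z i)"
    | i where "i \<in> {1..n}" "e = cls (t (zeta_mat i))"
  using assms unfolding t_gens_def by blast

lemma t_gens_cases_last:
  assumes "e \<in> t_gens"
  obtains a where "e = cls (scal a)" | i where "i \<in> {1..<n}" "e = cls (z i)" | "e = cls (z n)"
    | i where "i \<in> {1..<n}" "e = cls (t (zeta_mat i))" | "e = cls (t (zeta_mat n))"
proof -
  have "i \<in> {1..<n} \<or> i = n" if "i \<in> {1..n}" for i
    using that by auto
  then show ?thesis
    using assms by (elim t_gens_cases) (metis that)+
qed

lemma t_gens_closed: "t_gens \<subseteq> carrier H"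
  unfolding t_gens_def by (auto intro!: cls_closed closed z_closed)

lemma A_gens_closed: "A_gens \<subseteq> carrier H"
  unfolding A_gens_def by (auto intro!: cls_closed closed z_closed)

sublocale A: ring A
  unfolding A_eq by (rule H.generate_ring_is_ring[OF A_gens_closed])

lemma A_simps [simp]: "a \<otimes>\<^bsub>A\<^esub> b = a \<otimes>\<^bsub>H\<^esub> b" "a \<oplus>\<^bsub>A\<^esub> b = a \<oplus>\<^bsub>H\<^esub> b" "\<one>\<^bsub>A\<^esub> = \<one>\<^bsub>H\<^esub>"
  by (simp_all add: A_eq)

lemma tt_subset_A: "carrier \<tt> \<subseteq> carrier A"
proof
  fix f assume "f \<in> carrier \<tt>"
  then have "f \<in> generate_ring H t_gens" by (simp add: tt_eq)
  then have "f \<in> generate_ring H A_gens"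
  proof induction
    case (incl f)
    then have "f \<in> A_gens"
      using zeta_mat_closed by (auto simp: t_gens_def A_gens_def)
    then show ?case by (rule generate_ring.incl)
  qed (auto intro: generate_ring.intros)
  then show "f \<in> carrier A" by (simp add: A_eq)
qed

lemma cls_intertwineI:
  assumes "q (a * b) = q (b' * b'')" "a \<in> car" "b \<in> car" "b' \<in> car" "b'' \<in> car"
  shows "cls a \<otimes>\<^bsub>H\<^esub> cls b = cls b' \<otimes>\<^bsub>H\<^esub> cls b''"
  using assms cls_eq_iff[of "a * b" "b' * b''"] by (simp add: cls_mult free_algebra_mult)

definition A_polys :: "gen ncpoly set" where
  "A_polys = {p \<in> car. cls p \<in> carrier A}"

lemma A_polys_z: "i \<in> {1..n} \<Longrightarrow> z i \<in> A_polys"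
  unfolding A_polys_def A_eq by (auto simp: A_gens_def intro!: generate_ring.incl z_closed)

lemma A_polys_t: "w \<in> carrier G \<Longrightarrow> t w \<in> A_polys"
  unfolding A_polys_def A_eq by (auto simp: A_gens_def intro!: generate_ring.incl t_closed)

lemma A_polys_scal: "scal a \<in> A_polys"
  unfolding A_polys_def A_eq by (auto simp: A_gens_def intro!: generate_ring.incl free_algebra_scal)

lemma A_polys_add: "p \<in> A_polys \<Longrightarrow> p' \<in> A_polys \<Longrightarrow> p + p' \<in> A_polys"
  unfolding A_polys_def A_eq by (auto simp: cls_add intro!: generate_ring.eng_add free_algebra_add)

lemma A_polys_mult: "p \<in> A_polys \<Longrightarrow> p' \<in> A_polys \<Longrightarrow> p * p' \<in> A_polys"
  unfolding A_polys_def A_eq by (auto simp: cls_mult intro!: generate_ring.eng_mult free_algebra_mult)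

lemma A_polys_diff: "p \<in> A_polys \<Longrightarrow> p' \<in> A_polys \<Longrightarrow> p - p' \<in> A_polys"
proof -
  assume *: "p \<in> A_polys" "p' \<in> A_polys"
  have "scal (- 1) + scal 1 = (0 :: gen ncpoly)"
    by (simp add: scal_0 flip: scal_add)
  then have "scal (- 1) = (- 1 :: gen ncpoly)"
    by (simp add: scal_1 eq_neg_iff_add_eq_0)
  then have "p - p' = p + scal (- 1) * p'" by simp
  then show ?thesis
    using * by (simp only: A_polys_add A_polys_mult A_polys_scal)
qed

lemma A_polys_1: "1 \<in> A_polys"
  using A_polys_scal[of 1] by (simp add: scal_1)

lemma A_polys_power: "p \<in> A_polys \<Longrightarrow> p ^ k \<in> A_polys"
  by (induction k) (auto intro: A_polys_1 A_polys_mult)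

lemma A_polys_sum: "(\<And>i. i \<in> F \<Longrightarrow> f i \<in> A_polys) \<Longrightarrow> sum f F \<in> A_polys"
  by (induction F rule: infinite_finite_induct)
    (use A_polys_scal[of 0] in \<open>auto simp: scal_0 intro: A_polys_add\<close>)

lemma A_polys_prod_list: "(\<And>i. i \<in> set is \<Longrightarrow> f i \<in> A_polys) \<Longrightarrow> prod_list (map f is) \<in> A_polys"
  by (induction "is") (auto intro: A_polys_1 A_polys_mult)

lemma A_polys_zpoly: "zpoly p \<in> A_polys"
  unfolding zpoly_def monoid_ext_def zmon_def
  by (intro A_polys_sum A_polys_mult A_polys_scal A_polys_prod_list A_polys_power A_polys_z) auto

lemma A_polys_pi: "i \<in> {1..<n} \<Longrightarrow> \<pi> i \<in> A_polys"
  unfolding \<pi>_def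
  by (intro A_polys_sum A_polys_t, subst pi_factor)
    (auto simp: monomial_data_def permutes_id zeta_power_root power_inverse intro!: mono_in_G)

lemma A_polys_car: "p \<in> A_polys \<Longrightarrow> p \<in> car"
  and A_polys_cls: "p \<in> A_polys \<Longrightarrow> cls p \<in> carrier A"
  by (auto simp: A_polys_def)

lemma symmetric_central:
  assumes "p \<in> symmetric_polys n" "a \<in> carrier A"
  shows "cls (zpoly p) \<otimes>\<^bsub>H\<^esub> a = a \<otimes>\<^bsub>H\<^esub> cls (zpoly p)"
proof -
  have zp: "zpoly p \<in> car"
    by (rule A_polys_car[OF A_polys_zpoly])
  have comm: "cls b \<otimes>\<^bsub>H\<^esub> cls (zpoly p) = cls (zpoly p) \<otimes>\<^bsub>H\<^esub> cls b"
    if "b \<in> car" "commutes b (zpoly p)" for b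
    using that zp by (intro cls_intertwineI) (auto simp: commutes_def q_mult)
  have "id a \<otimes>\<^bsub>H\<^esub> cls (zpoly p) = cls (zpoly p) \<otimes>\<^bsub>H\<^esub> id a"
  proof (rule H.generate_ring_intertwine[OF A_gens_closed, where h = id and k = id])
    show "a \<in> generate_ring H A_gens"
      using assms(2) by (simp add: A_eq)
    fix e assume "e \<in> A_gens"
    then consider a where "e = cls (scal a)" | i where "i \<in> {1..n}" "e = cls (z i)"
      | w where "w \<in> carrier G" "e = cls (t w)"
      unfolding A_gens_def by blast
    then obtain b where "b \<in> car" "e = cls b" "commutes b (zpoly p)"
      using commutes_z_zpoly symmetric_comm_group[OF assms(1)] commutes_scal
        free_algebra_scal z_closed t_closed by metis
    then show "id e \<otimes>\<^bsub>H\<^esub> cls (zpoly p) = cls (zpoly p) \<otimes>\<^bsub>H\<^esub> id e"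
      using comm by simp
  qed (use zp in \<open>auto intro: cls_closed H.id_ring_hom_subring[OF A_gens_closed]\<close>)
  then show ?thesis by simp
qed

section \<open>Localizing A at symmetric polynomials in the z_i\<close>

lemma denominators_eq: "denominators = (\<lambda>p. cls (zpoly p)) ` (symmetric_polys n - {0})"
  by (simp add: denominators_def eval_z_eq[abs_def])

lemma cls_zpoly_mult: "cls (zpoly p) \<otimes>\<^bsub>H\<^esub> cls (zpoly p') = cls (zpoly (p * p'))"
proof -
  have "q (zpoly p * zpoly p') = q (zpoly (p * p'))"
    by (simp add: q_mult q_zpoly ev.ext_mult)
  then show ?thesis
    using cls_eq_iff[of "zpoly p * zpoly p'" "zpoly (p * p')"]
    by (simp add: A_polys_car A_polys_zpoly free_algebra_mult cls_mult)
qed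

lemma cls_zpoly_1: "cls (zpoly 1) = \<one>\<^bsub>H\<^esub>"
proof -
  have "zmon 0 = 1"
    by (simp add: zmon_def prod_list_ones)
  then have "zpoly 1 = 1"
    by (simp add: zpoly_def monoid_ext_def scal_1)
  then show ?thesis
    by (simp add: cls_one)
qed

sublocale loc: central_localization A denominators
proof
  show "denominators \<subseteq> carrier A"
    unfolding denominators_eq using A_polys_cls[OF A_polys_zpoly] by blast
  show "\<one>\<^bsub>A\<^esub> \<in> denominators"
    unfolding denominators_eq using symmetric_1[of n] cls_zpoly_1
    by (intro image_eqI[of _ _ 1]) auto
  show "u \<otimes>\<^bsub>A\<^esub> v \<in> denominators" if uv: "u \<in> denominators" "v \<in> denominators" for u v
  proof -
    obtain p p' where "p \<in> symmetric_polys n" "p \<noteq> 0" "p' \<in> symmetric_polys n" "p' \<noteq> 0"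
        "u = cls (zpoly p)" "v = cls (zpoly p')"
      using uv unfolding denominators_eq by blast
    \<comment> \<open>The product polynomial is again nonzero because the polynomial ring is an
      integral domain.\<close>
    then show ?thesis
      unfolding denominators_eq
      by (intro image_eqI[of _ _ "p * p'"]) (auto simp: cls_zpoly_mult symmetric_mult)
  qed
  show "u \<otimes>\<^bsub>A\<^esub> a = a \<otimes>\<^bsub>A\<^esub> u" if "u \<in> denominators" "a \<in> carrier A" for u a
    using that symmetric_central unfolding denominators_eq by auto
qed

text \<open>The automorphism is read as a homomorphism into H, since \<Phi>, \<Psi> and the
  numerator of \<sigma>_i, past which its values are moved, are taken in H.\<close>

lemma tt_hom:
  assumes "algebra_aut \<tt> h"
  shows "h \<in> ring_hom (H\<lparr>carrier := generate_ring H t_gens\<rparr>) H"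
    and "f \<in> carrier \<tt> \<Longrightarrow> h f \<in> carrier \<tt>"
proof -
  have hom: "h \<in> ring_hom \<tt> \<tt>"
    using assms by (simp add: algebra_aut_def ring_iso_def)
  then show "f \<in> carrier \<tt> \<Longrightarrow> h f \<in> carrier \<tt>"
    by (rule ring_hom_closed)
  show "h \<in> ring_hom (H\<lparr>carrier := generate_ring H t_gens\<rparr>) H"
    using hom H.generate_ring_incl[OF t_gens_closed] unfolding tt_eq
    by (auto simp: ring_hom_def Pi_def)
qed

section \<open>Intertwining relations on all of \<tt>\<close>

lemma \<Phi>_intertwine:
  assumes \<phi>: "shift_automorphism \<phi>" and f: "f \<in> carrier \<tt>"
  shows "f \<otimes>\<^bsub>H\<^esub> \<Phi> = \<Phi> \<otimes>\<^bsub>H\<^esub> \<phi> f"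
proof -
  have aut: "algebra_aut \<tt> \<phi>" using \<phi> by (simp add: shift_automorphism_def)
  have \<Phi>_eq: "\<Phi> = cls \<Phi>'" by (simp add: \<Phi>_def \<Phi>'_def)
  have "id f \<otimes>\<^bsub>H\<^esub> \<Phi> = \<Phi> \<otimes>\<^bsub>H\<^esub> \<phi> f"
  proof (rule H.generate_ring_intertwine[OF t_gens_closed _ H.id_ring_hom_subring[OF t_gens_closed] tt_hom(1)[OF aut]])
    show "\<Phi> \<in> carrier H"
      unfolding \<Phi>_eq by (rule cls_closed[OF \<Phi>'_closed])
    show "f \<in> generate_ring H t_gens"
      using f by (simp add: tt_eq)
    fix e assume "e \<in> t_gens"
    then consider a where "e = cls (scal a)" | i where "i \<in> {1..<n}" "e = cls (z i)" | "e = cls (z n)"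
      | i where "i \<in> {1..<n}" "e = cls (t (zeta_mat i))" | "e = cls (t (zeta_mat n))"
      by (rule t_gens_cases_last)
    then show "id e \<otimes>\<^bsub>H\<^esub> \<Phi> = \<Phi> \<otimes>\<^bsub>H\<^esub> \<phi> e"
    proof cases
      case 1
      then have "\<phi> e = cls (scal a)" using aut by (simp add: algebra_aut_def)
      then show ?thesis
        unfolding \<Phi>_eq 1 id_apply
        by (simp only:) (intro cls_intertwineI closed \<Phi>'_closed, simp add: q_mult q_scal_comm)
    next
      case 2
      then have "\<phi> e = cls (z (i + 1))" using \<phi> by (simp add: shift_automorphism_def)
      then show ?thesis
        unfolding \<Phi>_eq id_apply using 2 q_intertwine_\<Phi>(1)[of i]
        by (simp only:) (intro cls_intertwineI z_closed \<Phi>'_closed, auto)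
    next
      case 3
      then have "\<phi> e = cls (z 1 + \<delta>)" using \<phi> by (simp add: shift_automorphism_def \<delta>_def add_diff_eq)
      then show ?thesis
        unfolding \<Phi>_eq id_apply using 3 q_intertwine_\<Phi>(2) n_pos
        by (simp only:) (intro cls_intertwineI z_closed \<Phi>'_closed free_algebra_add \<delta>_closed, auto)
    next
      case 4
      then have "\<phi> e = cls (t (zeta_mat (i + 1)))" using \<phi> by (simp add: shift_automorphism_def)
      then show ?thesis
        unfolding \<Phi>_eq id_apply using 4 q_intertwine_\<Phi>(3)[of i]
        by (simp only:) (intro cls_intertwineI closed \<Phi>'_closed, auto)
    next
      case 5
      then have "\<phi> e = cls (scal (inverse \<zeta>) * t (zeta_mat 1))" using \<phi> by (simp add: shift_automorphism_def)
      then show ?thesis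
        unfolding \<Phi>_eq id_apply using 5 q_intertwine_\<Phi>(4) n_pos
        by (simp only:) (intro cls_intertwineI closed \<Phi>'_closed, auto)
    qed
  qed
  then show ?thesis by simp
qed

text \<open>This is stated with \<phi> instead of its inverse, because only \<phi> has prescribed
  values on the generators.\<close>

lemma \<Psi>_intertwine:
  assumes \<phi>: "shift_automorphism \<phi>" and f: "f \<in> carrier \<tt>"
  shows "\<phi> f \<otimes>\<^bsub>H\<^esub> \<Psi> = \<Psi> \<otimes>\<^bsub>H\<^esub> f"
proof -
  have aut: "algebra_aut \<tt> \<phi>" using \<phi> by (simp add: shift_automorphism_def)
  have \<Psi>_eq: "\<Psi> = cls \<Psi>'" by (simp add: \<Psi>_def \<Psi>'_def)
  have "\<phi> f \<otimes>\<^bsub>H\<^esub> \<Psi> = \<Psi> \<otimes>\<^bsub>H\<^esub> id f"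
  proof (rule H.generate_ring_intertwine[OF t_gens_closed _ tt_hom(1)[OF aut] H.id_ring_hom_subring[OF t_gens_closed]])
    show "\<Psi> \<in> carrier H"
      unfolding \<Psi>_eq by (rule cls_closed[OF \<Psi>'_closed])
    show "f \<in> generate_ring H t_gens"
      using f by (simp add: tt_eq)
    fix e assume "e \<in> t_gens"
    then consider a where "e = cls (scal a)" | i where "i \<in> {1..<n}" "e = cls (z i)" | "e = cls (z n)"
      | i where "i \<in> {1..<n}" "e = cls (t (zeta_mat i))" | "e = cls (t (zeta_mat n))"
      by (rule t_gens_cases_last)
    then show "\<phi> e \<otimes>\<^bsub>H\<^esub> \<Psi> = \<Psi> \<otimes>\<^bsub>H\<^esub> id e"
    proof cases
      case 1
      then have "\<phi> e = cls (scal a)" using aut by (simp add: algebra_aut_def)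
      then show ?thesis
        unfolding \<Psi>_eq 1 id_apply
        by (simp only:) (intro cls_intertwineI closed \<Psi>'_closed, simp add: q_mult q_scal_comm)
    next
      case 2
      then have "\<phi> e = cls (z (i + 1))" using \<phi> by (simp add: shift_automorphism_def)
      then show ?thesis
        unfolding \<Psi>_eq id_apply using 2 q_intertwine_\<Psi>(1)[of i]
        by (simp only:) (intro cls_intertwineI z_closed \<Psi>'_closed, auto)
    next
      case 3
      then have "\<phi> e = cls (z 1 + \<delta>)" using \<phi> by (simp add: shift_automorphism_def \<delta>_def add_diff_eq)
      then show ?thesis
        unfolding \<Psi>_eq id_apply using 3 q_intertwine_\<Psi>(2) n_pos
        by (simp only:) (intro cls_intertwineI z_closed \<Psi>'_closed free_algebra_add \<delta>_closed, auto)
    next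
      case 4
      then have "\<phi> e = cls (t (zeta_mat (i + 1)))" using \<phi> by (simp add: shift_automorphism_def)
      then show ?thesis
        unfolding \<Psi>_eq id_apply using 4 q_intertwine_\<Psi>(3)[of i]
        by (simp only:) (intro cls_intertwineI closed \<Psi>'_closed, auto)
    next
      case 5
      then have "\<phi> e = cls (scal (inverse \<zeta>) * t (zeta_mat 1))" using \<phi> by (simp add: shift_automorphism_def)
      then show ?thesis
        unfolding \<Psi>_eq id_apply using 5 q_intertwine_\<Psi>(4) n_pos
        by (simp only:) (intro cls_intertwineI closed \<Psi>'_closed, auto)
    qed
  qed
  then show ?thesis by simp
qed

text \<open>The numerator of \<open>\<sigma>\<^sub>i\<close> over the denominator \<open>\<Prod>\<^bsub>w\<^esub> (z\<^bsub>w(i)\<^esub> - z\<^bsub>w(i+1)\<^esub>)\<close>.\<close>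

definition \<sigma>_num :: "nat \<Rightarrow> gen ncpoly" where
  "\<sigma>_num i = (z i - z (i + 1)) * zpoly (orbit_cofactor n i (i + 1)) * t (s i (i + 1)) +
    scal (c 0) * zpoly (orbit_cofactor n i (i + 1)) * \<pi> i"

lemma q_\<sigma>_num:
  assumes i: "i \<in> {1..<n}"
  shows "q (\<sigma>_num i) = q (zpoly (orbit_cofactor n i (i + 1))) * rel.\<tau> i"
proof -
  let ?g = "q (zpoly (orbit_cofactor n i (i + 1)))"
  have i': "i \<in> {1..n}" "i + 1 \<in> {1..n}" using i by auto
  have "(rel.z i - rel.z (i + 1)) * ?g = ?g * (rel.z i - rel.z (i + 1))"
    using commutes_z_zpoly[OF i'(1)] commutes_z_zpoly[OF i'(2)]
    by (simp add: commutes_def q_z[OF i'(1)] q_z[OF i'(2)] left_diff_distrib right_diff_distrib)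
  moreover have "q (scal (c 0)) * ?g = ?g * q (scal (c 0))"
    by (rule q_scal_comm[symmetric])
  ultimately show ?thesis
    by (simp add: \<sigma>_num_def rel.\<tau>_def q_add q_diff q_mult q_z[OF i'(1)] q_z[OF i'(2)] q_S[OF i] q_pi[OF i]
        distrib_left mult.assoc) (simp flip: mult.assoc)
qed

text \<open>The cofactor is a polynomial in the z_i and commutes with the generators of \<tt>.
  Standing to the left of \<tau>_i, it lets the already permuted generator pass unchanged, so the
  intertwining of \<tau>_i is preserved.\<close>

lemma \<sigma>_num_intertwine:
  assumes act: "permutation_action act" and i: "i \<in> {1..<n}" and f: "f \<in> carrier \<tt>"
  shows "act (transpose i (i + 1)) f \<otimes>\<^bsub>H\<^esub> cls (\<sigma>_num i) = cls (\<sigma>_num i) \<otimes>\<^bsub>H\<^esub> f"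
proof -
  let ?s = "transpose i (i + 1)"
  let ?g = "q (zpoly (orbit_cofactor n i (i + 1)))"
  have i': "i \<in> {1..n}" "i + 1 \<in> {1..n}" using i by auto
  have s: "?s permutes {1..n}" by (rule rel.adjacent_permutes[OF i])
  have aut: "algebra_aut \<tt> (act ?s)"
    and act_gens: "\<And>k. k \<in> {1..n} \<Longrightarrow> act ?s (cls (z k)) = cls (z (?s k))"
      "\<And>k. k \<in> {1..n} \<Longrightarrow> act ?s (cls (t (zeta_mat k))) = cls (t (zeta_mat (?s k)))"
    using act s by (auto simp: permutation_action_def)
  have num: "\<sigma>_num i \<in> car"
    unfolding \<sigma>_num_def using i' i
    by (intro closed z_closed pi_closed A_polys_car[OF A_polys_zpoly]) auto
  have "act ?s f \<otimes>\<^bsub>H\<^esub> cls (\<sigma>_num i) = cls (\<sigma>_num i) \<otimes>\<^bsub>H\<^esub> id f"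
  proof (rule H.generate_ring_intertwine[OF t_gens_closed _ tt_hom(1)[OF aut] H.id_ring_hom_subring[OF t_gens_closed]])
    show "cls (\<sigma>_num i) \<in> carrier H"
      by (rule cls_closed[OF num])
    show "f \<in> generate_ring H t_gens"
      using f by (simp add: tt_eq)
    fix e assume "e \<in> t_gens"
    then consider a where "e = cls (scal a)" | k where "k \<in> {1..n}" "e = cls (z k)"
      | k where "k \<in> {1..n}" "e = cls (t (zeta_mat k))"
      by (rule t_gens_cases)
    then show "act ?s e \<otimes>\<^bsub>H\<^esub> cls (\<sigma>_num i) = cls (\<sigma>_num i) \<otimes>\<^bsub>H\<^esub> id e"
    proof cases
      case 1
      then have "act ?s e = cls (scal a)" using aut by (simp add: algebra_aut_def)
      then show ?thesis
        unfolding 1 id_apply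
        by (simp only:) (intro cls_intertwineI closed num, simp add: q_mult q_scal_comm)
    next
      case 2
      have sk: "?s k \<in> {1..n}" using permutes_in_image[OF s] 2 by blast
      have "q (z (?s k)) * (?g * rel.\<tau> i) = (?g * rel.\<tau> i) * q (z k)"
      proof (rule mult_intertwine)
        show "q (z (?s k)) * ?g = ?g * q (z (?s k))"
          using commutes_z_zpoly[OF sk] by (simp add: commutes_def)
        show "rel.\<tau> i * q (z k) = q (z (?s k)) * rel.\<tau> i"
          using rel.\<tau>_z[OF i 2(1)] by (simp only: q_z[OF 2(1)] q_z[OF sk])
      qed
      then have "q (z (?s k) * \<sigma>_num i) = q (\<sigma>_num i * z k)"
        by (simp only: q_mult q_\<sigma>_num[OF i])
      then show ?thesis
        unfolding 2(2) id_apply act_gens(1)[OF 2(1)]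
        by (intro cls_intertwineI z_closed num sk 2(1))
    next
      case 3
      have sk: "?s k \<in> {1..n}" using permutes_in_image[OF s] 3 by blast
      have "q (t (zeta_mat (?s k))) * (?g * rel.\<tau> i) = (?g * rel.\<tau> i) * q (t (zeta_mat k))"
      proof (rule mult_intertwine)
        show "q (t (zeta_mat (?s k))) * ?g = ?g * q (t (zeta_mat (?s k)))"
          using commutes_diag_zpoly[OF monomial_data_diag[OF zeta_root]]
          by (simp only: zeta_mat_mono[OF sk] commutes_def)
        show "rel.\<tau> i * q (t (zeta_mat k)) = q (t (zeta_mat (?s k))) * rel.\<tau> i"
          using rel.\<tau>_D[OF i, of k] by (simp only: q_D[OF 3(1)] q_D[OF sk])
      qed
      then have "q (t (zeta_mat (?s k)) * \<sigma>_num i) = q (\<sigma>_num i * t (zeta_mat k))"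
        by (simp only: q_mult q_\<sigma>_num[OF i])
      then show ?thesis
        unfolding 3(2) id_apply act_gens(2)[OF 3(1)]
        by (intro cls_intertwineI t_closed zeta_mat_closed num sk 3(1))
    qed
  qed
  then show ?thesis by simp
qed

lemma \<sigma>_intertwine:
  assumes act: "permutation_action act" and i: "i \<in> {1..<n}" and f: "f \<in> carrier \<tt>"
  shows "\<sigma> i \<otimes>\<^bsub>A_loc\<^esub> \<iota> f = \<iota> (act (transpose i (i + 1)) f) \<otimes>\<^bsub>A_loc\<^esub> \<sigma> i"
proof -
  let ?g = "orbit_cofactor n i (i + 1)"
  have i': "i \<in> {1..n}" "i + 1 \<in> {1..n}" using i by auto
  have diff: "z i - z (i + 1) \<in> A_polys"
    using i' by (intro A_polys_diff A_polys_z)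
  have ts: "t (s i (i + 1)) \<in> A_polys"
    using i' by (intro A_polys_t s_closed)
  note mem = diff ts A_polys_zpoly[of ?g] A_polys_scal[of "c 0"] A_polys_pi[OF i]
  have aut: "algebra_aut \<tt> (act (transpose i (i + 1)))"
    using act rel.adjacent_permutes[OF i] by (auto simp: permutation_action_def)
  \<comment> \<open>z_i - z_{i+1} is the factor of the orbit product at the identity permutation, so
    the cofactor completes it to the value of a nonzero symmetric polynomial.\<close>
  have q_prod: "q ((z i - z (i + 1)) * zpoly ?g) = q (zpoly (orbit_prod n i (i + 1)))"
    by (simp add: q_mult q_diff q_zpoly orbit_prod_eq ev.ext_mult ev.ext_diff ext_z[OF i'(1)] ext_z[OF i'(2)]
        q_z[OF i'(1)] q_z[OF i'(2)])
  have "q (zpoly ?g * (z i - z (i + 1))) = q ((z i - z (i + 1)) * zpoly ?g)"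
    using commutes_z_zpoly[OF i'(1), of ?g] commutes_z_zpoly[OF i'(2), of ?g]
    by (simp add: commutes_def q_mult q_diff left_diff_distrib right_diff_distrib)
  then have comm: "cls (zpoly ?g) \<otimes>\<^bsub>H\<^esub> cls (z i - z (i + 1)) = cls (z i - z (i + 1)) \<otimes>\<^bsub>H\<^esub> cls (zpoly ?g)"
    by (intro cls_intertwineI A_polys_car mem)
  have "cls (z i - z (i + 1)) \<otimes>\<^bsub>H\<^esub> cls (zpoly ?g) = cls (zpoly (orbit_prod n i (i + 1)))"
    using q_prod cls_eq_iff[of "(z i - z (i + 1)) * zpoly ?g" "zpoly (orbit_prod n i (i + 1))"]
    by (simp add: mem[THEN A_polys_car] A_polys_car[OF A_polys_zpoly] free_algebra_mult cls_mult)
  then have denom: "cls (z i - z (i + 1)) \<otimes>\<^bsub>H\<^esub> cls (zpoly ?g) \<in> denominators"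
    unfolding denominators_eq using orbit_prod_symmetric[OF i'] orbit_prod_nonzero[of i "i + 1" n] by auto
  have num: "cls (z i - z (i + 1)) \<otimes>\<^bsub>H\<^esub> cls (zpoly ?g) \<otimes>\<^bsub>H\<^esub> cls (t (s i (i + 1))) \<oplus>\<^bsub>H\<^esub>
      cls (scal (c 0)) \<otimes>\<^bsub>H\<^esub> cls (zpoly ?g) \<otimes>\<^bsub>H\<^esub> cls (\<pi> i) = cls (\<sigma>_num i)"
    unfolding \<sigma>_num_def by (simp add: mem[THEN A_polys_car] free_algebra_mult cls_mult cls_add)
  show ?thesis
    unfolding A_loc_def \<iota>_def
  proof (rule loc.fraction_intertwine[where g = "cls (zpoly ?g)"])
    show "\<sigma> i = fraction A denominators (cls (t (s i (i + 1)))) \<one>\<^bsub>A\<^esub> \<oplus>\<^bsub>localization A denominators\<^esub>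
        fraction A denominators (cls (scal (c 0))) \<one>\<^bsub>A\<^esub> \<otimes>\<^bsub>localization A denominators\<^esub>
        inv\<^bsub>localization A denominators\<^esub> (fraction A denominators (cls (z i - z (i + 1))) \<one>\<^bsub>A\<^esub>) \<otimes>\<^bsub>localization A denominators\<^esub>
        fraction A denominators (cls (\<pi> i)) \<one>\<^bsub>A\<^esub>"
      by (simp add: \<sigma>_def \<iota>_def A_loc_def)
    show "f \<in> carrier A" "act (transpose i (i + 1)) f \<in> carrier A"
      using f tt_hom(2)[OF aut f] tt_subset_A by auto
    show "cls (zpoly ?g) \<in> carrier A"
      by (rule A_polys_cls[OF A_polys_zpoly])
    show "cls (z i - z (i + 1)) \<otimes>\<^bsub>A\<^esub> cls (zpoly ?g) \<in> denominators"
      using denom by simp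
    show "cls (zpoly ?g) \<otimes>\<^bsub>A\<^esub> cls (z i - z (i + 1)) = cls (z i - z (i + 1)) \<otimes>\<^bsub>A\<^esub> cls (zpoly ?g)"
      using comm by simp
    show "(cls (z i - z (i + 1)) \<otimes>\<^bsub>A\<^esub> cls (zpoly ?g) \<otimes>\<^bsub>A\<^esub> cls (t (s i (i + 1))) \<oplus>\<^bsub>A\<^esub>
        cls (scal (c 0)) \<otimes>\<^bsub>A\<^esub> cls (zpoly ?g) \<otimes>\<^bsub>A\<^esub> cls (\<pi> i)) \<otimes>\<^bsub>A\<^esub> f =
      act (transpose i (i + 1)) f \<otimes>\<^bsub>A\<^esub>
      (cls (z i - z (i + 1)) \<otimes>\<^bsub>A\<^esub> cls (zpoly ?g) \<otimes>\<^bsub>A\<^esub> cls (t (s i (i + 1))) \<oplus>\<^bsub>A\<^esub>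
        cls (scal (c 0)) \<otimes>\<^bsub>A\<^esub> cls (zpoly ?g) \<otimes>\<^bsub>A\<^esub> cls (\<pi> i))"
      using \<sigma>_num_intertwine[OF act i f] by (simp only: A_simps num)
  qed (use mem[THEN A_polys_cls] in auto)
qed

end

theorem lemma5p3:
  fixes r n :: nat and \<kappa> :: complex and c :: "nat \<Rightarrow> complex"
    and act :: "(nat \<Rightarrow> nat) \<Rightarrow> gen ncpoly set \<Rightarrow> gen ncpoly set"
    and \<phi> :: "gen ncpoly set \<Rightarrow> gen ncpoly set"
  defines "H \<equiv> cherednik.H r n \<kappa> c"
    and "\<tt> \<equiv> cherednik.\<tt> r n \<kappa> c"
    and "A_loc \<equiv> cherednik.A_loc r n \<kappa> c"
    and "\<iota> \<equiv> cherednik.\<iota> r n \<kappa> c"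
    and "\<sigma> \<equiv> cherednik.\<sigma> r n \<kappa> c"
    and "\<Phi> \<equiv> cherednik.\<Phi> r n \<kappa> c"
    and "\<Psi> \<equiv> cherednik.\<Psi> r n \<kappa> c"
  assumes "1 \<le> r" and "1 \<le> n"
    and "cherednik.permutation_action r n \<kappa> c act"
    and "cherednik.shift_automorphism r n \<kappa> c \<phi>"
  shows "(\<forall>i \<in> {1..<n}. \<forall>f \<in> carrier \<tt>.
            \<sigma> i \<otimes>\<^bsub>A_loc\<^esub> \<iota> f = \<iota> (act (transpose i (i + 1)) f) \<otimes>\<^bsub>A_loc\<^esub> \<sigma> i) \<and>
         (\<forall>f \<in> carrier \<tt>.
            f \<otimes>\<^bsub>H\<^esub> \<Phi> = \<Phi> \<otimes>\<^bsub>H\<^esub> \<phi> f \<and>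
            f \<otimes>\<^bsub>H\<^esub> \<Psi> = \<Psi> \<otimes>\<^bsub>H\<^esub> inv_into (carrier \<tt>) \<phi> f)"
proof -
  interpret C: cherednik_pos r n \<kappa> c
    using assms by unfold_locales auto
  \<comment> \<open>\<phi> maps the carrier of \<tt> onto itself, so the relation for \<Psi> can be
    applied to the preimage of f.\<close>
  have inv: "inv_into (carrier C.\<tt>) \<phi> f \<in> carrier C.\<tt>" "\<phi> (inv_into (carrier C.\<tt>) \<phi> f) = f"
    if "f \<in> carrier C.\<tt>" for f
  proof -
    have "\<phi> ` carrier C.\<tt> = carrier C.\<tt>"
      using assms(11) by (auto simp: C.shift_automorphism_def C.algebra_aut_def ring_iso_def bij_betw_def)
    then show "inv_into (carrier C.\<tt>) \<phi> f \<in> carrier C.\<tt>" "\<phi> (inv_into (carrier C.\<tt>) \<phi> f) = f"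
      using that by (simp_all add: inv_into_into f_inv_into_f)
  qed
  show ?thesis
    unfolding assms(1-7)
    using C.\<sigma>_intertwine[OF assms(10)] C.\<Phi>_intertwine[OF assms(11)] C.\<Psi>_intertwine[OF assms(11) inv(1)] inv(2)
    by simp
qed

end
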